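(* Let $A$ be a finite alphabet with $|A|>1$, and let $\xi\colon A\to A^q$ be an injective primitive substitution of constant length $q$ such that for some $\alpha\in A$ the word $\xi(\alpha)$ begins with $\alpha$. Let $(X_\xi,\mu^\xi,T)$ be the associated substitutional dynamical system, let $h(\xi)$ be the height of $\xi$ and $c(\xi)$ its column number (all as defined in the context). Then the sequence $h_n=1+(c(\xi)-h(\xi))\log n$ is a scaling entropy sequence of $(X_\xi,\mu^\xi,T)$.
   Context: Substitutions. A substitution of constant length $q$ on a finite alphabet $A$ is a map $\xi\colon A\to A^q$, extended to finite and infinite words by concatenation; $\xi^n(a)$ is a word of length $q^n$, and $\xi^n(a)_k$, $0\le k<q^n$, denotes its $k$-th letter (indexing from $0$). It is injective if it is injective as a map $A\to A^q$, and primitive if for some $n$ every letter $b\in A$ occurs in $\xi^n(a)$ for every $a\in A$. It is assumed that for some $\alpha\in A$ the first letter of $\xi(\alpha)$ is $\alpha$; then let $u=(u_n)_{n\ge0}\in A^{\mathbb{N}_0}$ be the infinite word starting with $\alpha$ such that $\xi(u)=u$. Let $T$ be the left shift on $A^{\mathbb{N}_0}$ and let $X_\xi$ be the closure of $\{T^nu: n\in\mathbb{N}\}$ in the product topology. For primitive $\xi$ the topological system $(X_\xi,T)$ is minimal and uniquely ergodic; $\mu^\xi$ is its unique invariant probability measure, and $(X_\xi,\mu^\xi,T)$ is regarded as a measure-preserving system, with $T$ an (invertible mod 0) ergodic automorphism. The height $h(\xi)$ is the greatest number $k$ relatively prime to $q$ such that $u_n=u_0$ implies $k\mid n$. The column number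 is $c(\xi)=\min\{|\{\xi^n(a)_k: a\in A\}| : n\in\mathbb{N},\ 0\le k<q^n\}$. Scaling entropy. Let $T$ be an ergodic automorphism of a standard (Lebesgue--Rokhlin) probability space $(X,\mu)$. A semimetric $\rho$ on $X$ is a nonnegative symmetric function on $X\times X$ that vanishes on the diagonal and satisfies the triangle inequality (distinct points may be at distance $0$). It is measurable if it is measurable on $(X^2,\mu^2)$ as a function of two variables. A measurable semimetric is admissible if there is a subset $X_1\subset X$ of full measure such that the semimetric space $(X_1,\rho)$ is separable. It is summable if $\int_{X\times X}\rho\,d(\mu\times\mu)<\infty$. Epsilon-entropy: for $\varepsilon>0$ let $k\in\mathbb{N}=\{1,2,\dots\}$ be the least number such that $X$ can be partitioned into disjoint measurable sets $X_0,X_1,\dots,X_k$ with $\mu(X_0)<\varepsilon$ and with the $\rho$-diameter of $X_j$ less than $\varepsilon$ for each $j=1,\dots,k$. Put $\mathbb{H}_\varepsilon(X,\mu,\rho)=\log_2 k$, and $\mathbb{H}_\varepsilon(X,\mu,\rho)=+\infty$ if no such $k$ exists. For $k\in\mathbb{Z}$ put $T^k\rho(x,y)=\rho(T^kx,T^ky)$, and for $n\ge 1$ put $T^n_{av}\rho=\frac1n\sum_{k=0}^{n-1}T^k\rho$. A measurable semimetric $\rho$ is (two-sided) generating for $(X,\mu,T)$ if there is a measurable set $X'\subset X$ of full measure such that for any two distinct $x,y\in X'$ there exists $k\in\mathbb{Z}$ with $T^k\rho(x,y)>0$. For an admissible semimetric $\rho$, a sequence $\{h_n\}$ of positive numbers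 is a scaling sequence for $\rho$ if for every $\varepsilon>0$ one has $\limsup_n \mathbb{H}_\varepsilon(X,\mu,T^n_{av}\rho)/h_n<+\infty$, and for all sufficiently small $\varepsilon>0$ one has $\liminf_n \mathbb{H}_\varepsilon(X,\mu,T^n_{av}\rho)/h_n>0$. A sequence of positive numbers is a scaling entropy sequence of $(X,\mu,T)$ if it is a scaling sequence for some (and then for any) summable admissible generating semimetric $\rho$ on $(X,\mu)$. *)

theory Defs
  imports "HOL-Probability.Probability"
begin

section \<open>Substitutions of constant length\<close>

type_synonym 'a subst = "'a \<Rightarrow> 'a list"

definition constant_length :: "nat \<Rightarrow> 'a subst \<Rightarrow> bool" where
  "constant_length q \<xi> \<longleftrightarrow> (\<forall>a. length (\<xi> a) = q)"

definition subst_word :: "'a subst \<Rightarrow> 'a list \<Rightarrow> 'a list" where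
  "subst_word \<xi> w = concat (map \<xi> w)"

definition subst_iter :: "'a subst \<Rightarrow> nat \<Rightarrow> 'a \<Rightarrow> 'a list" where
  "subst_iter \<xi> n a = (subst_word \<xi> ^^ n) [a]"

text \<open>Extension to infinite words. When every image is nonempty, the image of the prefix
  of length \<open>n + 1\<close> already has more than \<open>n\<close> letters, so its \<open>n\<close>-th letter is
  the \<open>n\<close>-th letter of the infinite concatenation.\<close>

definition subst_inf :: "'a subst \<Rightarrow> (nat \<Rightarrow> 'a) \<Rightarrow> nat \<Rightarrow> 'a" where
  "subst_inf \<xi> u n = subst_word \<xi> (map u [0..<Suc n]) ! n"

definition primitive_subst :: "'a subst \<Rightarrow> bool" where
  "primitive_subst \<xi> \<longleftrightarrow> (\<exists>n\<ge>1. \<forall>a b. b \<in> set (subst_iter \<xi> n a))"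

definition subst_height :: "nat \<Rightarrow> (nat \<Rightarrow> 'a) \<Rightarrow> nat" where
  "subst_height q u = (GREATEST k. coprime k q \<and> (\<forall>n. u n = u 0 \<longrightarrow> k dvd n))"

definition column_number :: "nat \<Rightarrow> 'a subst \<Rightarrow> nat" where
  "column_number q \<xi> =
     Min {card (range (\<lambda>a. subst_iter \<xi> n a ! k)) | n k. n \<ge> 1 \<and> k < q ^ n}"

definition word_shift :: "(nat \<Rightarrow> 'a) \<Rightarrow> nat \<Rightarrow> 'a" where
  "word_shift u = (\<lambda>n. u (Suc n))"

definition word_topology :: "(nat \<Rightarrow> 'a) topology" where
  "word_topology = product_topology (\<lambda>_. discrete_topology UNIV) UNIV"

definition orbit_closure :: "(nat \<Rightarrow> 'a) \<Rightarrow> (nat \<Rightarrow> 'a) set" where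
  "orbit_closure u = word_topology closure_of {(word_shift ^^ n) u | n. n \<ge> 1}"

definition invariant_borel_prob ::
    "'x topology \<Rightarrow> 'x set \<Rightarrow> ('x \<Rightarrow> 'x) \<Rightarrow> 'x measure \<Rightarrow> bool" where
  "invariant_borel_prob \<T> X T M \<longleftrightarrow>
     prob_space M \<and>
     space M = X \<and> sets M = sigma_sets X {U. openin (subtopology \<T> X) U} \<and>
     T \<in> measurable M M \<and> distr M M T = M"


section \<open>Scaling entropy\<close>

text \<open>The measure \<open>M\<close> below stands for the (complete) measure of a Lebesgue--Rokhlin
  probability space; accordingly, measurability in two variables refers to the completion of
  the product measure.\<close>

definition full_measure :: "'x measure \<Rightarrow> 'x set \<Rightarrow> bool" where
  "full_measure M S \<longleftrightarrow> S \<in> sets M \<and> space M - S \<in> null_sets M"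

definition semimetric_on :: "'x set \<Rightarrow> ('x \<Rightarrow> 'x \<Rightarrow> real) \<Rightarrow> bool" where
  "semimetric_on X \<rho> \<longleftrightarrow>
     (\<forall>x\<in>X. \<forall>y\<in>X. 0 \<le> \<rho> x y) \<and>
     (\<forall>x\<in>X. \<rho> x x = 0) \<and>
     (\<forall>x\<in>X. \<forall>y\<in>X. \<rho> x y = \<rho> y x) \<and>
     (\<forall>x\<in>X. \<forall>y\<in>X. \<forall>z\<in>X. \<rho> x z \<le> \<rho> x y + \<rho> y z)"

definition measurable_semimetric :: "'x measure \<Rightarrow> ('x \<Rightarrow> 'x \<Rightarrow> real) \<Rightarrow> bool" where
  "measurable_semimetric M \<rho> \<longleftrightarrow>
     semimetric_on (space M) \<rho> \<and>
     case_prod \<rho> \<in> borel_measurable (completion (M \<Otimes>\<^sub>M M))"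

definition admissible_semimetric :: "'x measure \<Rightarrow> ('x \<Rightarrow> 'x \<Rightarrow> real) \<Rightarrow> bool" where
  "admissible_semimetric M \<rho> \<longleftrightarrow>
     measurable_semimetric M \<rho> \<and>
     (\<exists>X\<^sub>1. full_measure M X\<^sub>1 \<and>
        (\<exists>D\<subseteq>X\<^sub>1. countable D \<and> (\<forall>x\<in>X\<^sub>1. \<forall>\<epsilon>>0. \<exists>d\<in>D. \<rho> x d < \<epsilon>)))"

definition summable_semimetric :: "'x measure \<Rightarrow> ('x \<Rightarrow> 'x \<Rightarrow> real) \<Rightarrow> bool" where
  "summable_semimetric M \<rho> \<longleftrightarrow>
     measurable_semimetric M \<rho> \<and>
     (\<integral>\<^sup>+ p. ennreal (case_prod \<rho> p) \<partial>completion (M \<Otimes>\<^sub>M M)) < \<infinity>"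

definition semimetric_diam :: "('x \<Rightarrow> 'x \<Rightarrow> real) \<Rightarrow> 'x set \<Rightarrow> ennreal" where
  "semimetric_diam \<rho> S = (SUP (x, y)\<in>S \<times> S. ennreal (\<rho> x y))"

definition eps_partition ::
    "'x measure \<Rightarrow> ('x \<Rightarrow> 'x \<Rightarrow> real) \<Rightarrow> real \<Rightarrow> nat \<Rightarrow> (nat \<Rightarrow> 'x set) \<Rightarrow> bool" where
  "eps_partition M \<rho> \<epsilon> k P \<longleftrightarrow>
     (\<forall>j\<le>k. P j \<in> sets M) \<and> disjoint_family_on P {..k} \<and> (\<Union>j\<le>k. P j) = space M \<and>
     emeasure M (P 0) < ennreal \<epsilon> \<and>
     (\<forall>j\<in>{1..k}. semimetric_diam \<rho> (P j) < ennreal \<epsilon>)"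

definition eps_entropy :: "'x measure \<Rightarrow> ('x \<Rightarrow> 'x \<Rightarrow> real) \<Rightarrow> real \<Rightarrow> ereal" where
  "eps_entropy M \<rho> \<epsilon> =
     (if \<exists>k\<ge>1. \<exists>P. eps_partition M \<rho> \<epsilon> k P
      then ereal (log 2 (real (LEAST k. k \<ge> 1 \<and> (\<exists>P. eps_partition M \<rho> \<epsilon> k P))))
      else \<infinity>)"

definition semimetric_avg ::
    "('x \<Rightarrow> 'x) \<Rightarrow> nat \<Rightarrow> ('x \<Rightarrow> 'x \<Rightarrow> real) \<Rightarrow> 'x \<Rightarrow> 'x \<Rightarrow> real" where
  "semimetric_avg T n \<rho> x y = (\<Sum>k<n. \<rho> ((T ^^ k) x) ((T ^^ k) y)) / real n"

definition iter_int_on :: "'x set \<Rightarrow> ('x \<Rightarrow> 'x) \<Rightarrow> int \<Rightarrow> 'x \<Rightarrow> 'x" where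
  "iter_int_on X T k = (if 0 \<le> k then T ^^ nat k else inv_into X T ^^ nat (- k))"

text \<open>The transformation is only assumed to be invertible mod 0. Its negative powers are taken
  on a set \<open>X'\<close> of full measure which it maps bijectively onto itself; the requirement
  on \<open>X'\<close> costs no generality, since any set of full measure contains such a subset, on which
  different choices of the inverse agree.\<close>

definition generating_semimetric ::
    "'x measure \<Rightarrow> ('x \<Rightarrow> 'x) \<Rightarrow> ('x \<Rightarrow> 'x \<Rightarrow> real) \<Rightarrow> bool" where
  "generating_semimetric M T \<rho> \<longleftrightarrow>
     measurable_semimetric M \<rho> \<and>
     (\<exists>X'. full_measure M X' \<and> bij_betw T X' X' \<and>
        (\<forall>x\<in>X'. \<forall>y\<in>X'. x \<noteq> y \<longrightarrow>
           (\<exists>k::int. \<rho> (iter_int_on X' T k x) (iter_int_on X' T k y) > 0)))"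

definition scaling_sequence ::
    "'x measure \<Rightarrow> ('x \<Rightarrow> 'x) \<Rightarrow> ('x \<Rightarrow> 'x \<Rightarrow> real) \<Rightarrow> (nat \<Rightarrow> real) \<Rightarrow> bool" where
  "scaling_sequence M T \<rho> h \<longleftrightarrow>
     (\<forall>\<epsilon>>0. limsup (\<lambda>n. eps_entropy M (semimetric_avg T n \<rho>) \<epsilon> / ereal (h n)) < \<infinity>) \<and>
     (\<forall>\<^sub>F \<epsilon> in at_right 0.
        liminf (\<lambda>n. eps_entropy M (semimetric_avg T n \<rho>) \<epsilon> / ereal (h n)) > 0)"

text \<open>Sequences are indexed by \<open>n \<ge> 1\<close>; the value at \<open>0\<close> is irrelevant.\<close>

definition scaling_entropy_sequence ::
    "'x measure \<Rightarrow> ('x \<Rightarrow> 'x) \<Rightarrow> (nat \<Rightarrow> real) \<Rightarrow> bool" where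
  "scaling_entropy_sequence M T h \<longleftrightarrow>
     (\<forall>n\<ge>1. h n > 0) \<and>
     (\<exists>\<rho>. summable_semimetric M \<rho> \<and> admissible_semimetric M \<rho> \<and>
        generating_semimetric M T \<rho> \<and> scaling_sequence M T \<rho> h)"

end

(* Take the cut semimetric [x 0 ~= y 0], so that averaged distances are normalised Hamming distances
   of initial words. Points with the same residue modulo q^m ("phase") and the same residue modulo the
   height h disagree, when c = h, only on a set of density tending to 0 with m, because some column
   merges all letters of a class; hence bounded entropy. In general a partition by words of length n
   gives O(log n). Conversely, identify letters whose columns can always be made to coincide. The
   quotient word is fixed by an injective substitution, and if c > h it is not periodic, hence
   recognizable: words of some length L determine the phase modulo q. Applying this at every level,
   points with different phases modulo q^m, q^m of order n, stay at a Hamming distance bounded below.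
   The q^m phase classes have equal measure, so order of n sets are needed. *)
theory Submission
  imports Defs "HOL-Number_Theory.Cong" "HOL-Real_Asymp.Real_Asymp"
begin

text \<open>Only whether \<open>c - h\<close> vanishes affects the growth rate; its value is
  absorbed into constants. The obstacle in the lower bound is that telling phases apart is not
  enough: words of \<open>u\<close> with different phases might differ in few places, because
  distinct letters can have images that agree in almost every column. After the identification this
  cannot happen. Two letters of different classes have, at a bounded level, a column leading to two
  letters that never coincide in any column, so their iterated blocks differ in a fixed proportion
  of positions. Nonperiodicity of the quotient is where \<open>c\<close> and \<open>h\<close> are
  compared: if the quotient were periodic, its least period would be coprime to \<open>q\<close> and
  divide all return times of the letter \<open>u 0\<close>, hence be at most \<open>h\<close>; but a
  column with the fewest letters has \<open>c\<close> letters in distinct classes, so the period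
  would be at least \<open>c\<close>. Recognizability, in turn, rests on linear complexity, which
  leaves only finitely many pairs of points that differ exactly in their first letter.\<close>

section \<open>Prefixes, orbit hulls and compactness\<close>

definition init_word :: "nat \<Rightarrow> (nat \<Rightarrow> 'a) \<Rightarrow> 'a list" where
  "init_word L x = map x [0..<L]"

lemma init_word_eq_iff: "init_word L x = init_word L y \<longleftrightarrow> (\<forall>i<L. x i = y i)"
  unfolding init_word_def by auto

lemma init_word_eq_mono: "init_word L x = init_word L y \<Longrightarrow> M \<le> L \<Longrightarrow> init_word M x = init_word M y"
  unfolding init_word_eq_iff by auto

lemma finite_range_init_word: "finite (range (init_word L :: (nat \<Rightarrow> 'a::finite) \<Rightarrow> _))"
  by (rule finite_subset[OF _ finite_lists_length_eq[of UNIV L]]) (auto simp: init_word_def)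

lemma word_shift_pow: "(word_shift ^^ n) x = (\<lambda>i. x (n + i))"
  by (induction n) (auto simp: word_shift_def)

text \<open>The orbit closure expressed through words instead of open sets, so that the same
  arguments serve \<open>u\<close> and its quotient; \<open>orbit_closure_eq\<close> makes the link
  with the topology.\<close>

definition orbit_hull :: "(nat \<Rightarrow> 'a) \<Rightarrow> (nat \<Rightarrow> 'a) set" where
  "orbit_hull v = {x. \<forall>L. \<exists>s. init_word L x = init_word L (\<lambda>i. v (s + i))}"

lemma hullD: "x \<in> orbit_hull v \<Longrightarrow> \<exists>s. init_word L x = init_word L (\<lambda>i. v (s + i))"
  unfolding orbit_hull_def by auto

lemma hull_shift: "x \<in> orbit_hull v \<Longrightarrow> (\<lambda>i. x (n + i)) \<in> orbit_hull v"
  unfolding orbit_hull_def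
proof (clarify)
  fix L assume "\<forall>L. \<exists>s. init_word L x = init_word L (\<lambda>i. v (s + i))"
  then obtain s where "init_word (n + L) x = init_word (n + L) (\<lambda>i. v (s + i))" by blast
  then have "init_word L (\<lambda>i. x (n + i)) = init_word L (\<lambda>i. v ((s + n) + i))"
    unfolding init_word_eq_iff by (simp add: add.assoc)
  then show "\<exists>s. init_word L (\<lambda>i. x (n + i)) = init_word L (\<lambda>i. v (s + i))" by blast
qed

lemma self_hull: "v \<in> orbit_hull v"
  unfolding orbit_hull_def by (auto intro!: exI[of _ 0])

text \<open>Koenig's lemma: a prefix shared by infinitely many of the words \<open>s n\<close> can
  be extended by one letter and still be shared by infinitely many, the alphabet being finite.
  Infinitely many choices also allow \<open>n \<ge> L\<close>, so a limit inherits properties that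
  \<open>s n\<close> has only on its first \<open>n\<close> letters.\<close>

lemma compactness_words:
  fixes s :: "nat \<Rightarrow> nat \<Rightarrow> 'b::finite"
  shows "\<exists>z. \<forall>L. \<exists>n\<ge>L. init_word L z = init_word L (s n)"
proof -
  define P where "P = (\<lambda>L z. infinite {n. init_word L z = init_word L (s n)})"
  have "\<exists>z. \<forall>n. P n (z n) \<and> init_word n (z n) = init_word n (z (Suc n))"
  proof (rule dependent_nat_choice)
    show "\<exists>z. P 0 z" by (auto simp: P_def init_word_def)
  next
    fix z n assume "P n z"
    then have inf: "infinite {k. init_word n z = init_word n (s k)}" by (simp add: P_def)
    have "\<exists>b\<in>UNIV. infinite {k\<in>{k. init_word n z = init_word n (s k)}. s k n = b}"
      using inf by (intro pigeonhole_infinite_rel) auto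
    then obtain b where b: "infinite {k\<in>{k. init_word n z = init_word n (s k)}. s k n = b}" by auto
    have "{k\<in>{k. init_word n z = init_word n (s k)}. s k n = b} \<subseteq> {k. init_word (Suc n) (z(n := b)) = init_word (Suc n) (s k)}"
      by (auto simp: init_word_eq_iff less_Suc_eq)
    then have "P (Suc n) (z(n := b))" unfolding P_def using b infinite_super by blast
    moreover have "init_word n z = init_word n (z(n := b))" by (auto simp: init_word_eq_iff)
    ultimately show "\<exists>z'. P (Suc n) z' \<and> init_word n z = init_word n z'" by blast
  qed
  then obtain z where z: "\<And>n. P n (z n)" "\<And>n. init_word n (z n) = init_word n (z (Suc n))" by blast
  define y where "y = (\<lambda>i. z (Suc i) i)"
  have *: "z n i = z (Suc i) i" if "Suc i \<le> n" for n i
    using that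
  proof (induction n rule: dec_induct)
    case (step n)
    then have "z (Suc n) i = z n i" using z(2)[of n] by (auto simp: init_word_eq_iff)
    then show ?case using step by simp
  qed simp
  have "\<exists>n\<ge>L. init_word L y = init_word L (s n)" for L
  proof -
    have "init_word L y = init_word L (z L)" unfolding init_word_eq_iff y_def using *[of _ L] by (metis Suc_leI)
    moreover have "\<exists>n\<ge>L. init_word L (z L) = init_word L (s n)"
      using z(1)[of L] unfolding P_def infinite_nat_iff_unbounded_le by blast
    ultimately show ?thesis by simp
  qed
  then show ?thesis by blast
qed

section \<open>Complexity and recurrence of fixed words\<close>

text \<open>Abstracts what \<open>u\<close> and its quotient have in common. Injectivity is demanded
  on letters that occur in \<open>v\<close>: for the quotient, the block map is meaningful on
  representatives of classes, not on the whole alphabet.\<close>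

locale automatic_sequence =
  fixes q :: nat and f :: "'a::finite \<Rightarrow> nat \<Rightarrow> 'a" and v :: "nat \<Rightarrow> 'a"
  assumes q_ge_2: "2 \<le> q"
    and fixed: "i < q \<Longrightarrow> v (q * n + i) = f (v n) i"
    and recurrent: "\<exists>R. \<forall>s t. \<exists>r\<le>R. init_word L (\<lambda>i. v (s + r + i)) = init_word L (\<lambda>i. v (t + i))"
    and blocks_inj: "(\<And>i. i < q \<Longrightarrow> f (v m) i = f (v n) i) \<Longrightarrow> v m = v n"
begin

lemma q_pos: "0 < q" and q_gt_1: "1 < q"
  using q_ge_2 by auto

lemma block_determined:
  "v n = v n' \<Longrightarrow> k < q ^ m \<Longrightarrow> v (q ^ m * n + k) = v (q ^ m * n' + k)"
proof (induction m arbitrary: k)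
  case (Suc m)
  have k: "k div q < q ^ m" using Suc.prems(2) by (simp add: less_mult_imp_div_less mult.commute)
  have "q ^ Suc m * l + k = q * (q ^ m * l + k div q) + k mod q" for l
    by (simp add: algebra_simps)
  then have "v (q ^ Suc m * l + k) = f (v (q ^ m * l + k div q)) (k mod q)" for l
    using fixed[of "k mod q"] q_pos by simp
  then show ?case using Suc.IH[OF Suc.prems(1) k] by simp
qed simp

definition factors :: "nat \<Rightarrow> 'a list set" where
  "factors L = range (\<lambda>s. init_word L (\<lambda>i. v (s + i)))"

lemma finite_factors: "finite (factors L)"
  unfolding factors_def by (rule finite_subset[OF _ finite_range_init_word[of L]]) auto

text \<open>A window of length \<open>q ^ m\<close> meets at most two consecutive blocks of level
  \<open>m\<close>, so the two underlying letters and the offset, collected in \<open>key\<close>,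
  determine it.\<close>

lemma card_factors_power: "card (factors (q ^ m)) \<le> CARD('a)\<^sup>2 * q ^ m"
proof -
  define Q where "Q = q ^ m"
  have Q: "0 < Q" using q_pos by (simp add: Q_def)
  define key where "key = (\<lambda>s. (v (s div Q), v (Suc (s div Q)), s mod Q))"
  have keyeq: "init_word Q (\<lambda>i. v (s + i)) = init_word Q (\<lambda>i. v (t + i))" if "key s = key t" for s t
    unfolding init_word_eq_iff
  proof (intro allI impI)
    fix i assume i: "i < Q"
    have h: "v (s div Q) = v (t div Q)" "v (Suc (s div Q)) = v (Suc (t div Q))" "s mod Q = t mod Q"
      using that by (auto simp: key_def)
    have dec: "r + i = Q * (r div Q) + (r mod Q + i)" for r by (metis add.assoc mult_div_mod_eq)
    show "v (s + i) = v (t + i)"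
    proof (cases "s mod Q + i < Q")
      case True
      then have "v (Q * (s div Q) + (s mod Q + i)) = v (Q * (t div Q) + (t mod Q + i))"
        using block_determined[OF h(1), of "s mod Q + i" m] h(3) by (simp only: Q_def)
      then show ?thesis by (simp only: dec[symmetric])
    next
      case False
      have dec': "r + i = Q * (Suc (r div Q)) + (r mod Q + i - Q)" if "r mod Q + i \<ge> Q" for r
        using dec[of r] that by simp
      have "s mod Q + i - Q < q ^ m" using i mod_less_divisor[OF Q, of s] by (simp add: Q_def)
      then have "v (Q * Suc (s div Q) + (s mod Q + i - Q)) = v (Q * Suc (t div Q) + (t mod Q + i - Q))"
        using block_determined[OF h(2), of "s mod Q + i - Q" m] h(3) by (simp only: Q_def)
      then show ?thesis using dec'[of s] dec'[of t] h(3) False by (simp only: not_less)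
    qed
  qed
  define g where "g = (\<lambda>k. init_word Q (\<lambda>i. v ((SOME s. key s = k) + i)))"
  have "factors Q \<subseteq> g ` range key"
  proof -
    have "init_word Q (\<lambda>i. v (s + i)) = g (key s)" for s
    proof -
      have "key (SOME t. key t = key s) = key s" by (rule someI) (rule refl)
      from keyeq[OF this[symmetric]] show ?thesis by (simp only: g_def)
    qed
    then show ?thesis unfolding factors_def by auto
  qed
  moreover have sub: "range key \<subseteq> UNIV \<times> UNIV \<times> {..<Q}" using Q by (auto simp: key_def)
  moreover have fin: "finite (range key)" by (rule finite_subset[OF sub]) auto
  ultimately have "card (factors Q) \<le> card (range key)"
    by (meson card_image_le card_mono finite_imageI le_trans)
  also have "\<dots> \<le> card (UNIV \<times> UNIV \<times> {..<Q} :: ('a \<times> 'a \<times> nat) set)"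
    by (rule card_mono[OF _ sub]) auto
  finally show ?thesis by (simp add: card_cartesian_product Q_def power2_eq_square mult.assoc)
qed

lemma card_factors_mono: "L \<le> M \<Longrightarrow> card (factors L) \<le> card (factors M)"
proof -
  assume LM: "L \<le> M"
  have "factors L \<subseteq> take L ` factors M"
    unfolding factors_def init_word_def using LM by (auto simp: take_map min_def image_iff)
  then show ?thesis by (meson card_image_le card_mono finite_factors finite_imageI le_trans)
qed

text \<open>The extra factor \<open>q\<close> is the price of rounding \<open>n\<close> up to a
  power of \<open>q\<close>.\<close>

lemma card_factors_linear: 
  assumes "1 \<le> n" shows "card (factors n) \<le> CARD('a)\<^sup>2 * q * n"
proof -
  have ex: "\<exists>m. n \<le> q ^ m" using q_gt_1
    by (metis less_exp le_trans less_imp_le power_mono[OF q_ge_2, of n] zero_le)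
  define m where "m = (LEAST m. n \<le> q ^ m)"
  have m: "n \<le> q ^ m" unfolding m_def by (rule LeastI_ex[OF ex])
  have "q ^ m \<le> q * n"
  proof (cases m)
    case 0 then show ?thesis using assms q_pos by simp
  next
    case (Suc k)
    then have "\<not> n \<le> q ^ k" unfolding m_def using not_less_Least[of k "\<lambda>m. n \<le> q ^ m"] by (simp add: m_def)
    then show ?thesis using Suc by simp
  qed
  then have "CARD('a)\<^sup>2 * q ^ m \<le> CARD('a)\<^sup>2 * (q * n)" by (rule mult_left_mono) simp
  then show ?thesis using card_factors_mono[OF m] card_factors_power[of m]
    unfolding mult.assoc by linarith
qed

lemma occurs_later: "\<exists>r. init_word L (\<lambda>i. v (s + r + i)) = init_word L (\<lambda>i. v (t + i))"
  using recurrent[of L] by blast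

lemma hull_occurs_later:
  assumes "x \<in> orbit_hull v" shows "\<exists>s\<ge>N. init_word L x = init_word L (\<lambda>i. v (s + i))"
proof -
  obtain t where "init_word L x = init_word L (\<lambda>i. v (t + i))" using hullD[OF assms] by blast
  moreover obtain r where "init_word L (\<lambda>i. v (N + r + i)) = init_word L (\<lambda>i. v (t + i))"
    using occurs_later by blast
  ultimately show ?thesis by (intro exI[of _ "N + r"]) simp
qed

text \<open>Recurrence gives each prefix of \<open>z\<close> an occurrence at a positive position;
  the words starting one letter earlier have a limit point, which is the preimage.\<close>

lemma hull_preimage:
  assumes "z \<in> orbit_hull v" shows "\<exists>x\<in>orbit_hull v. \<forall>i. x (Suc i) = z i"
proof -
  have "\<exists>s. init_word L z = init_word L (\<lambda>i. v (Suc s + i))" for L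
    using hull_occurs_later[OF assms, of 1 L] by (metis Suc_le_D One_nat_def)
  then obtain s where s: "\<And>L. init_word L z = init_word L (\<lambda>i. v (Suc (s L) + i))" by metis
  obtain x where x: "\<And>L. \<exists>n\<ge>L. init_word L x = init_word L (\<lambda>i. v (s n + i))"
    using compactness_words[of "\<lambda>n i. v (s n + i)"] by blast
  have "x \<in> orbit_hull v" unfolding orbit_hull_def using x by blast
  moreover have "x (Suc i) = z i" for i
  proof -
    obtain n where n: "n \<ge> Suc (Suc i)" "init_word (Suc (Suc i)) x = init_word (Suc (Suc i)) (\<lambda>i. v (s n + i))"
      using x by blast
    then show ?thesis using s[of n] by (auto simp: init_word_eq_iff)
  qed
  ultimately show ?thesis by blast
qed

lemma hull_uniformly_recurrent:
  "\<exists>R. \<forall>x\<in>orbit_hull v. \<forall>t. \<exists>r\<le>R. init_word L (\<lambda>i. x (r + i)) = init_word L (\<lambda>i. v (t + i))"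
proof -
  obtain R where R: "\<And>s t. \<exists>r\<le>R. init_word L (\<lambda>i. v (s + r + i)) = init_word L (\<lambda>i. v (t + i))"
    using recurrent[of L] by blast
  have "\<exists>r\<le>R. init_word L (\<lambda>i. x (r + i)) = init_word L (\<lambda>i. v (t + i))" if x: "x \<in> orbit_hull v" for x t
  proof -
    obtain s where s: "init_word (R + L) x = init_word (R + L) (\<lambda>i. v (s + i))" using hullD[OF x] by blast
    obtain r where r: "r \<le> R" "init_word L (\<lambda>i. v (s + r + i)) = init_word L (\<lambda>i. v (t + i))" using R by blast
    have "init_word L (\<lambda>i. x (r + i)) = init_word L (\<lambda>i. v (s + r + i))"
      using s r(1) unfolding init_word_eq_iff by (simp add: add.assoc)
    then show ?thesis using r by auto
  qed
  then show ?thesis by blast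
qed

section \<open>Asymptotic pairs and recognizability\<close>

text \<open>Such a pair is a failure of injectivity of the shift in its purest form; the common
  tails, collected in \<open>left_special\<close>, are the infinite words with at least two left
  extensions.\<close>

definition asymptotic_pairs :: "((nat \<Rightarrow> 'a) \<times> (nat \<Rightarrow> 'a)) set" where
  "asymptotic_pairs = {(x, y). x \<in> orbit_hull v \<and> y \<in> orbit_hull v \<and> x 0 \<noteq> y 0 \<and> (\<forall>i. x (Suc i) = y (Suc i))}"

definition left_special :: "(nat \<Rightarrow> 'a) set" where
  "left_special = (\<lambda>(x, y) i. x (Suc i)) ` asymptotic_pairs"

text \<open>Every factor of length \<open>n\<close> has a left extension, chosen by \<sigma>. A
  prefix of a left special word has a second one, chosen by \<tau>, and the two choices never
  collide.\<close>

lemma factors_growth: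
  assumes S: "finite S" "S \<subseteq> left_special" "inj_on (init_word n) S"
  shows "card (factors n) + card S \<le> card (factors (Suc n))"
proof -
  have tlp: "tl (init_word (Suc n) x) = init_word n (\<lambda>i. x (Suc i))" for x :: "nat \<Rightarrow> 'a"
    by (rule nth_equalityI) (simp_all add: init_word_def nth_tl del: upt_Suc)
  have hullf: "init_word L x \<in> factors L" if "x \<in> orbit_hull v" for x L
    using hullD[OF that, of L] by (auto simp: factors_def)
  have hdp: "hd (init_word (Suc n) x) = x 0" for x :: "nat \<Rightarrow> 'a"
    unfolding init_word_def by (simp add: upt_conv_Cons del: upt_Suc)
  have ex1: "\<exists>w\<in>factors (Suc n). tl w = z" if z: "z \<in> factors n" for z
  proof -
    obtain t where t: "z = init_word n (\<lambda>i. v (t + i))" using z by (auto simp: factors_def)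
    obtain r where "init_word n (\<lambda>i. v (1 + r + i)) = z" using occurs_later[of n 1 t] t by auto
    then have "tl (init_word (Suc n) (\<lambda>i. v (r + i))) = z" unfolding tlp by simp
    then show ?thesis by (auto simp: factors_def)
  qed
  then obtain \<sigma> where \<sigma>: "\<And>z. z \<in> factors n \<Longrightarrow> \<sigma> z \<in> factors (Suc n) \<and> tl (\<sigma> z) = z" by metis
  have ex2: "\<exists>w\<in>factors (Suc n). tl w = init_word n z \<and> w \<noteq> \<sigma> (init_word n z)" if z: "z \<in> S" for z
  proof -
    obtain x y where xy: "x \<in> orbit_hull v" "y \<in> orbit_hull v" "x 0 \<noteq> y 0" "\<And>i. x (Suc i) = y (Suc i)" "z = (\<lambda>i. x (Suc i))"
      using z S(2) by (auto simp: left_special_def asymptotic_pairs_def)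
    have "init_word (Suc n) x \<noteq> init_word (Suc n) y" using hdp[of x] hdp[of y] xy(3) by auto
    moreover have "tl (init_word (Suc n) x) = init_word n z" "tl (init_word (Suc n) y) = init_word n z"
      unfolding tlp using xy by auto
    moreover have "init_word (Suc n) x \<in> factors (Suc n)" "init_word (Suc n) y \<in> factors (Suc n)"
      using hullf xy by auto
    ultimately show ?thesis by metis
  qed
  then obtain \<tau> where \<tau>: "\<And>z. z \<in> S \<Longrightarrow> \<tau> z \<in> factors (Suc n) \<and> tl (\<tau> z) = init_word n z \<and> \<tau> z \<noteq> \<sigma> (init_word n z)"
    by metis
  have "inj_on \<sigma> (factors n)" by (rule inj_on_inverseI[of _ tl]) (use \<sigma> in auto)
  then have c1: "card (\<sigma> ` factors n) = card (factors n)" by (rule card_image)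
  have "inj_on \<tau> S" using \<tau> S(3) unfolding inj_on_def by metis
  then have c2: "card (\<tau> ` S) = card S" by (rule card_image)
  have "init_word n z \<in> factors n" if "z \<in> S" for z
  proof -
    have "z \<in> orbit_hull v" using that S(2) hull_shift[where n=1]
      by (force simp: left_special_def asymptotic_pairs_def)
    then show ?thesis by (rule hullf)
  qed
  have "\<sigma> ` factors n \<inter> \<tau> ` S = {}"
  proof (rule ccontr)
    assume "\<sigma> ` factors n \<inter> \<tau> ` S \<noteq> {}"
    then obtain z y where zy: "z \<in> factors n" "y \<in> S" "\<sigma> z = \<tau> y" by blast
    then have "z = init_word n y" using \<sigma>[OF zy(1)] \<tau>[OF zy(2)] by simp
    then show False using \<tau>[OF zy(2)] zy(3) by simp
  qed
  then have "card (\<sigma> ` factors n \<union> \<tau> ` S) = card (factors n) + card S"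
    using c1 c2 finite_factors S(1) by (simp add: card_Un_disjoint)
  moreover have "\<sigma> ` factors n \<union> \<tau> ` S \<subseteq> factors (Suc n)" using \<sigma> \<tau> by auto
  ultimately show ?thesis using card_mono[OF finite_factors] by metis
qed

lemma eventually_separated:
  assumes "finite (S :: (nat \<Rightarrow> 'a) set)" shows "\<exists>N. \<forall>n\<ge>N. inj_on (init_word n) S"
proof -
  have "\<exists>N. \<forall>n\<ge>N. init_word n x = init_word n y \<longrightarrow> x = y" for x y :: "nat \<Rightarrow> 'a"
  proof (cases "x = y")
    case False
    then obtain i where i: "x i \<noteq> y i" by auto
    then show ?thesis by (intro exI[of _ "Suc i"]) (auto simp: init_word_eq_iff Suc_le_eq)
  qed simp
  then obtain N where N: "\<And>x y n. n \<ge> N x y \<Longrightarrow> init_word n x = init_word n y \<Longrightarrow> x = (y :: nat \<Rightarrow> 'a)" by metis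
  define M where "M = Max (insert 0 ((\<lambda>(x, y). N x y) ` (S \<times> S)))"
  have "N x y \<le> M" if "x \<in> S" "y \<in> S" for x y
    unfolding M_def using that assms by (intro Max_ge) auto
  note NM = this
  have "inj_on (init_word n) S" if "n \<ge> M" for n
  proof (rule inj_onI)
    fix x y assume "x \<in> S" "y \<in> S" "init_word n x = init_word n y"
    then show "x = y" using N[of x y n] NM[of x y] that by simp
  qed
  then show ?thesis by blast
qed

text \<open>Many left special words would make the complexity grow with a larger slope than the
  linear bound allows.\<close>

lemma finite_left_special: "finite left_special"
proof (rule ccontr)
  assume "infinite left_special"
  \<comment> \<open>More than twice the slope of the complexity bound: once prefixes of length
    \<open>N\<close> separate \<open>S\<close>, at length \<open>q ^ (2 * N) \<ge> 2 * N\<close> the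
    growth has lasted for at least half of the length.\<close>
  define M where "M = 2 * CARD('a)\<^sup>2 + 1"
  obtain S where S: "S \<subseteq> left_special" "finite S" "card S = M"
    using infinite_arbitrarily_large[OF \<open>infinite left_special\<close>] by blast
  obtain N where N: "\<And>n. n \<ge> N \<Longrightarrow> inj_on (init_word n) S" using eventually_separated[OF S(2)] by blast
  have grow: "k * M \<le> card (factors (N + k))" for k
  proof (induction k)
    case (Suc k)
    then show ?case using factors_growth[OF S(2,1) N[of "N + k"]] S(3) by simp
  qed simp
  have "2 * N \<le> q ^ (2 * N)" using power_mono[OF q_ge_2, of "2 * N"] less_exp[of "2*N"] by linarith
  moreover have "0 < q ^ (2*N)" using q_pos by simp
  ultimately have "(q ^ (2*N) - N) * M > CARD('a)\<^sup>2 * q ^ (2*N)"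
  proof -
    define Q where "Q = q ^ (2*N)"
    assume "2 * N \<le> q ^ (2 * N)" "0 < q ^ (2*N)"
    then have "2 * N \<le> Q" "0 < Q" by (simp_all add: Q_def)
    then have a: "2 * (Q - N) \<ge> Q" "0 < Q" "0 < Q - N" by linarith+
    have "CARD('a)\<^sup>2 * Q \<le> CARD('a)\<^sup>2 * (2 * (Q - N))" using a by (intro mult_left_mono) auto
    also have "\<dots> < (Q - N) * M" using a(3) unfolding M_def distrib_left by (simp only: ac_simps)
    finally show ?thesis by (simp add: Q_def)
  qed
  moreover have "(q ^ (2*N) - N) * M \<le> card (factors (q ^ (2*N)))"
    using grow[of "q ^ (2*N) - N"] \<open>2 * N \<le> q ^ (2 * N)\<close> by simp
  ultimately show False using card_factors_power[of "2*N"] by linarith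
qed

lemma finite_asymptotic_pairs: "finite asymptotic_pairs"
proof (rule finite_imageD)
  let ?g = "\<lambda>(x, y). (x (0::nat), y (0::nat), \<lambda>i. x (Suc i))"
  have "?g ` asymptotic_pairs \<subseteq> UNIV \<times> UNIV \<times> left_special"
    by (auto simp: left_special_def)
  moreover have "finite (UNIV \<times> UNIV \<times> left_special :: ('a \<times> 'a \<times> (nat \<Rightarrow> 'a)) set)"
    using finite_left_special by simp
  ultimately show "finite (?g ` asymptotic_pairs)" by (rule finite_subset)
  show "inj_on ?g asymptotic_pairs"
  proof (rule inj_onI, clarify)
    fix x y x' y' :: "nat \<Rightarrow> 'a"
    assume h: "(x, y) \<in> asymptotic_pairs" "(x', y') \<in> asymptotic_pairs" "x 0 = x' 0" "y 0 = y' 0"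
      and e: "(\<lambda>i. x (Suc i)) = (\<lambda>i. x' (Suc i))"
    have "x i = x' i" for i using h(3) fun_cong[OF e] by (cases i) auto
    moreover have "y i = y' i" for i using h fun_cong[OF e] by (cases i) (auto simp: asymptotic_pairs_def)
    ultimately show "x = x' \<and> y = y'" by auto
  qed
qed

text \<open>If some \<open>L\<close> letters always determined the letter before them, equality of
  two such words would propagate to the left, and bounded return times would then force a period. So
  for every \<open>L\<close> there are occurrences of one word after different letters, and a limit
  of these is an asymptotic pair.\<close>

lemma asymptotic_pairs_nonempty:
  assumes np: "\<not> (\<exists>p\<ge>1. \<forall>i. v (i + p) = v i)"
  shows "asymptotic_pairs \<noteq> {}"
proof -
  have "\<exists>s t. v s \<noteq> v t \<and> init_word L (\<lambda>i. v (Suc s + i)) = init_word L (\<lambda>i. v (Suc t + i))" for L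
  proof (rule ccontr)
    assume "\<not> ?thesis"
    then have det: "v s = v t" if "init_word L (\<lambda>i. v (Suc s + i)) = init_word L (\<lambda>i. v (Suc t + i))" for s t
      using that by blast
    have backward: "init_word L (\<lambda>i. v (s + j + i)) = init_word L (\<lambda>i. v (t + j + i)) \<Longrightarrow> k \<le> j \<Longrightarrow>
        init_word L (\<lambda>i. v (s + (j - k) + i)) = init_word L (\<lambda>i. v (t + (j - k) + i))" for s t j k
    proof (induction k)
      case (Suc k)
      define a b where "a = s + (j - Suc k)" and "b = t + (j - Suc k)"
      have ab: "Suc a = s + (j - k)" "Suc b = t + (j - k)" using Suc.prems(2) by (auto simp: a_def b_def)
      have 1: "init_word L (\<lambda>i. v (Suc a + i)) = init_word L (\<lambda>i. v (Suc b + i))" unfolding ab using Suc by simp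
      have "v (a + i) = v (b + i)" if "i < L" for i
        using det[OF 1] 1 that by (cases i) (auto simp: init_word_eq_iff)
      then have "init_word L (\<lambda>i. v (a + i)) = init_word L (\<lambda>i. v (b + i))" by (auto simp: init_word_eq_iff)
      then show ?case by (simp only: a_def b_def)
    qed simp
    have L: "0 < L"
    proof (rule ccontr)
      assume "\<not> 0 < L"
      then have "\<And>s t. v s = v t" using det by (auto simp: init_word_def)
      then show False using np by (metis order_refl)
    qed
    obtain R where R: "\<And>s t. \<exists>r\<le>R. init_word L (\<lambda>i. v (s + r + i)) = init_word L (\<lambda>i. v (t + i))"
      using recurrent[of L] by blast
    have "\<exists>p\<in>{1..Suc R}. init_word L (\<lambda>i. v (m + p + i)) = init_word L (\<lambda>i. v (m + i))" for m
    proof -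
      obtain r where "r \<le> R" "init_word L (\<lambda>i. v (Suc m + r + i)) = init_word L (\<lambda>i. v (m + i))" using R by blast
      then show ?thesis by (intro bexI[of _ "Suc r"]) auto
    qed
    then obtain p where p: "\<And>m. p m \<in> {1..Suc R}"
      "\<And>m. init_word L (\<lambda>i. v (m + p m + i)) = init_word L (\<lambda>i. v (m + i))" by metis
    \<comment> \<open>Return times are at most \<open>Suc R\<close>, so one of them occurs at
      arbitrarily large positions; running backwards from there gives this period at every
      position.\<close>
    obtain p0 where p0: "p0 \<in> {1..Suc R}" "infinite {m\<in>UNIV. p m = p0}"
      using pigeonhole_infinite_rel[of UNIV "{1..Suc R}" "\<lambda>m r. p m = r"] p by auto
    have "v (i + p0) = v i" for i
    proof -
      obtain m where m: "m \<ge> i" "p m = p0" using p0(2) unfolding infinite_nat_iff_unbounded_le by auto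
      have "init_word L (\<lambda>i. v (p0 + m + i)) = init_word L (\<lambda>i. v (0 + m + i))" using p(2)[of m] m by (simp add: add.commute)
      from backward[OF this, of "m - i"] m have "init_word L (\<lambda>j. v (p0 + i + j)) = init_word L (\<lambda>j. v (i + j))" by simp
      then have "v (p0 + i + 0) = v (i + 0)" unfolding init_word_eq_iff using L by blast
      then show ?thesis by (simp add: add.commute)
    qed
    then show False using np p0 by auto
  qed
  then obtain s t where st: "\<And>L. v (s L) \<noteq> v (t L)"
    "\<And>L. init_word L (\<lambda>i. v (Suc (s L) + i)) = init_word L (\<lambda>i. v (Suc (t L) + i))" by metis
  \<comment> \<open>Compactness over the product alphabet takes both limits along the same
    indices.\<close>
  obtain z where z: "\<And>L. \<exists>n\<ge>L. init_word L z = init_word L (\<lambda>i. (v (s n + i), v (t n + i)))"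
    using compactness_words[of "\<lambda>n i. (v (s n + i), v (t n + i))"] by blast
  have z': "\<exists>n\<ge>L. \<forall>i<L. fst (z i) = v (s n + i) \<and> snd (z i) = v (t n + i)" for L
    using z[of L] unfolding init_word_eq_iff by (metis fst_conv snd_conv)
  have "(\<lambda>i. fst (z i)) \<in> orbit_hull v" "(\<lambda>i. snd (z i)) \<in> orbit_hull v"
    unfolding orbit_hull_def init_word_eq_iff mem_Collect_eq
    subgoal by (intro allI) (metis z')
    subgoal by (intro allI) (metis z')
    done
  moreover have "fst (z 0) \<noteq> snd (z 0)"
  proof -
    obtain n where "fst (z 0) = v (s n + 0)" "snd (z 0) = v (t n + 0)" using z'[of 1] by blast
    then show ?thesis using st(1)[of n] by simp
  qed
  moreover have "fst (z (Suc i)) = snd (z (Suc i))" for i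
  proof -
    obtain n where n: "n \<ge> Suc (Suc i)" "fst (z (Suc i)) = v (s n + Suc i)" "snd (z (Suc i)) = v (t n + Suc i)" 
      using z'[of "Suc (Suc i)"] by blast
    then show ?thesis using st(2)[of n] by (auto simp: init_word_eq_iff)
  qed
  ultimately have "((\<lambda>i. fst (z i)), (\<lambda>i. snd (z i))) \<in> asymptotic_pairs"
    unfolding asymptotic_pairs_def by auto
  then show ?thesis by blast
qed

end

section \<open>Phases modulo \<open>q\<close> and desubstitution\<close>

context automatic_sequence
begin

text \<open>Recognizability amounts to this set being a singleton for large
  \<open>L\<close>.\<close>

definition phases :: "nat \<Rightarrow> (nat \<Rightarrow> 'a) \<Rightarrow> nat set" where
  "phases L x = {s mod q |s. init_word L x = init_word L (\<lambda>i. v (s + i))}"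

lemma phases_subset: "phases L x \<subseteq> {..<q}"
  using q_pos by (auto simp: phases_def)

lemma finite_phases: "finite (phases L x)"
  by (rule finite_subset[OF phases_subset]) simp

lemma phases_antimono: "L \<le> M \<Longrightarrow> phases M x \<subseteq> phases L x"
  unfolding phases_def using init_word_eq_mono by blast

lemma phases_shift: "(\<lambda>t. (t + n) mod q) ` phases (n + L) x \<subseteq> phases L (\<lambda>i. x (n + i))"
proof clarify
  fix t assume "t \<in> phases (n + L) x"
  then obtain s where s: "t = s mod q" "init_word (n + L) x = init_word (n + L) (\<lambda>i. v (s + i))"
    by (auto simp: phases_def)
  have "init_word L (\<lambda>i. x (n + i)) = init_word L (\<lambda>i. v ((s + n) + i))"
    using s(2) by (auto simp: init_word_eq_iff add.assoc)
  then have "(s + n) mod q \<in> phases L (\<lambda>i. x (n + i))" unfolding phases_def by blast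
  then show "(t + n) mod q \<in> phases L (\<lambda>i. x (n + i))" by (simp add: s(1) mod_add_left_eq)
qed

lemma inj_on_phase_shift: "inj_on (\<lambda>t. (t + n) mod q) {..<q}"
proof (rule inj_onI)
  fix s t assume st: "s \<in> {..<q}" "t \<in> {..<q}" "(s + n) mod q = (t + n) mod q"
  then have "s mod q = t mod q" 
    by (metis cong_def cong_add_rcancel_nat)
  then show "s = t" using st by simp
qed

lemma card_phases_shift: "card (phases (n + L) x) \<le> card (phases L (\<lambda>i. x (n + i)))"
proof -
  have "card (phases (n + L) x) = card ((\<lambda>t. (t + n) mod q) ` phases (n + L) x)"
    by (rule card_image[symmetric, OF inj_on_subset[OF inj_on_phase_shift phases_subset]])
  also have "\<dots> \<le> card (phases L (\<lambda>i. x (n + i)))"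
    by (rule card_mono[OF finite_phases phases_shift])
  finally show ?thesis .
qed

text \<open>Take a prefix \<open>L0\<close> of a point \<open>x0\<close> with the least possible
  number of phases. It occurs in every point of the hull within a bounded gap \<open>R\<close>, and
  shifting acts injectively on residues, so every prefix of length at least \<open>R + L0\<close>
  has no more phases.\<close>

lemma phases_stable:
  "\<exists>L e. 1 \<le> e \<and> (\<forall>x\<in>orbit_hull v. \<forall>M\<ge>L. card (phases M x) = e)"
proof -
  define Q where "Q = (\<lambda>e. \<exists>L. \<exists>x\<in>orbit_hull v. card (phases L x) = e)"
  define e where "e = (LEAST e. Q e)"
  have "Q (card (phases 0 v))" unfolding Q_def using self_hull by blast
  then have "Q e" unfolding e_def by (rule LeastI)
  then obtain L0 x0 where x0: "x0 \<in> orbit_hull v" "card (phases L0 x0) = e" unfolding Q_def by blast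
  have min: "e \<le> card (phases L x)" if "x \<in> orbit_hull v" for L x
    unfolding e_def by (rule Least_le) (use that in \<open>auto simp: Q_def\<close>)
  obtain t where t: "init_word L0 x0 = init_word L0 (\<lambda>i. v (t + i))" using hullD[OF x0(1)] by blast
  obtain R where R: "\<And>x t. x \<in> orbit_hull v \<Longrightarrow> \<exists>r\<le>R. init_word L0 (\<lambda>i. x (r + i)) = init_word L0 (\<lambda>i. v (t + i))"
    using hull_uniformly_recurrent[of L0] by blast
  have "card (phases M x) = e" if x: "x \<in> orbit_hull v" and M: "R + L0 \<le> M" for M x
  proof -
    obtain r where r: "r \<le> R" "init_word L0 (\<lambda>i. x (r + i)) = init_word L0 (\<lambda>i. v (t + i))"
      using R[OF x] by blast
    have "card (phases M x) \<le> card (phases (r + L0) x)"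
      by (rule card_mono[OF finite_phases phases_antimono]) (use M r in simp)
    also have "\<dots> \<le> card (phases L0 (\<lambda>i. x (r + i)))" by (rule card_phases_shift)
    also have "\<dots> = e" using x0(2) r(2) t unfolding phases_def by simp
    finally show ?thesis using min[OF x] by (metis le_antisym)
  qed
  moreover have "1 \<le> e"
  proof -
    have "phases L0 x0 \<noteq> {}" using t by (auto simp: phases_def)
    then show ?thesis using x0(2) finite_phases by (metis card_gt_0_iff less_eq_Suc_le One_nat_def)
  qed
  ultimately show ?thesis by blast
qed

text \<open>All prefixes of \<open>x\<close> occur at positions \<open>q * n + i\<close>; a limit of
  the coarse words read from the positions \<open>n\<close> is the required
  \<open>z\<close>.\<close>

lemma desubstitution:
  assumes i: "\<And>L. i \<in> phases L x"
  shows "\<exists>z\<in>orbit_hull v. \<forall>j. x j = f (z ((i + j) div q)) ((i + j) mod q)"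
proof -
  have "\<exists>n. init_word L x = init_word L (\<lambda>j. v (q * n + i + j))" for L
  proof -
    obtain s where "i = s mod q" "init_word L x = init_word L (\<lambda>j. v (s + j))"
      using i[of L] by (auto simp: phases_def)
    then show ?thesis by (intro exI[of _ "s div q"]) simp
  qed
  then obtain n where n: "\<And>L. init_word L x = init_word L (\<lambda>j. v (q * n L + i + j))" by metis
  obtain z where z: "\<And>M. \<exists>L\<ge>M. init_word M z = init_word M (\<lambda>k. v (n L + k))"
    using compactness_words[of "\<lambda>L k. v (n L + k)"] by blast
  have "z \<in> orbit_hull v" unfolding orbit_hull_def using z by blast
  moreover have "x j = f (z ((i + j) div q)) ((i + j) mod q)" for j
  proof -
    obtain L where L: "L \<ge> Suc (i + j)" "init_word (Suc (i + j)) z = init_word (Suc (i + j)) (\<lambda>k. v (n L + k))"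
      using z by blast
    have "z ((i + j) div q) = v (n L + (i + j) div q)"
      using L(2) unfolding init_word_eq_iff by (simp add: le_imp_less_Suc)
    moreover have "x j = v (q * n L + i + j)" using n[of L] L(1) by (simp add: init_word_eq_iff)
    moreover have "q * n L + i + j = q * (n L + (i + j) div q) + (i + j) mod q"
      by (simp add: distrib_left)
    ultimately show ?thesis using fixed[of "(i + j) mod q"] q_pos by simp
  qed
  ultimately show ?thesis by blast
qed

text \<open>Desubstituting a left asymptotic pair at any one of its \<open>e\<close> phases gives another such pair,
  which determines both the original pair and the phase. As there are finitely many pairs,
  and at least one, \<open>e = 1\<close>.\<close>

lemma recognizable:
  assumes np: "\<not> (\<exists>p\<ge>1. \<forall>i. v (i + p) = v i)"
  shows "\<exists>L. \<forall>s t. init_word L (\<lambda>i. v (s + i)) = init_word L (\<lambda>i. v (t + i)) \<longrightarrow> s mod q = t mod q"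
proof -
  obtain L e where e: "1 \<le> e" and L: "\<And>x M. x \<in> orbit_hull v \<Longrightarrow> L \<le> M \<Longrightarrow> card (phases M x) = e"
    using phases_stable by blast
  have const: "phases M x = phases L x" if "x \<in> orbit_hull v" "L \<le> M" for x M
    by (rule card_subset_eq[OF finite_phases phases_antimono]) (use that L in auto)
  have all: "i \<in> phases M x" if "x \<in> orbit_hull v" "i \<in> phases L x" for x i M
    using const[OF that(1), of "max L M"] phases_antimono[of M "max L M" x] that(2) by auto
  \<comment> \<open>Adding 1 to residues maps each of the two sets into the phases of the common
    tail, and all these sets have \<open>e\<close> elements; so both have the same image under an
    injective map.\<close>
  have same: "phases L x = phases L y" if xy: "(x, y) \<in> asymptotic_pairs" for x y
  proof -
    have h: "x \<in> orbit_hull v" "y \<in> orbit_hull v" "(\<lambda>i. x (1 + i)) = (\<lambda>i. y (1 + i))"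
      using xy by (auto simp: asymptotic_pairs_def)
    have im: "(\<lambda>t. (t + 1) mod q) ` phases L x = phases L (\<lambda>i. x (1 + i))" if "x \<in> orbit_hull v" for x
    proof (rule card_subset_eq[OF finite_phases])
      show "(\<lambda>t. (t + 1) mod q) ` phases L x \<subseteq> phases L (\<lambda>i. x (1 + i))"
        using phases_shift[of 1 L x] const[OF that, of "1 + L"] by simp
      show "card ((\<lambda>t. (t + 1) mod q) ` phases L x) = card (phases L (\<lambda>i. x (1 + i)))"
        using card_image[OF inj_on_subset[OF inj_on_phase_shift phases_subset], of 1 L x]
          L[OF that, of L] L[OF hull_shift[OF that], of L 1] by simp
    qed
    have "(\<lambda>t. (t + 1) mod q) ` phases L x = (\<lambda>t. (t + 1) mod q) ` phases L y"
      using im[OF h(1)] im[OF h(2)] h(3) by simp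
    then show ?thesis
      using inj_on_image_eq_iff[OF inj_on_phase_shift phases_subset phases_subset] by blast
  qed
  define S where "S = (SIGMA p:asymptotic_pairs. phases L (fst p))"
  have "\<exists>p'. p' \<in> asymptotic_pairs \<and>
      (\<forall>j. fst (fst k) j = f (fst p' ((snd k + j) div q)) ((snd k + j) mod q)) \<and>
      (\<forall>j. snd (fst k) j = f (snd p' ((snd k + j) div q)) ((snd k + j) mod q))" if "k \<in> S" for k
  proof -
    obtain x y i where k: "k = ((x, y), i)" by (metis prod.collapse)
    have xy: "(x, y) \<in> asymptotic_pairs" and i: "i \<in> phases L x" using that by (auto simp: S_def k)
    have h: "x \<in> orbit_hull v" "y \<in> orbit_hull v" "x 0 \<noteq> y 0" "\<And>i. x (Suc i) = y (Suc i)"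
      using xy by (auto simp: asymptotic_pairs_def)
    have iq: "i < q" using i phases_subset by blast
    obtain x' where x': "x' \<in> orbit_hull v" "\<And>j. x j = f (x' ((i + j) div q)) ((i + j) mod q)"
      using desubstitution[of i x] all[OF h(1) i] by blast
    obtain y' where y': "y' \<in> orbit_hull v" "\<And>j. y j = f (y' ((i + j) div q)) ((i + j) mod q)"
      using desubstitution[of i y] all[OF h(2)] i same[OF xy] by blast
    have tail: "x' (Suc l) = y' (Suc l)" for l
    proof -
      obtain m where m: "x' (Suc l) = v m"
        using hullD[OF x'(1), of "Suc (Suc l)"] by (auto simp: init_word_eq_iff)
      obtain n where n: "y' (Suc l) = v n"
        using hullD[OF y'(1), of "Suc (Suc l)"] by (auto simp: init_word_eq_iff)
      have "f (v m) r = f (v n) r" if r: "r < q" for r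
      proof -
        \<comment> \<open>Position \<open>Suc j\<close> of \<open>x\<close> and \<open>y\<close> is
          letter \<open>r\<close> of the block of index \<open>Suc l\<close>. Since
          \<open>i < q\<close>, this block starts after position 0, where \<open>x\<close> and
          \<open>y\<close> agree.\<close>
        define j where "j = q * Suc l + r - i - 1"
        have j: "i + Suc j = q * Suc l + r" using iq by (simp add: j_def)
        have d: "(i + Suc j) div q = Suc l" "(i + Suc j) mod q = r" 
          unfolding j using r by (simp_all del: mult_Suc_right)
        have "x (Suc j) = f (v m) r" "y (Suc j) = f (v n) r"
          using x'(2)[of "Suc j"] y'(2)[of "Suc j"] unfolding d m n by auto
        then show ?thesis using h(4)[of j] by simp
      qed
      then show ?thesis using blocks_inj[of m n] m n by simp
    qed
    have "x' 0 \<noteq> y' 0"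
    proof
      assume "x' 0 = y' 0"
      then have "x' l = y' l" for l using tail by (cases l) auto
      then have "x 0 = y 0" using x'(2)[of 0] y'(2)[of 0] by simp
      then show False using h(3) by simp
    qed
    then have "(x', y') \<in> asymptotic_pairs" using x'(1) y'(1) tail by (auto simp: asymptotic_pairs_def)
    then show ?thesis using x'(2) y'(2) by (intro exI[of _ "(x', y')"]) (simp add: k)
  qed
  then obtain g where g: "\<And>k. k \<in> S \<Longrightarrow> g k \<in> asymptotic_pairs"
      "\<And>k j. k \<in> S \<Longrightarrow> fst (fst k) j = f (fst (g k) ((snd k + j) div q)) ((snd k + j) mod q)"
      "\<And>k j. k \<in> S \<Longrightarrow> snd (fst k) j = f (snd (g k) ((snd k + j) div q)) ((snd k + j) mod q)"
    by metis
  \<comment> \<open>With a smaller phase for \<open>k\<close>, the pair of \<open>l\<close> would be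
    a proper shift of the pair of \<open>k\<close>, hence have equal first letters.\<close>
  have le: "\<not> snd k < snd l" if kl: "k \<in> S" "l \<in> S" "g k = g l" for k l
  proof
    assume lt: "snd k < snd l"
    define j where "j = snd l - snd k - 1"
    have j: "snd k + Suc j = snd l + 0" using lt by (simp add: j_def)
    have "fst (fst l) 0 = fst (fst k) (Suc j)" "snd (fst l) 0 = snd (fst k) (Suc j)"
      using g(2,3)[OF kl(1), of "Suc j"] g(2,3)[OF kl(2), of 0] kl(3) unfolding j by simp_all
    moreover have "fst k \<in> asymptotic_pairs" "fst l \<in> asymptotic_pairs" using kl by (auto simp: S_def)
    ultimately show False by (auto simp: asymptotic_pairs_def)
  qed
  have "inj_on g S"
  proof (rule inj_onI)
    fix k l assume kl: "k \<in> S" "l \<in> S" "g k = g l"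
    have "snd k = snd l" using le[OF kl] le[OF kl(2,1) kl(3)[symmetric]] by simp
    moreover have "fst k = fst l"
      using g(2,3)[OF kl(1)] g(2,3)[OF kl(2)] kl(3) \<open>snd k = snd l\<close> by (auto intro!: prod_eqI)
    ultimately show "k = l" by (rule prod_eqI[rotated])
  qed
  moreover have "g ` S \<subseteq> asymptotic_pairs" using g(1) by blast
  ultimately have "card S \<le> card asymptotic_pairs"
    using card_inj_on_le finite_asymptotic_pairs by blast
  moreover have "card S = card asymptotic_pairs * e"
  proof -
    have "card S = (\<Sum>p\<in>asymptotic_pairs. card (phases L (fst p)))"
      unfolding S_def by (rule card_SigmaI) (auto simp: finite_asymptotic_pairs finite_phases)
    also have "\<dots> = (\<Sum>p\<in>asymptotic_pairs. e)"
      by (rule sum.cong) (auto simp: asymptotic_pairs_def L)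
    finally show ?thesis by simp
  qed
  moreover have "card asymptotic_pairs > 0"
    using asymptotic_pairs_nonempty[OF np] finite_asymptotic_pairs by (simp add: card_gt_0_iff)
  ultimately have "e = 1" using e by simp
  have "s mod q = t mod q" if st: "init_word L (\<lambda>i. v (s + i)) = init_word L (\<lambda>i. v (t + i))" for s t
  proof -
    have "s mod q \<in> phases L (\<lambda>i. v (s + i))" "t mod q \<in> phases L (\<lambda>i. v (s + i))"
      using st by (auto simp: phases_def)
    moreover have "card (phases L (\<lambda>i. v (s + i))) = 1"
      using L[OF hull_shift[OF self_hull]] \<open>e = 1\<close> by simp
    ultimately show ?thesis by (auto simp: card_1_singleton_iff)
  qed
  then show ?thesis by blast
qed

end

section \<open>Columns of iterated substitutions\<close>

lemma nth_concat_const_length: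
  assumes "\<And>x. x \<in> set xs \<Longrightarrow> length x = Q" "k < length xs" "r < Q"
  shows "concat xs ! (Q * k + r) = xs ! k ! r"
  using assms
proof (induction xs arbitrary: k)
  case (Cons x xs)
  then show ?case by (cases k) (auto simp: nth_append)
qed simp

lemma length_concat_const_length:
  assumes "\<And>x. x \<in> set xs \<Longrightarrow> length x = Q"
  shows "length (concat xs) = length xs * Q"
  using assms by (induction xs) auto

lemma subst_word_concat: "subst_word \<xi> (concat ws) = concat (map (subst_word \<xi>) ws)"
  unfolding subst_word_def by (induction ws) auto

lemma subst_word_pow: "(subst_word \<xi> ^^ m) w = concat (map (subst_iter \<xi> m) w)"
proof (induction m)
  case 0
  have "subst_iter \<xi> 0 = (\<lambda>a. [a])" by (rule ext) (simp add: subst_iter_def)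
  then show ?case by simp
next
  case (Suc m)
  have "subst_iter \<xi> (Suc m) = (\<lambda>a. subst_word \<xi> (subst_iter \<xi> m a))"
    by (rule ext) (simp add: subst_iter_def)
  then show ?case using Suc by (simp add: subst_word_concat comp_def)
qed

locale substitution_fixed_point =
  fixes q :: nat and \<xi> :: "'a::finite \<Rightarrow> 'a list" and u :: "nat \<Rightarrow> 'a"
  assumes q_ge_2: "2 \<le> q"
    and const_length: "constant_length q \<xi>"
    and inj: "inj \<xi>"
    and primitive: "primitive_subst \<xi>"
    and fixed_point: "subst_inf \<xi> u = u"
begin

lemma q_pos: "0 < q" using q_ge_2 by simp

abbreviation col :: "nat \<Rightarrow> nat \<Rightarrow> 'a \<Rightarrow> 'a" where
  "col m k a \<equiv> subst_iter \<xi> m a ! k"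

lemma length_subst: "length (\<xi> a) = q"
  using const_length by (simp add: constant_length_def)

lemma length_subst_iter: "length (subst_iter \<xi> m a) = q ^ m"
proof (induction m)
  case (Suc m)
  have "length (subst_iter \<xi> (Suc m) a) = length (subst_word \<xi> (subst_iter \<xi> m a))"
    by (simp add: subst_iter_def)
  also have "\<dots> = length (subst_iter \<xi> m a) * q"
    unfolding subst_word_def
    by (subst length_concat_const_length[where Q = q]) (auto simp: length_subst)
  finally show ?case using Suc by simp
qed (simp add: subst_iter_def)

lemma col_0: "col 0 0 a = a"
  by (simp add: subst_iter_def)

lemma col_1: "col 1 r a = \<xi> a ! r"
  by (simp add: subst_iter_def subst_word_def)

text \<open>Positions are read in base \<open>q\<close>: the leading part \<open>k\<close> selects a
  letter of the coarse word, and the trailing part \<open>r\<close> a position in the block of that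
  letter. So the most significant part acts first.\<close>

lemma col_add:
  assumes "r < q ^ m" "k < q ^ l"
  shows "col (m + l) (q ^ m * k + r) a = col m r (col l k a)"
proof -
  have "subst_iter \<xi> (m + l) a = concat (map (subst_iter \<xi> m) (subst_iter \<xi> l a))"
    by (simp add: subst_iter_def funpow_add flip: subst_word_pow)
  also have "\<dots> ! (q ^ m * k + r) = map (subst_iter \<xi> m) (subst_iter \<xi> l a) ! k ! r"
    by (rule nth_concat_const_length) (use assms in \<open>auto simp: length_subst_iter\<close>)
  finally show ?thesis using assms by (simp add: length_subst_iter)
qed

lemma digit_bound: "k < q ^ l \<Longrightarrow> r < q ^ m \<Longrightarrow> q ^ m * k + r < q ^ (m + l)"
proof -
  assume "k < q ^ l" "r < q ^ m"
  then have "q ^ m * k + r < q ^ m * Suc k" "q ^ m * Suc k \<le> q ^ m * q ^ l"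
    by (simp, intro mult_left_mono) auto
  then show ?thesis by (simp add: power_add)
qed

lemma digit_split: "k < q ^ (m + l) \<Longrightarrow> k div q ^ m < q ^ l \<and> k mod q ^ m < q ^ m \<and> q ^ m * (k div q ^ m) + k mod q ^ m = k"
  using q_pos by (simp add: power_add less_mult_imp_div_less mult.commute)

lemma u_block: "r < q \<Longrightarrow> u (q * n + r) = \<xi> (u n) ! r"
proof -
  assume r: "r < q"
  have "n \<le> q * n + r" using q_pos by (simp add: trans_le_add1)
  have "u (q * n + r) = subst_inf \<xi> u (q * n + r)" by (simp add: fixed_point)
  also have "\<dots> = map \<xi> (map u [0..<Suc (q * n + r)]) ! n ! r"
    unfolding subst_inf_def subst_word_def
    by (rule nth_concat_const_length) (use r \<open>n \<le> q * n + r\<close> in \<open>auto simp: length_subst simp del: upt_Suc\<close>)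
  also have "\<dots> = \<xi> (u n) ! r" using \<open>n \<le> q * n + r\<close> by (simp del: upt_Suc)
  finally show ?thesis .
qed

lemma u_col: "k < q ^ m \<Longrightarrow> u (q ^ m * n + k) = col m k (u n)"
proof (induction m arbitrary: k)
  case (Suc m)
  have k: "k div q < q ^ m" "k mod q < q" "q * (k div q) + k mod q = k"
    using digit_split[of k 1 m] Suc.prems by auto
  have "q ^ Suc m * n + k = q * (q ^ m * n + k div q) + k mod q" using k(3) by (simp add: algebra_simps)
  then have "u (q ^ Suc m * n + k) = \<xi> (u (q ^ m * n + k div q)) ! (k mod q)"
    using u_block[OF k(2)] by simp
  also have "\<dots> = col 1 (k mod q) (col m (k div q) (u n))" using Suc.IH[OF k(1)] col_1 by simp
  also have "\<dots> = col (Suc m) k (u n)" using col_add[of "k mod q" 1 "k div q" m] k by simp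
  finally show ?case .
qed (simp add: col_0)

lemma level_hitting_all: "\<exists>N. \<forall>a b. \<exists>k<q ^ N. col N k a = b"
proof -
  obtain N where N: "\<And>a b. b \<in> set (subst_iter \<xi> N a)" using primitive by (auto simp: primitive_subst_def)
  have "\<exists>k<q ^ N. col N k a = b" for a b using N[of b a] by (auto simp: in_set_conv_nth length_subst_iter)
  then show ?thesis by blast
qed

lemma letter_occurs: "\<exists>n. u n = a"
proof -
  obtain N where "\<exists>k<q ^ N. col N k (u 0) = a" using level_hitting_all by blast
  then obtain k where "k < q ^ N" "col N k (u 0) = a" by blast
  then have "u k = a" using u_col[of k N 0] by simp
  then show ?thesis ..
qed

lemma power_unbounded: "\<exists>m. n \<le> q ^ m"
  using power_mono[OF q_ge_2, of n] less_exp[of n] by (intro exI[of _ n]) linarith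

text \<open>All words of length \<open>L\<close> occurring in \<open>u\<close> already occur in one
  prefix of length \<open>q ^ M\<close>. That prefix is the level \<open>M\<close> block of
  \<open>u 0\<close>, and by primitivity \<open>u 0\<close> occurs in every block of level
  \<open>N\<close>.\<close>

lemma uniformly_recurrent:
  "\<exists>R. \<forall>s t. \<exists>r\<le>R. init_word L (\<lambda>i. u (s + r + i)) = init_word L (\<lambda>i. u (t + i))"
proof -
  define W where "W = range (\<lambda>t. init_word L (\<lambda>i. u (t + i)))"
  have fin: "finite W" unfolding W_def by (rule finite_subset[OF _ finite_range_init_word[of L]]) auto
  have "\<forall>w\<in>W. \<exists>t. w = init_word L (\<lambda>i. u (t + i))" by (auto simp: W_def)
  then obtain \<tau> where \<tau>: "\<And>w. w \<in> W \<Longrightarrow> w = init_word L (\<lambda>i. u (\<tau> w + i))" by metis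
  obtain M where M: "Max (insert 0 (\<tau> ` W)) + L \<le> q ^ M" using power_unbounded by blast
  have \<tau>M: "\<tau> w + L \<le> q ^ M" if "w \<in> W" for w
  proof -
    have "\<tau> w \<le> Max (insert 0 (\<tau> ` W))" by (rule Max_ge) (use fin that in auto)
    then show ?thesis using M by simp
  qed
  obtain N where N: "\<And>a b. \<exists>k<q ^ N. col N k a = b" using level_hitting_all by blast
  have start: "\<exists>k<q ^ N. \<forall>i<q ^ M. u (q ^ (M + N) * n + q ^ M * k + i) = u i" for n
  proof -
    obtain k where k: "k < q ^ N" "col N k (u n) = u 0" using N by blast
    have "u (q ^ (M + N) * n + q ^ M * k + i) = u i" if i: "i < q ^ M" for i
    proof -
      have "q ^ (M + N) * n + q ^ M * k + i = q ^ M * (q ^ N * n + k) + i"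
        by (simp add: algebra_simps power_add)
      then have "u (q ^ (M + N) * n + q ^ M * k + i) = col M i (u 0)"
        using u_col[OF i, of "q ^ N * n + k"] u_col[OF k(1), of n] k(2) by simp
      then show ?thesis using u_col[OF i, of 0] by simp
    qed
    then show ?thesis using k by blast
  qed
  have "\<exists>r\<le>2 * q ^ (M + N). init_word L (\<lambda>i. u (s + r + i)) = init_word L (\<lambda>i. u (t + i))" for s t
  proof -
    define w where "w = init_word L (\<lambda>i. u (t + i))"
    define B where "B = q ^ (M + N)"
    have B: "0 < B" using q_pos by (simp add: B_def)
    \<comment> \<open>Index of the next complete block after \<open>s\<close>; reaching it and then
      searching inside it costs at most \<open>B\<close> letters each.\<close>
    define n where "n = Suc (s div B)"
    have w: "w \<in> W" by (auto simp: W_def w_def)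
    obtain k where k: "k < q ^ N" "\<And>i. i < q ^ M \<Longrightarrow> u (B * n + q ^ M * k + i) = u i" 
      using start unfolding B_def by blast
    define r where "r = B * n + q ^ M * k + \<tau> w - s"
    have sn: "s \<le> B * n" "B * n \<le> s + B"
      unfolding n_def using B mult_div_mod_eq[of B s] mod_less_divisor[OF B, of s] by (simp_all del: mult_div_mod_eq, linarith+)
    have sr: "s + r = B * n + q ^ M * k + \<tau> w" unfolding r_def using sn by simp
    have "q ^ M * k + q ^ M \<le> B" 
      using mult_le_mono2[of "Suc k" "q ^ N" "q ^ M"] k(1) by (simp add: B_def power_add)
    then have "r \<le> 2 * B" unfolding r_def using sn \<tau>M[OF w] by linarith
    moreover have "init_word L (\<lambda>i. u (s + r + i)) = init_word L (\<lambda>i. u (\<tau> w + i))"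
      unfolding init_word_eq_iff
    proof (intro allI impI)
      fix i assume "i < L"
      then show "u (s + r + i) = u (\<tau> w + i)" unfolding sr
        using k(2)[of "\<tau> w + i"] \<tau>M[OF w] by (simp add: add.assoc)
    qed
    ultimately show ?thesis using \<tau>[OF w] unfolding w_def B_def by metis
  qed
  then show ?thesis by blast
qed

sublocale auto: automatic_sequence q "\<lambda>a i. \<xi> a ! i" u
proof
  show "2 \<le> q" by (rule q_ge_2)
  show "u (q * n + i) = \<xi> (u n) ! i" if "i < q" for n i using u_block that by blast
  show "\<exists>R. \<forall>s t. \<exists>r\<le>R. init_word L (\<lambda>i. u (s + r + i)) = init_word L (\<lambda>i. u (t + i))" for L
    by (rule uniformly_recurrent)
  show "u m = u n" if "\<And>i. i < q \<Longrightarrow> \<xi> (u m) ! i = \<xi> (u n) ! i" for m n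
    by (rule injD[OF inj], rule nth_equalityI) (use that in \<open>auto simp: length_subst\<close>)
qed

section \<open>Letters that cannot be merged\<close>

definition never_meet :: "'a \<Rightarrow> 'a \<Rightarrow> bool" where
  "never_meet a b \<longleftrightarrow> (\<forall>m k. k < q ^ m \<longrightarrow> col m k a \<noteq> col m k b)"

text \<open>The negation says that after every column some further column merges the two letters.
  This is an equivalence relation, unlike the mere existence of one merging column.\<close>

definition separated :: "'a \<Rightarrow> 'a \<Rightarrow> bool" where
  "separated a b \<longleftrightarrow> (\<exists>m k. k < q ^ m \<and> never_meet (col m k a) (col m k b))"

lemma never_meet_col: "never_meet a b \<Longrightarrow> k < q ^ m \<Longrightarrow> never_meet (col m k a) (col m k b)"
  unfolding never_meet_def
proof (intro allI impI)
  fix l r assume "\<forall>m k. k < q ^ m \<longrightarrow> col m k a \<noteq> col m k b" "k < q ^ m" "r < q ^ l"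
  then show "col l r (col m k a) \<noteq> col l r (col m k b)"
    using digit_bound[of k m r l] col_add[of r l k m] by metis
qed

lemma never_meet_separated: "never_meet a b \<Longrightarrow> separated a b"
  unfolding separated_def by (rule exI[of _ 0], rule exI[of _ 0]) (simp add: col_0)

lemma separated_of_col: "k < q ^ m \<Longrightarrow> separated (col m k a) (col m k b) \<Longrightarrow> separated a b"
  unfolding separated_def by (metis digit_bound col_add)

lemma not_separated_refl: "\<not> separated a a"
  by (metis separated_def never_meet_def col_0 power_0 zero_less_one)

lemma separated_sym: "separated a b \<Longrightarrow> separated b a"
  unfolding separated_def never_meet_def by metis

text \<open>A column after which \<open>a\<close> and \<open>c\<close> never meet can be prolonged
  so that \<open>a\<close> and \<open>b\<close> coincide; then \<open>b\<close> and \<open>c\<close>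
  would never meet from there on.\<close>

lemma not_separated_trans:
  assumes ab: "\<not> separated a b" and bc: "\<not> separated b c" shows "\<not> separated a c"
proof
  assume "separated a c"
  then obtain m k where k: "k < q ^ m" "never_meet (col m k a) (col m k c)" by (auto simp: separated_def)
  have "\<not> never_meet (col m k a) (col m k b)" using ab k by (auto simp: separated_def)
  then obtain l r where r: "r < q ^ l" "col l r (col m k a) = col l r (col m k b)"
    by (auto simp: never_meet_def)
  define K where "K = q ^ l * k + r"
  have K: "K < q ^ (l + m)" "\<And>a. col (l + m) K a = col l r (col m k a)"
    using digit_bound[OF k(1) r(1)] col_add[OF r(1) k(1)] by (auto simp: K_def)
  have "\<not> never_meet (col (l + m) K b) (col (l + m) K c)" using bc K(1) by (auto simp: separated_def)
  moreover have "never_meet (col (l + m) K a) (col (l + m) K c)"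
    using never_meet_col[OF k(2) r(1)] K(2) by simp
  ultimately show False using K(2) r(2) by simp
qed

text \<open>A class is represented by one of its letters, so the quotient word is over the same
  finite type. The choice depends on \<open>a\<close> through its class alone, as
  \<open>rep_eq_iff\<close> shows.\<close>

definition rep :: "'a \<Rightarrow> 'a" where
  "rep a = (SOME b. \<not> separated a b)"

lemma not_separated_rep: "\<not> separated a (rep a)"
  unfolding rep_def by (rule someI_ex) (use not_separated_refl in blast)

lemma rep_eq_iff: "rep a = rep b \<longleftrightarrow> \<not> separated a b"
proof
  assume "rep a = rep b"
  then show "\<not> separated a b"
    using not_separated_rep[of a] not_separated_rep[of b] not_separated_trans separated_sym by metis
next
  assume "\<not> separated a b"
  then have "(\<lambda>c. \<not> separated a c) = (\<lambda>c. \<not> separated b c)"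
    using not_separated_trans separated_sym by blast
  then show "rep a = rep b" by (simp add: rep_def)
qed

lemma rep_rep: "rep (rep a) = rep a"
  using not_separated_rep[of a] separated_sym by (auto simp: rep_eq_iff)

lemma rep_col: "rep a = rep b \<Longrightarrow> k < q ^ m \<Longrightarrow> rep (col m k a) = rep (col m k b)"
  unfolding rep_eq_iff using separated_of_col by blast

text \<open>Gives injectivity of the quotient substitution: a column witnessing separation passes
  through one of the letters of the first substitution step, and these letters are then separated
  too. At level 0 the letters already never meet, and any first step preserves this.\<close>

lemma rep_eqI_block:
  assumes "\<And>i. i < q \<Longrightarrow> rep (\<xi> a ! i) = rep (\<xi> b ! i)" shows "rep a = rep b"
  unfolding rep_eq_iff
proof
  assume "separated a b"
  then obtain m k where k: "k < q ^ m" "never_meet (col m k a) (col m k b)" by (auto simp: separated_def)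
  have ns: "\<not> separated (col 1 i a) (col 1 i b)" if "i < q" for i
    using assms[OF that] unfolding rep_eq_iff col_1 .
  show False
  proof (cases m)
    case 0
    then have "never_meet a b" using k by (simp add: col_0)
    then have "separated (col 1 0 a) (col 1 0 b)" 
      using never_meet_col[of a b 0 1] never_meet_separated q_pos by simp
    then show False using ns[of 0] q_pos by blast
  next
    case (Suc n)
    have "k < q ^ (n + 1)" using k Suc by simp
    from digit_split[OF this] have d: "k div q ^ n < q ^ 1" "k mod q ^ n < q ^ n" "q ^ n * (k div q ^ n) + k mod q ^ n = k"
      by auto
    have "col m k c = col n (k mod q ^ n) (col 1 (k div q ^ n) c)" for c
      using col_add[OF d(2,1), of c] d(3) Suc by simp
    then have "separated (col 1 (k div q ^ n) a) (col 1 (k div q ^ n) b)"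
      using k(2) d(2) unfolding separated_def by metis
    then show False using ns d(1) by simp
  qed
qed

definition quot :: "nat \<Rightarrow> 'a" where
  "quot n = rep (u n)"

lemma quot_block: "i < q \<Longrightarrow> quot (q * n + i) = rep (\<xi> (quot n) ! i)"
  using rep_col[of "u n" "rep (u n)" i 1] unfolding quot_def col_1 by (simp add: u_block rep_rep)

lemma quot_col: "k < q ^ m \<Longrightarrow> quot (q ^ m * n + k) = rep (col m k (u n))"
  by (simp add: quot_def u_col)

sublocale quot: automatic_sequence q "\<lambda>a i. rep (\<xi> a ! i)" quot
proof
  show "2 \<le> q" by (rule q_ge_2)
  show "quot (q * n + i) = rep (\<xi> (quot n) ! i)" if "i < q" for n i using quot_block that by blast
  show "\<exists>R. \<forall>s t. \<exists>r\<le>R. init_word L (\<lambda>i. quot (s + r + i)) = init_word L (\<lambda>i. quot (t + i))" for L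
  proof -
    obtain R where "\<And>s t. \<exists>r\<le>R. init_word L (\<lambda>i. u (s + r + i)) = init_word L (\<lambda>i. u (t + i))"
      using uniformly_recurrent[of L] by blast
    then have "\<exists>r\<le>R. init_word L (\<lambda>i. quot (s + r + i)) = init_word L (\<lambda>i. quot (t + i))" for s t
      unfolding init_word_eq_iff quot_def by metis
    then show ?thesis by blast
  qed
  show "quot m = quot n" if "\<And>i. i < q \<Longrightarrow> rep (\<xi> (quot m) ! i) = rep (\<xi> (quot n) ! i)" for m n
    using rep_eqI_block[OF that] by (simp add: quot_def rep_rep)
qed

text \<open>A separated pair reaches a never-meeting pair within a level \<open>M\<close> common to
  all pairs, and below that position every one of the \<open>q ^ (l - M)\<close> letters differs.
  For \<open>l < M\<close> a single mismatch suffices, as \<open>q ^ l \<le> q ^ M\<close>.\<close>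

lemma separation_density:
  "\<exists>M. \<forall>a b l. rep a \<noteq> rep b \<longrightarrow> q ^ l \<le> q ^ M * card {k. k < q ^ l \<and> rep (col l k a) \<noteq> rep (col l k b)}"
proof -
  have "\<forall>a b. \<exists>m. separated a b \<longrightarrow> (\<exists>k<q ^ m. never_meet (col m k a) (col m k b))"
    unfolding separated_def by blast
  then obtain \<mu> where \<mu>: "\<And>a b. separated a b \<Longrightarrow> \<exists>k<q ^ \<mu> a b. never_meet (col (\<mu> a b) k a) (col (\<mu> a b) k b)"
    by metis
  define M where "M = Max (range (\<lambda>(a, b). \<mu> a b))"
  have level: "\<exists>k<q ^ M. never_meet (col M k a) (col M k b)" if ab: "separated a b" for a b
  proof -
    obtain k where k: "k < q ^ \<mu> a b" "never_meet (col (\<mu> a b) k a) (col (\<mu> a b) k b)" using \<mu>[OF ab] by blast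
    have "\<mu> a b \<le> M" unfolding M_def by (rule Max_ge) (auto intro!: rev_image_eqI[of "(a, b)"])
    then obtain d where d: "M = d + \<mu> a b" by (metis le_add_diff_inverse2)
    have "col M (q ^ d * k + 0) c = col d 0 (col (\<mu> a b) k c)" for c
      unfolding d by (rule col_add) (use k q_pos in auto)
    moreover have "q ^ d * k + 0 < q ^ M" unfolding d by (rule digit_bound) (use k q_pos in auto)
    moreover have "never_meet (col d 0 (col (\<mu> a b) k a)) (col d 0 (col (\<mu> a b) k b))"
      by (rule never_meet_col[OF k(2)]) (use q_pos in simp)
    ultimately show ?thesis by metis
  qed
  have "q ^ l \<le> q ^ M * card {k. k < q ^ l \<and> rep (col l k a) \<noteq> rep (col l k b)}"
    if ab: "rep a \<noteq> rep b" for a b l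
  proof -
    let ?S = "{k. k < q ^ l \<and> rep (col l k a) \<noteq> rep (col l k b)}"
    obtain k where k: "k < q ^ M" "never_meet (col M k a) (col M k b)"
      using level ab rep_eq_iff by blast
    show ?thesis
    proof (cases "M \<le> l")
      case True
      then obtain d where d: "l = d + M" by (metis le_add_diff_inverse2)
      have "(\<lambda>r. q ^ d * k + r) ` {..<q ^ d} \<subseteq> ?S"
      proof clarify
        fix r assume r: "r < q ^ d"
        have "separated (col d r (col M k a)) (col d r (col M k b))"
          by (rule never_meet_separated[OF never_meet_col[OF k(2) r]])
        then show "q ^ d * k + r < q ^ l \<and> rep (col l (q ^ d * k + r) a) \<noteq> rep (col l (q ^ d * k + r) b)"
          unfolding d using digit_bound[OF k(1) r] col_add[OF r k(1)] by (simp add: rep_eq_iff)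
      qed
      then have "card ((\<lambda>r. q ^ d * k + r) ` {..<q ^ d}) \<le> card ?S" by (intro card_mono) auto
      then have "q ^ d \<le> card ?S" by (subst (asm) card_image) (auto simp: inj_on_def)
      then show ?thesis by (simp add: d power_add)
    next
      case False
      then obtain d where d: "M = d + l" by (metis le_add_diff_inverse2 nat_le_linear)
      from digit_split[of k d l] k(1) have s: "k div q ^ d < q ^ l" "k mod q ^ d < q ^ d" "q ^ d * (k div q ^ d) + k mod q ^ d = k"
        unfolding d by auto
      have e: "col M k c = col d (k mod q ^ d) (col l (k div q ^ d) c)" for c
        using col_add[OF s(2,1), of c] s(3) by (simp add: d)
      have "separated (col l (k div q ^ d) a) (col l (k div q ^ d) b)"
        using never_meet_separated[OF k(2)] unfolding e by (rule separated_of_col[OF s(2)])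
      then have "k div q ^ d \<in> ?S" using s(1) by (simp add: rep_eq_iff)
      then have "1 \<le> card ?S" using card_gt_0_iff[of ?S] by (auto simp: Suc_le_eq)
      moreover have "q ^ l \<le> q ^ M" by (rule power_increasing) (use False q_pos in auto)
      ultimately show ?thesis using mult_le_mono[of "q ^ l" "q ^ M" 1 "card ?S"] by simp
    qed
  qed
  then show ?thesis by blast
qed

section \<open>Height and column number\<close>

abbreviation "ht \<equiv> subst_height q u"
abbreviation "colnum \<equiv> column_number q \<xi>"

text \<open>Some return time \<open>s \<ge> 1\<close> of the letter \<open>u 0\<close> bounds all
  candidates, so the greatest one exists.\<close>

lemma
  shows height_candidate_le: "coprime k q \<Longrightarrow> (\<And>n. u n = u 0 \<Longrightarrow> k dvd n) \<Longrightarrow> k \<le> ht"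
  and height_coprime: "coprime ht q" and height_dvd: "u n = u 0 \<Longrightarrow> ht dvd n"
proof -
  let ?P = "\<lambda>k. coprime k q \<and> (\<forall>n. u n = u 0 \<longrightarrow> k dvd n)"
  obtain s where s: "s \<ge> 1" "init_word 1 u = init_word 1 (\<lambda>i. u (s + i))"
    using auto.hull_occurs_later[OF self_hull, of 1 1] by blast
  then have us: "u s = u 0" by (simp add: init_word_eq_iff)
  have bound: "k \<le> s" if "?P k" for k using that us s(1) by (auto intro: dvd_imp_le)
  have "?P 1" by simp
  then have P: "?P ht" unfolding subst_height_def by (rule GreatestI_nat) (use bound in blast)
  then show "coprime ht q" "u n = u 0 \<Longrightarrow> ht dvd n" by auto
  show "k \<le> ht" if "coprime k q" "\<And>n. u n = u 0 \<Longrightarrow> k dvd n"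
    unfolding subst_height_def by (rule Greatest_le_nat) (use that bound in blast)+
qed

lemma height_pos: "0 < ht"
  by (rule ccontr) (use height_coprime q_ge_2 in simp)

text \<open>Carries the defining property of the height from \<open>u 0\<close> to every letter: the
  same column leads from both occurrences to \<open>u 0\<close>, and multiplication by
  \<open>q ^ N\<close> is invertible modulo the height.\<close>

lemma letter_class: 
  assumes "u m = u n" shows "m mod ht = n mod ht"
proof -
  obtain N where "\<exists>k<q ^ N. col N k (u m) = u 0" using level_hitting_all by blast
  then obtain k where k: "k < q ^ N" "col N k (u m) = u 0" by blast
  have "ht dvd q ^ N * m + k" "ht dvd q ^ N * n + k"
    using height_dvd u_col[OF k(1)] k(2) assms by auto
  then have "[q ^ N * m + k = q ^ N * n + k] (mod ht)"
    by (simp add: cong_def mod_eq_0_iff_dvd[THEN iffD2])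
  then have "[q ^ N * m = q ^ N * n] (mod ht)" by (simp add: cong_add_rcancel_nat)
  moreover have "coprime (q ^ N) ht" using height_coprime by (simp add: coprime_commute)
  ultimately show ?thesis by (simp add: cong_mult_lcancel_nat cong_def[symmetric])
qed

definition class_of :: "'a \<Rightarrow> nat" where
  "class_of a = (SOME n. u n = a) mod ht"

lemma class_of_u: "class_of (u n) = n mod ht"
proof -
  have "u (SOME m. u m = u n) = u n" by (rule someI) (rule refl)
  then show ?thesis unfolding class_of_def by (rule letter_class)
qed

lemma class_of_col: "k < q ^ m \<Longrightarrow> class_of (col m k (u n)) = (q ^ m * n + k) mod ht"
  using class_of_u[of "q ^ m * n + k"] by (simp add: u_col)

lemma class_of_col_cong:
  assumes "class_of a = class_of b" "k < q ^ m" shows "class_of (col m k a) = class_of (col m k b)"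
proof -
  obtain i j where ij: "a = u i" "b = u j" using letter_occurs by metis
  have "[i = j] (mod ht)" using assms(1) by (simp add: ij class_of_u cong_def)
  then have "[q ^ m * i + k = q ^ m * j + k] (mod ht)" by (intro cong_add cong_mult) auto
  then show ?thesis using assms(2) by (simp add: ij class_of_col cong_def)
qed

text \<open>The map sending \<open>n\<close> to \<open>q ^ m * n + k\<close> permutes the residues
  modulo the height, so every column meets every class.\<close>

lemma height_le_card_classes:
  assumes "k < q ^ m" shows "ht \<le> card (class_of ` range (\<lambda>a. col m k a))"
proof -
  let ?g = "\<lambda>n. (q ^ m * n + k) mod ht"
  have "inj_on ?g {..<ht}"
  proof (rule inj_onI)
    fix i j assume ij: "i \<in> {..<ht}" "j \<in> {..<ht}" "?g i = ?g j"
    then have "[q ^ m * i + k = q ^ m * j + k] (mod ht)" by (simp add: cong_def)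
    then have "[q ^ m * i = q ^ m * j] (mod ht)" by (simp add: cong_add_rcancel_nat)
    moreover have "coprime (q ^ m) ht" using height_coprime by (simp add: coprime_commute)
    ultimately have "[i = j] (mod ht)" by (simp add: cong_mult_lcancel_nat)
    then show "i = j" using ij by (simp add: cong_def)
  qed
  then have "ht = card (?g ` {..<ht})" by (simp add: card_image)
  also have "\<dots> \<le> card (class_of ` range (\<lambda>a. col m k a))"
    by (rule card_mono) (use class_of_col[OF assms, symmetric] in \<open>auto simp del: mult_Suc_right\<close>)
  finally show ?thesis .
qed

lemma
  shows colnum_le: "1 \<le> n \<Longrightarrow> k < q ^ n \<Longrightarrow> colnum \<le> card (range (\<lambda>a. col n k a))"
  and colnum_attained: "\<exists>n k. 1 \<le> n \<and> k < q ^ n \<and> card (range (\<lambda>a. col n k a)) = colnum"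
proof -
  define S where "S = {card (range (\<lambda>a. col n k a)) | n k. n \<ge> 1 \<and> k < q ^ n}"
  have "S \<subseteq> {..CARD('a)}" unfolding S_def by (auto intro: card_mono)
  then have fin: "finite S" by (rule finite_subset) simp
  have "card (range (\<lambda>a. col 1 0 a)) \<in> S" unfolding S_def using q_pos
    by (intro CollectI exI[of _ "1::nat"] exI[of _ "0::nat"]) simp
  then have "S \<noteq> {}" by blast
  have c: "colnum = Min S" unfolding column_number_def S_def ..
  have "colnum \<in> S" unfolding c by (rule Min_in[OF fin \<open>S \<noteq> {}\<close>])
  then show "\<exists>n k. 1 \<le> n \<and> k < q ^ n \<and> card (range (\<lambda>a. col n k a)) = colnum"
    unfolding S_def mem_Collect_eq by metis
  show "colnum \<le> card (range (\<lambda>a. col n k a))" if "1 \<le> n" "k < q ^ n" unfolding c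
    by (rule Min_le[OF fin]) (use that in \<open>auto simp: S_def\<close>)
qed

lemma height_le_colnum: "ht \<le> colnum"
proof -
  obtain n k where "k < q ^ n" "card (range (\<lambda>a. col n k a)) = colnum" using colnum_attained by blast
  then show ?thesis
    using height_le_card_classes[of k n] card_image_le[of "range (\<lambda>a. col n k a)" class_of] by simp
qed

text \<open>When the two numbers agree, a smallest column has exactly one letter in each class,
  hence merges each class to a letter. Columns respect classes, so each further \<open>n0\<close>
  levels remove one of \<open>q ^ n0\<close> subblocks from the possible mismatches.\<close>

lemma coincidence_density:
  assumes "colnum = ht"
  shows "\<exists>n0\<ge>1. \<forall>j a b. class_of a = class_of b \<longrightarrow>
    card {k. k < q ^ (n0 * j) \<and> col (n0 * j) k a \<noteq> col (n0 * j) k b} \<le> (q ^ n0 - 1) ^ j"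
proof -
  obtain n0 k0 where n0: "1 \<le> n0" "k0 < q ^ n0" "card (range (\<lambda>a. col n0 k0 a)) = ht"
    using colnum_attained assms by auto
  have "card (class_of ` range (\<lambda>a. col n0 k0 a)) = card (range (\<lambda>a. col n0 k0 a))"
    using height_le_card_classes[OF n0(2)] card_image_le[of "range (\<lambda>a. col n0 k0 a)" class_of] n0(3) by simp
  then have ij: "inj_on class_of (range (\<lambda>a. col n0 k0 a))" by (intro eq_card_imp_inj_on) auto
  have merge: "col n0 k0 a = col n0 k0 b" if "class_of a = class_of b" for a b
    using class_of_col_cong[OF that n0(2)] inj_onD[OF ij] by blast
  have "card {k. k < q ^ (n0 * j) \<and> col (n0 * j) k a \<noteq> col (n0 * j) k b} \<le> (q ^ n0 - 1) ^ j"
    if "class_of a = class_of b" for a b j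
    using that
  proof (induction j arbitrary: a b)
    case 0
    have "{k. k < q ^ (n0 * 0) \<and> col (n0 * 0) k a \<noteq> col (n0 * 0) k b} \<subseteq> {0}" by auto
    then show ?case using card_mono[of "{0::nat}"] by fastforce
  next
    case (Suc j)
    define Q where "Q = q ^ (n0 * j)"
    define D where "D = (\<lambda>a b. {k. k < q ^ (n0 * j) \<and> col (n0 * j) k a \<noteq> col (n0 * j) k b})"
    let ?T = "SIGMA k:{..<q ^ n0} - {k0}. D (col n0 k a) (col n0 k b)"
    let ?S = "{k. k < q ^ (n0 * Suc j) \<and> col (n0 * Suc j) k a \<noteq> col (n0 * Suc j) k b}"
    have fin: "finite ?T" unfolding D_def by (intro finite_SigmaI) auto
    have "?S \<subseteq> (\<lambda>(k, r). Q * k + r) ` ?T"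
    proof
      fix k assume k: "k \<in> ?S"
      have sj: "n0 * Suc j = n0 * j + n0" by simp
      have "k < q ^ (n0 * j + n0)" using k unfolding sj by simp
      from digit_split[OF this] have d: "k div Q < q ^ n0" "k mod Q < q ^ (n0 * j)" "Q * (k div Q) + k mod Q = k"
        unfolding Q_def by auto
      have e: "col (n0 * Suc j) k c = col (n0 * j) (k mod Q) (col n0 (k div Q) c)" for c
        using col_add[OF d(2,1), of c] d(3) unfolding sj Q_def by simp
      have ne: "col (n0 * j) (k mod Q) (col n0 (k div Q) a) \<noteq> col (n0 * j) (k mod Q) (col n0 (k div Q) b)"
      proof -
        have "col (n0 * Suc j) k a \<noteq> col (n0 * Suc j) k b" using k by blast
        then show ?thesis unfolding e .
      qed
      then have "k div Q \<noteq> k0" using merge[OF Suc.prems] by auto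
      then have "(k div Q, k mod Q) \<in> ?T" using d ne by (simp add: D_def)
      then show "k \<in> (\<lambda>(k, r). Q * k + r) ` ?T" using d(3) by (intro rev_image_eqI) auto
    qed
    then have "card ?S \<le> card ?T" using fin card_image_le card_mono by (meson finite_imageI le_trans)
    also have "\<dots> = (\<Sum>k\<in>{..<q ^ n0} - {k0}. card (D (col n0 k a) (col n0 k b)))"
      by (rule card_SigmaI) (auto simp: D_def)
    also have "\<dots> \<le> (\<Sum>k\<in>{..<q ^ n0} - {k0}. (q ^ n0 - 1) ^ j)"
      unfolding D_def by (intro sum_mono Suc.IH class_of_col_cong[OF Suc.prems]) auto
    also have "\<dots> = (q ^ n0 - 1) ^ Suc j" using n0(2) by simp
    finally show ?case .
  qed
  then show ?thesis using n0(1) by blast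
qed

text \<open>The least period \<open>p\<close> would satisfy both \<open>p \<le> ht\<close> and
  \<open>colnum \<le> p\<close>.\<close>

lemma quot_nonperiodic:
  assumes "ht < colnum"
  shows "\<not> (\<exists>p\<ge>1. \<forall>i. quot (i + p) = quot i)"
proof
  assume ex: "\<exists>p\<ge>1. \<forall>i. quot (i + p) = quot i"
  define per where "per = (\<lambda>p. \<forall>i. quot (i + p) = quot i)"
  define p where "p = (LEAST p. 1 \<le> p \<and> per p)"
  have "1 \<le> p \<and> per p" unfolding p_def by (rule LeastI_ex) (use ex in \<open>auto simp: per_def\<close>)
  then have p: "1 \<le> p" "per p" by auto
  have mult: "quot (i + p * k) = quot i" for i k
  proof (induction k)
    case (Suc k)
    have "quot (i + p * Suc k) = quot ((i + p * k) + p)" by (simp add: algebra_simps)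
    then show ?case using p(2) Suc unfolding per_def by metis
  qed simp
  have modp: "quot (i mod p) = quot i" for i using mult[of "i mod p" "i div p"] by simp
  have dvd: "p dvd d" if "per d" for d
  proof -
    have "quot (i + d mod p) = quot i" for i
      using mult[of "i + d mod p" "d div p"] that by (simp add: per_def add.assoc)
    then have "per (d mod p)" by (simp add: per_def)
    then have "\<not> 1 \<le> d mod p" 
      using not_less_Least[of "d mod p" "\<lambda>p. 1 \<le> p \<and> per p", folded p_def] p(1) by simp
    then have "d mod p = 0" by simp
    then show ?thesis by (simp only: mod_eq_0_iff_dvd)
  qed
  have "coprime p q"
  proof -
    define g where "g = gcd p q"
    obtain p' q' where g: "p = g * p'" "q = g * q'" unfolding g_def by (meson gcd_dvd1 gcd_dvd2 dvdE)
    \<comment> \<open>Shifting by \<open>q * p'\<close>, a multiple of \<open>p\<close>, changes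
      nothing, so the blocks of the letters at \<open>n + p'\<close> and \<open>n\<close> agree, and
      so do the letters. As \<open>p\<close> divides every period, this leaves no room for a common
      factor.\<close>
    have "quot (n + p') = quot n" for n
    proof (rule quot.blocks_inj)
      fix i assume i: "i < q"
      have "q * (n + p') + i = (q * n + i) + p * q'" using g by (simp add: algebra_simps)
      then have "quot (q * (n + p') + i) = quot (q * n + i)" by (simp only: mult)
      then show "rep (\<xi> (quot (n + p')) ! i) = rep (\<xi> (quot n) ! i)" using quot_block[OF i] by simp
    qed
    then have "p dvd p'" by (intro dvd) (simp add: per_def)
    moreover have "0 < p'" using p(1) g(1) by (cases p') auto
    ultimately have "g * p' \<le> p'" using g(1) by (auto dest: dvd_imp_le)
    then have "g \<le> 1" using \<open>0 < p'\<close> by simp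
    moreover have "g > 0" using p(1) g(1) by (cases g) auto
    ultimately have "g = 1" by linarith
    then show ?thesis unfolding g_def by (simp only: coprime_iff_gcd_eq_1)
  qed
  \<comment> \<open>Equal letters of \<open>u\<close> have equal blocks of level \<open>m\<close>,
    and agreement on at least \<open>p\<close> letters determines a periodic word; so
    \<open>q ^ m * n\<close> is a period.\<close>
  moreover have "p dvd n" if un: "u n = u 0" for n
  proof -
    obtain m where m: "p \<le> q ^ m" using power_unbounded by blast
    have "quot (i + q ^ m * n) = quot i" for i
    proof -
      have im: "i mod p < q ^ m" using m p(1) mod_less_divisor[of p i] by linarith
      have "i + q ^ m * n = (q ^ m * n + i mod p) + p * (i div p)" by simp
      then have "quot (i + q ^ m * n) = quot (q ^ m * n + i mod p)" by (simp only: mult)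
      also have "\<dots> = quot (q ^ m * 0 + i mod p)" unfolding quot_col[OF im] un ..
      finally show ?thesis using modp by simp
    qed
    then have "p dvd q ^ m * n" by (intro dvd) (simp add: per_def)
    then show ?thesis using \<open>coprime p q\<close> by (simp add: coprime_dvd_mult_right_iff)
  qed
  ultimately have "p \<le> ht" by (rule height_candidate_le)
  moreover have "colnum \<le> p"
  proof -
    obtain n0 k0 where n0: "1 \<le> n0" "k0 < q ^ n0" "card (range (\<lambda>a. col n0 k0 a)) = colnum"
      using colnum_attained by blast
    define R where "R = range (\<lambda>a. col n0 k0 a)"
    \<comment> \<open>Two equivalent letters in a smallest column would be merged by some further
      column, producing a column with fewer than \<open>colnum\<close> letters.\<close>
    have "inj_on rep R"
    proof (rule inj_onI, rule ccontr)
      fix a b assume ab: "a \<in> R" "b \<in> R" "rep a = rep b" "a \<noteq> b"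
      then have "\<not> never_meet a b" using never_meet_separated rep_eq_iff by blast
      then obtain l r where r: "r < q ^ l" "col l r a = col l r b" by (auto simp: never_meet_def)
      have "colnum \<le> card (range (\<lambda>a. col (l + n0) (q ^ l * k0 + r) a))"
        using colnum_le[of "l + n0"] n0(1) digit_bound[OF n0(2) r(1)] by simp
      also have "range (\<lambda>a. col (l + n0) (q ^ l * k0 + r) a) = (\<lambda>c. col l r c) ` R"
        unfolding R_def image_image using col_add[OF r(1) n0(2)] by simp
      also have "card \<dots> < card R"
      proof -
        have "\<not> inj_on (\<lambda>c. col l r c) R" using ab r(2) by (auto simp: inj_on_def)
        then show ?thesis using eq_card_imp_inj_on[of R] card_image_le[of R "\<lambda>c. col l r c"]
          by (metis finite le_neq_implies_less)
      qed
      finally show False using n0(3) by (simp add: R_def)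
    qed
    then have "colnum = card (rep ` R)" using n0(3) by (simp add: card_image R_def)
    also have "\<dots> \<le> card (quot ` {..<p})"
    proof (rule card_mono)
      have "rep a \<in> quot ` {..<p}" for a
      proof -
        obtain n where "u n = a" using letter_occurs by blast
        then have "rep a = quot (n mod p)" using modp by (simp add: quot_def)
        then show ?thesis using p(1) by auto
      qed
      then show "rep ` R \<subseteq> quot ` {..<p}" by blast
    qed simp
    also have "\<dots> \<le> p" using card_image_le[of "{..<p}" quot] by simp
    finally show ?thesis .
  qed
  ultimately show False using assms by simp
qed

end

section \<open>Cylinders, completed measures and epsilon-entropy\<close>

lemma openin_word_coordinate: "openin word_topology {x. x i \<in> A}"
proof -
  have "continuous_map word_topology (discrete_topology UNIV) (\<lambda>x. x i)"
    unfolding word_topology_def by (rule continuous_map_product_projection) simp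
  from openin_continuous_map_preimage[OF this, of A] show ?thesis by (simp add: word_topology_def)
qed

lemma openin_word_cylinder: "openin word_topology {x. init_word L x = init_word L y}"
proof (induction L)
  case (Suc L)
  have "{x. init_word (Suc L) x = init_word (Suc L) y} = {x. init_word L x = init_word L y} \<inter> {x. x L \<in> {y L}}"
    by (auto simp: init_word_eq_iff less_Suc_eq)
  then show ?case using openin_Int[OF Suc openin_word_coordinate[of L "{y L}"]] by simp
qed (use openin_word_coordinate[of 0 UNIV] in \<open>simp add: init_word_def\<close>)

lemma word_cylinder_subset_open:
  assumes "openin word_topology U" "x \<in> U"
  shows "\<exists>L. {y. init_word L y = init_word L x} \<subseteq> U"
proof -
  obtain V where V: "finite {i. V i \<noteq> UNIV}" "x \<in> Pi\<^sub>E UNIV V" "Pi\<^sub>E UNIV V \<subseteq> U"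
    using assms unfolding word_topology_def openin_product_topology_alt by auto
  obtain L where L: "\<And>i. V i \<noteq> UNIV \<Longrightarrow> i < L"
    using V(1) unfolding finite_nat_set_iff_bounded by auto
  have "y \<in> U" if "init_word L y = init_word L x" for y
  proof -
    have "y i \<in> V i" for i using that V(2) L[of i] by (cases "V i = UNIV") (auto simp: init_word_eq_iff)
    then show ?thesis using V(3) by (auto simp: PiE_UNIV_domain)
  qed
  then show ?thesis by blast
qed

text \<open>Sets of a partition are measurable for the completion, whereas shift invariance is given
  for Borel sets; enlarging to a Borel set of equal measure bridges the two.\<close>

lemma completion_hull:
  assumes "A \<in> sets (completion M)"
  shows "\<exists>B\<in>sets M. A \<subseteq> B \<and> emeasure M B = emeasure (completion M) A"
proof -
  obtain S N N' where A: "A = S \<union> N" "N \<subseteq> N'" "N' \<in> null_sets M" "S \<in> sets M"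
    using assms by (rule sets_completionE)
  have "emeasure M (S \<union> N') = emeasure M S" using A by (simp add: emeasure_Un_null_set)
  also have "\<dots> = emeasure (completion M) A"
  proof (rule antisym)
    have "emeasure M S = emeasure (completion M) S" using A by simp
    also have "\<dots> \<le> emeasure (completion M) A" by (rule emeasure_mono) (use A assms in auto)
    finally show "emeasure M S \<le> emeasure (completion M) A" .
    have "emeasure (completion M) A \<le> emeasure (completion M) (S \<union> N')"
      by (rule emeasure_mono) (use A in auto)
    also have "\<dots> = emeasure M (S \<union> N')" 
    proof -
      have "S \<union> N' \<in> sets M" using A by auto
      then show ?thesis by simp
    qed
    finally show "emeasure (completion M) A \<le> emeasure M S" using A by (simp add: emeasure_Un_null_set)
  qed
  finally show ?thesis using A by (intro bexI[of _ "S \<union> N'"]) auto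
qed

lemma eps_entropy_le:
  assumes "1 \<le> k" "eps_partition M \<rho> \<epsilon> k P"
  shows "eps_entropy M \<rho> \<epsilon> \<le> ereal (log 2 (real k))"
proof -
  let ?Q = "\<lambda>k. 1 \<le> k \<and> (\<exists>P. eps_partition M \<rho> \<epsilon> k P)"
  have "?Q k" using assms by blast
  then have l: "?Q (LEAST k. ?Q k)" "(LEAST k. ?Q k) \<le> k" by (rule LeastI[of ?Q], rule Least_le[of ?Q])
  then have "log 2 (real (LEAST k. ?Q k)) \<le> log 2 (real k)" by simp
  moreover have "\<exists>k\<ge>1. \<exists>P. eps_partition M \<rho> \<epsilon> k P" using assms by blast
  ultimately show ?thesis unfolding eps_entropy_def by simp
qed

lemma eps_entropy_ge:
  assumes "0 < K" "\<And>k P. 1 \<le> k \<Longrightarrow> eps_partition M \<rho> \<epsilon> k P \<Longrightarrow> K \<le> real k"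
  shows "ereal (log 2 K) \<le> eps_entropy M \<rho> \<epsilon>"
proof (cases "\<exists>k\<ge>1. \<exists>P. eps_partition M \<rho> \<epsilon> k P")
  case True
  let ?Q = "\<lambda>k. 1 \<le> k \<and> (\<exists>P. eps_partition M \<rho> \<epsilon> k P)"
  have "?Q (LEAST k. ?Q k)" by (rule LeastI_ex[of ?Q]) (use True in simp)
  then obtain P where "1 \<le> (LEAST k. ?Q k)" "eps_partition M \<rho> \<epsilon> (LEAST k. ?Q k) P" by (elim conjE exE)
  then have "K \<le> real (LEAST k. ?Q k)" by (rule assms(2))
  then show ?thesis using True assms(1) unfolding eps_entropy_def by simp
qed (auto simp: eps_entropy_def)

lemma semimetric_diam_bound: "x \<in> S \<Longrightarrow> y \<in> S \<Longrightarrow> semimetric_diam \<rho> S < ennreal \<epsilon> \<Longrightarrow> 0 < \<epsilon> \<Longrightarrow> \<rho> x y < \<epsilon>"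
proof -
  assume "x \<in> S" "y \<in> S" "semimetric_diam \<rho> S < ennreal \<epsilon>" "0 < \<epsilon>"
  moreover have "ennreal (\<rho> x y) \<le> semimetric_diam \<rho> S"
    unfolding semimetric_diam_def using \<open>x \<in> S\<close> \<open>y \<in> S\<close> by (intro SUP_upper2[of "(x, y)"]) auto
  ultimately have "ennreal (\<rho> x y) < ennreal \<epsilon>" by simp
  then show "\<rho> x y < \<epsilon>" using \<open>0 < \<epsilon>\<close> by (cases "\<rho> x y \<ge> 0") (auto simp: ennreal_less_iff)
qed

definition cut_semimetric :: "(nat \<Rightarrow> 'a) \<Rightarrow> (nat \<Rightarrow> 'a) \<Rightarrow> real" where
  "cut_semimetric x y = (if x 0 = y 0 then 0 else 1)"

lemma semimetric_avg_cut:
  "semimetric_avg word_shift n cut_semimetric x y = card {i. i < n \<and> x i \<noteq> y i} / n"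
proof -
  have "(\<Sum>k<n. cut_semimetric ((word_shift ^^ k) x) ((word_shift ^^ k) y)) = (\<Sum>k<n. if x k \<noteq> y k then 1 else 0)"
    by (intro sum.cong) (simp_all add: cut_semimetric_def word_shift_pow)
  also have "\<dots> = real (card ({..<n} \<inter> {i. x i \<noteq> y i}))" by (subst sum.If_cases) simp_all
  also have "{..<n} \<inter> {i. x i \<noteq> y i} = {i. i < n \<and> x i \<noteq> y i}" by auto
  finally show ?thesis by (simp add: semimetric_avg_def)
qed

section \<open>The invariant measure on the orbit hull\<close>

locale substitution_system = substitution_fixed_point q \<xi> u
  for q and \<xi> :: "'a::finite \<Rightarrow> 'a list" and u +
  fixes \<mu> :: "(nat \<Rightarrow> 'a) measure"
  assumes two_letters: "CARD('a) > 1"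
    and invariant: "invariant_borel_prob word_topology (orbit_closure u) word_shift \<mu>"
begin

text \<open>Cylinders form a neighbourhood base. The restriction to \<open>n \<ge> 1\<close> in
  \<open>orbit_closure\<close> is harmless because recurrence moves every occurrence of a word to a
  positive position.\<close>

lemma orbit_closure_eq: "orbit_closure u = orbit_hull u"
proof (intro set_eqI iffI)
  fix x assume x: "x \<in> orbit_closure u"
  have "\<exists>s. init_word L x = init_word L (\<lambda>i. u (s + i))" for L
  proof -
    from x[unfolded orbit_closure_def in_closure_of, THEN conjunct2, THEN spec[of _ "{y. init_word L y = init_word L x}"]]
    obtain n where "init_word L ((word_shift ^^ n) u) = init_word L x"
      using openin_word_cylinder[of L x] by auto
    then show ?thesis unfolding word_shift_pow by (intro exI[of _ n]) (rule sym)
  qed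
  then show "x \<in> orbit_hull u" by (simp add: orbit_hull_def)
next
  fix x assume x: "x \<in> orbit_hull u"
  have "\<exists>y\<in>{(word_shift ^^ n) u | n. n \<ge> 1}. y \<in> U" if U: "x \<in> U" "openin word_topology U" for U
  proof -
    obtain L where L: "{y. init_word L y = init_word L x} \<subseteq> U" using word_cylinder_subset_open U by blast
    obtain s where "s \<ge> 1" "init_word L x = init_word L (\<lambda>i. u (s + i))"
      using auto.hull_occurs_later[OF x] by blast
    then show ?thesis using L by (intro bexI[of _ "(word_shift ^^ s) u"]) (auto simp: word_shift_pow)
  qed
  then show "x \<in> orbit_closure u" unfolding orbit_closure_def in_closure_of
    by (auto simp: word_topology_def)
qed

abbreviation "X \<equiv> orbit_hull u"

lemma prob_space_mu: "prob_space \<mu>"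
  and space_mu: "space \<mu> = X"
  and shift_measurable: "word_shift \<in> measurable \<mu> \<mu>"
  and shift_preserves: "distr \<mu> \<mu> word_shift = \<mu>"
  using invariant by (auto simp: invariant_borel_prob_def orbit_closure_eq)

sublocale mu: prob_space \<mu> by (rule prob_space_mu)

sublocale cmu: prob_space "completion \<mu>"
  by (rule prob_spaceI) (simp add: mu.emeasure_space_1)

lemma open_in_sets: "openin word_topology U \<Longrightarrow> U \<inter> X \<in> sets \<mu>"
  using invariant by (auto simp: invariant_borel_prob_def orbit_closure_eq openin_subtopology intro!: sigma_sets.Basic)

lemma coordinate_measurable: "(\<lambda>x. x i) \<in> measurable \<mu> (count_space UNIV)"
proof (rule measurableI)
  fix A
  have "(\<lambda>x. x i) -` A \<inter> space \<mu> = {x. x i \<in> A} \<inter> X" by (auto simp: space_mu)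
  then show "(\<lambda>x. x i) -` A \<inter> space \<mu> \<in> sets \<mu>" using open_in_sets[OF openin_word_coordinate] by simp
qed simp

lemma sets_init_word: "{x \<in> X. Q (init_word n x)} \<in> sets \<mu>"
proof -
  have cyl: "{x \<in> X. init_word n x = init_word n y} \<in> sets \<mu>" for y
    using open_in_sets[OF openin_word_cylinder[of n y]] by (simp add: Int_def conj_commute)
  have "{x \<in> X. Q (init_word n x)} = (\<Union>w\<in>{w \<in> range (init_word n). Q w}. {x \<in> X. init_word n x = w})"
    by auto
  also have "\<dots> \<in> sets \<mu>"
    by (rule sets.finite_UN) (use finite_range_init_word[of n] cyl in auto)
  finally show ?thesis .
qed

lemma singleton_in_sets: "x \<in> X \<Longrightarrow> {x} \<in> sets \<mu>"
proof -
  assume x: "x \<in> X"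
  have "{x} = (\<Inter>n. {y \<in> X. init_word n y = init_word n x})"
  proof (intro equalityI subsetI)
    fix y assume "y \<in> (\<Inter>n. {y \<in> X. init_word n y = init_word n x})"
    then have "init_word (Suc i) y = init_word (Suc i) x" for i by auto
    then have "y i = x i" for i unfolding init_word_eq_iff by blast
    then show "y \<in> {x}" by auto
  qed (use x in auto)
  also have "\<dots> \<in> sets \<mu>" by (rule sets.countable_INT) (use sets_init_word in auto)
  finally show ?thesis .
qed

lemma shift_in_X: "x \<in> X \<Longrightarrow> word_shift x \<in> X"
  using hull_shift[of x u 1] by (simp add: word_shift_def)

lemma emeasure_shift:
  assumes "A \<in> sets \<mu>" shows "emeasure \<mu> {x \<in> X. word_shift x \<in> A} = emeasure \<mu> A"
proof -
  have "emeasure \<mu> A = emeasure (distr \<mu> \<mu> word_shift) A" by (simp add: shift_preserves)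
  also have "\<dots> = emeasure \<mu> (word_shift -` A \<inter> space \<mu>)" by (rule emeasure_distr[OF shift_measurable assms])
  also have "word_shift -` A \<inter> space \<mu> = {x \<in> X. word_shift x \<in> A}" by (auto simp: space_mu)
  finally show ?thesis by simp
qed

lemma preimage_in_sets: "A \<in> sets \<mu> \<Longrightarrow> {x \<in> X. word_shift x \<in> A} \<in> sets \<mu>"
proof -
  assume "A \<in> sets \<mu>"
  from measurable_sets[OF shift_measurable this] show ?thesis
    by (simp add: space_mu vimage_def Int_def conj_commute)
qed

section \<open>The cut semimetric\<close>

lemma cut_measurable_semimetric: "measurable_semimetric (completion \<mu>) cut_semimetric"
proof -
  let ?M = "completion \<mu> \<Otimes>\<^sub>M completion \<mu>"
  have c: "(\<lambda>x. x 0) \<in> measurable (completion \<mu>) (count_space UNIV)"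
    by (rule measurable_completion[OF coordinate_measurable])
  have [measurable]: "(\<lambda>p. fst p 0) \<in> measurable ?M (count_space UNIV)" "(\<lambda>p. snd p 0) \<in> measurable ?M (count_space UNIV)"
    by (rule measurable_compose[OF measurable_fst c], rule measurable_compose[OF measurable_snd c])
  \<comment> \<open>Equality of first letters is spelled out as a finite union of measurable
    rectangles.\<close>
  have "(\<lambda>p. if \<exists>a\<in>UNIV. fst p 0 = a \<and> snd p 0 = a then 0 else 1 :: real) \<in> borel_measurable ?M"
    by measurable
  also have "(\<lambda>p. if \<exists>a\<in>UNIV. fst p 0 = a \<and> snd p 0 = a then 0 else 1 :: real) = case_prod (cut_semimetric :: (nat \<Rightarrow> 'a) \<Rightarrow> _)"
    by (auto simp: cut_semimetric_def fun_eq_iff)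
  finally have "case_prod (cut_semimetric :: (nat \<Rightarrow> 'a) \<Rightarrow> _) \<in> borel_measurable (completion ?M)"
    by (rule measurable_completion)
  moreover have "semimetric_on (space (completion \<mu>)) cut_semimetric"
    by (auto simp: semimetric_on_def cut_semimetric_def)
  ultimately show ?thesis by (simp add: measurable_semimetric_def)
qed

lemma cut_summable: "summable_semimetric (completion \<mu>) cut_semimetric"
proof -
  interpret pair: pair_prob_space "completion \<mu>" "completion \<mu>" ..
  let ?M = "completion (completion \<mu> \<Otimes>\<^sub>M completion \<mu>)"
  have "(\<integral>\<^sup>+ p. ennreal (case_prod cut_semimetric p) \<partial>?M) \<le> (\<integral>\<^sup>+ p. 1 \<partial>?M)"
    by (rule nn_integral_mono) (auto simp: cut_semimetric_def)
  also have "\<dots> = emeasure ?M (space ?M)" by simp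
  also have "\<dots> = 1" using pair.emeasure_space_1 by simp
  finally have "(\<integral>\<^sup>+ p. ennreal (case_prod cut_semimetric p) \<partial>?M) < \<infinity>"
    using ennreal_one_less_top by (simp add: le_less_trans)
  then show ?thesis unfolding summable_semimetric_def using cut_measurable_semimetric by blast
qed

lemma cut_admissible: "admissible_semimetric (completion \<mu>) cut_semimetric"
proof -
  have full: "full_measure (completion \<mu>) X"
    using sets.top[of "completion \<mu>"] by (simp add: full_measure_def space_mu)
  define pick where "pick = (\<lambda>a. SOME x. x \<in> X \<and> x 0 = a)"
  have pick: "pick (x 0) \<in> X \<and> pick (x 0) 0 = x 0" if "x \<in> X" for x
    unfolding pick_def by (rule someI[of _ x]) (use that in simp)
  define D where "D = pick ` ((\<lambda>x. x 0) ` X)"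
  have "countable D" unfolding D_def by (intro countable_image countable_finite) simp
  moreover have "D \<subseteq> X" using pick by (auto simp: D_def)
  moreover have "\<exists>d\<in>D. cut_semimetric x d < \<epsilon>" if "x \<in> X" "0 < \<epsilon>" for x \<epsilon>
    using pick[OF that(1)] that by (intro bexI[of _ "pick (x 0)"]) (auto simp: D_def cut_semimetric_def)
  ultimately show ?thesis unfolding admissible_semimetric_def
    using cut_measurable_semimetric full by blast
qed

text \<open>The mass of an atom does not decrease along its forward orbit, so the orbit is finite
  and the point is eventually periodic; uniform recurrence then makes \<open>u\<close>
  periodic.\<close>

lemma no_atoms:
  assumes np: "\<not> (\<exists>p\<ge>1. \<forall>i. u (i + p) = u i)" and x: "x \<in> X"
  shows "emeasure \<mu> {x} = 0"
proof (rule ccontr)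
  assume pos: "emeasure \<mu> {x} \<noteq> 0"
  define y where "y = (\<lambda>n i. x (n + i))"
  have yX: "y n \<in> X" for n unfolding y_def by (rule hull_shift[OF x])
  \<comment> \<open>\<open>y n\<close> lies in the shift preimage of \<open>y (Suc n)\<close>, and
    that preimage has the same measure as the singleton.\<close>
  have inc: "emeasure \<mu> {x} \<le> emeasure \<mu> {y n}" for n
  proof (induction n)
    case (Suc n)
    have "emeasure \<mu> {y n} \<le> emeasure \<mu> {z \<in> X. word_shift z \<in> {y (Suc n)}}"
    proof (rule emeasure_mono[OF _ preimage_in_sets[OF singleton_in_sets[OF yX]]])
      show "{y n} \<subseteq> {z \<in> X. word_shift z \<in> {y (Suc n)}}"
        using yX[of n] by (auto simp: y_def word_shift_def)
    qed
    then show ?case using Suc emeasure_shift[OF singleton_in_sets[OF yX]] by simp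
  qed (simp add: y_def)
  have "\<not> inj y"
  proof
    assume "inj y"
    then have "(\<Sum>n. emeasure \<mu> {y n}) = emeasure \<mu> (\<Union>n. {y n})"
      by (intro suminf_emeasure) (use yX singleton_in_sets in \<open>auto simp: disjoint_family_on_def inj_def\<close>)
    also have "\<dots> \<le> 1" by (rule mu.emeasure_le_1)
    finally have s: "(\<Sum>n. emeasure \<mu> {y n}) \<le> 1" .
    have "of_nat N * emeasure \<mu> {x} \<le> 1" for N
    proof -
      have "of_nat N * emeasure \<mu> {x} = (\<Sum>n<N. emeasure \<mu> {x})" by simp
      also have "\<dots> \<le> (\<Sum>n<N. emeasure \<mu> {y n})" by (intro sum_mono inc)
      also have "\<dots> \<le> (\<Sum>n. emeasure \<mu> {y n})" by (rule sum_le_suminf) auto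
      finally show ?thesis using s by simp
    qed
    moreover obtain r where r: "emeasure \<mu> {x} = ennreal r" "0 < r"
      using pos mu.emeasure_eq_measure[of "{x}"] by (metis ennreal_0 less_eq_real_def measure_nonneg)
    ultimately have "ennreal (real N * r) \<le> 1" for N
      by (metis ennreal_mult' ennreal_of_nat_eq_real_of_nat of_nat_0_le_iff)
    then have "real N * r \<le> 1" for N by (simp add: ennreal_le_1)
    moreover obtain N where "1 < real N * r" using r(2) reals_Archimedean3 by blast
    ultimately show False by (meson not_less)
  qed
  then obtain m p where p: "1 \<le> p" "y m = y (m + p)"
    unfolding inj_def by (metis add_diff_inverse_nat less_imp_le not_less_iff_gr_or_eq zero_less_diff Suc_le_eq One_nat_def not_less)
  have "u (i + p) = u i" for i
  proof -
    \<comment> \<open>A prefix of \<open>u\<close> longer than \<open>i + p\<close> occurs in the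
      periodic tail \<open>y m\<close>.\<close>
    obtain r where r: "init_word (Suc (i + p)) (\<lambda>j. y m (r + j)) = init_word (Suc (i + p)) (\<lambda>j. u (0 + j))"
      using auto.hull_uniformly_recurrent[of "Suc (i + p)"] yX by blast
    have "u (i + p) = y m (r + (i + p))" "u i = y m (r + i)" using r unfolding init_word_eq_iff by auto
    moreover have "y m (r + (i + p)) = y (m + p) (r + i)" by (simp add: y_def ac_simps)
    ultimately show ?thesis using p(2) by simp
  qed
  then show False using np p(1) by blast
qed

text \<open>With a period \<open>p \<ge> 1\<close>, every point of the hull has
  \<open>x p = x 0\<close>, so its first letter could be read off its tail.\<close>

lemma left_special_nonperiodic:
  assumes "auto.left_special \<noteq> {}" shows "\<not> (\<exists>p\<ge>1. \<forall>i. u (i + p) = u i)"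
proof clarify
  fix p :: nat assume p: "1 \<le> p" "\<forall>i. u (i + p) = u i"
  have per: "x p = x 0" if x: "x \<in> X" for x
  proof -
    obtain s where "init_word (Suc p) x = init_word (Suc p) (\<lambda>i. u (s + i))" using hullD[OF x] by blast
    then show ?thesis using p(2) by (simp add: init_word_eq_iff)
  qed
  obtain x y where "x \<in> X" "y \<in> X" "x 0 \<noteq> y 0" "\<And>i. x (Suc i) = y (Suc i)"
    using assms by (auto simp: auto.left_special_def auto.asymptotic_pairs_def)
  then show False using per p(1) by (metis One_nat_def Suc_le_D)
qed

text \<open>The shift is injective off the full orbits of the finitely many left special points.\<close>

lemma cut_generating: "generating_semimetric (completion \<mu>) word_shift cut_semimetric"
proof -
  \<comment> \<open>All points sharing some tail with a left special word: a countable set,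
    invariant under the shift in both directions.\<close>
  define O' where "O' = {x \<in> X. \<exists>m n. \<exists>w\<in>auto.left_special. (\<lambda>i. x (m + i)) = (\<lambda>i. w (n + i))}"
  have "countable O'"
  proof -
    have fin: "finite {x. (\<lambda>i. x (m + i)) = z}" for m and z :: "nat \<Rightarrow> 'a"
    proof (rule finite_imageD)
      show "finite (init_word m ` {x. (\<lambda>i. x (m + i)) = z})"
        by (rule finite_subset[OF _ finite_range_init_word[of m]]) auto
      show "inj_on (init_word m) {x. (\<lambda>i. x (m + i)) = z}"
      proof (rule inj_onI, rule ext)
        fix x y :: "nat \<Rightarrow> 'a" and i
        assume h: "x \<in> {x. (\<lambda>i. x (m + i)) = z}" "y \<in> {x. (\<lambda>i. x (m + i)) = z}" "init_word m x = init_word m y"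
        show "x i = y i"
        proof (cases "i < m")
          case True then show ?thesis using h(3) by (simp add: init_word_eq_iff)
        next
          case False
          have "(\<lambda>i. x (m + i)) = (\<lambda>i. y (m + i))" using h(1,2) by simp
          from fun_cong[OF this, of "i - m"] have "x (m + (i - m)) = y (m + (i - m))" .
          then show ?thesis using False by simp
        qed
      qed
    qed
    have "O' \<subseteq> (\<Union>m. \<Union>n. \<Union>w\<in>auto.left_special. {x. (\<lambda>i. x (m + i)) = (\<lambda>i. w (n + i))})"
      by (auto simp: O'_def)
    moreover have "countable \<dots>"
      by (intro countable_UN countable_finite[OF fin] countable_finite[OF auto.finite_left_special]) auto
    ultimately show ?thesis by (rule countable_subset)
  qed
  have O'X: "O' \<subseteq> X" by (auto simp: O'_def)
  \<comment> \<open>A point of \<open>O'\<close> presupposes a left special word, which excludes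
    periodicity and with it atoms. In the periodic case \<open>O'\<close> is empty.\<close>
  have "{x} \<in> null_sets \<mu>" if "x \<in> O'" for x
  proof (rule null_setsI)
    have "auto.left_special \<noteq> {}" using that by (auto simp: O'_def)
    then show "emeasure \<mu> {x} = 0"
      using no_atoms[OF left_special_nonperiodic] O'X that by blast
  qed (use singleton_in_sets O'X that in blast)
  then have "(\<Union>x\<in>O'. {x}) \<in> null_sets \<mu>" using \<open>countable O'\<close> by (intro null_sets_UN') auto
  then have null: "O' \<in> null_sets \<mu>" by simp
  define X' where "X' = X - O'"
  have full: "full_measure (completion \<mu>) X'"
  proof -
    have "X - O' \<in> sets \<mu>" using null sets.compl_sets[of O' \<mu>] by (auto simp: space_mu)
    moreover have "X - X' = O'" using O'X by (auto simp: X'_def)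
    moreover have "O' \<in> null_sets (completion \<mu>)" using null by (simp add: null_sets_completionI)
    ultimately show ?thesis by (simp add: full_measure_def X'_def space_mu)
  qed
  have shift_iff: "word_shift x \<in> O' \<longleftrightarrow> x \<in> O'" if x: "x \<in> X" for x
  proof
    assume "word_shift x \<in> O'"
    then obtain m n w where w: "w \<in> auto.left_special" "(\<lambda>i. word_shift x (m + i)) = (\<lambda>i. w (n + i))"
      by (auto simp: O'_def)
    then have "(\<lambda>i. x (Suc m + i)) = (\<lambda>i. w (n + i))" by (simp add: word_shift_def)
    then show "x \<in> O'" using w(1) x unfolding O'_def by blast
  next
    assume "x \<in> O'"
    then obtain m n w where w: "w \<in> auto.left_special" "(\<lambda>i. x (m + i)) = (\<lambda>i. w (n + i))"
      by (auto simp: O'_def)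
    have "word_shift x (m + i) = w (Suc n + i)" for i
      using fun_cong[OF w(2), of "Suc i"] by (simp add: word_shift_def)
    then show "word_shift x \<in> O'" using w(1) shift_in_X[OF x] unfolding O'_def by blast
  qed
  have "bij_betw word_shift X' X'"
    unfolding bij_betw_def
  proof (intro conjI inj_onI equalityI subsetI)
    fix x y assume h: "x \<in> X'" "y \<in> X'" "word_shift x = word_shift y"
    have tail: "x (Suc i) = y (Suc i)" for i using fun_cong[OF h(3)] by (simp add: word_shift_def)
    show "x = y"
    proof (rule ccontr)
      assume "x \<noteq> y"
      then obtain i where "x i \<noteq> y i" by auto
      then have "x 0 \<noteq> y 0" using tail by (cases i) auto
      then have "(x, y) \<in> auto.asymptotic_pairs" using h tail by (auto simp: auto.asymptotic_pairs_def X'_def)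
      then have "(\<lambda>i. x (Suc i)) \<in> auto.left_special" by (force simp: auto.left_special_def)
      then have "\<exists>m n. \<exists>w\<in>auto.left_special. (\<lambda>i. x (m + i)) = (\<lambda>i. w (n + i))"
        by (intro exI[of _ 1] exI[of _ 0] bexI[of _ "\<lambda>i. x (Suc i)"]) simp_all
      then have "x \<in> O'" using h(1) by (simp add: O'_def X'_def)
      then show False using h(1) by (simp add: X'_def)
    qed
  next
    fix z assume "z \<in> word_shift ` X'"
    then show "z \<in> X'" using shift_in_X shift_iff by (auto simp: X'_def)
  next
    fix z assume z: "z \<in> X'"
    then obtain x where x: "x \<in> X" "\<And>i. x (Suc i) = z i" using auto.hull_preimage[of z] by (auto simp: X'_def)
    then have "word_shift x = z" by (auto simp: word_shift_def)
    then show "z \<in> word_shift ` X'" using x z shift_iff[OF x(1)] by (auto simp: X'_def)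
  qed
  \<comment> \<open>A differing coordinate \<open>i\<close> is brought to position 0 by the power
    \<open>i \<ge> 0\<close>.\<close>
  moreover have "\<exists>k::int. cut_semimetric (iter_int_on X' word_shift k x) (iter_int_on X' word_shift k y) > 0"
    if xy: "x \<noteq> y" for x y :: "nat \<Rightarrow> 'a"
  proof -
    obtain i where "x i \<noteq> y i" using xy by auto
    then show ?thesis
      by (intro exI[of _ "int i"]) (simp add: iter_int_on_def word_shift_pow cut_semimetric_def)
  qed
  ultimately show ?thesis
    unfolding generating_semimetric_def using cut_measurable_semimetric full by blast
qed

end

context substitution_system
begin

abbreviation "entropy n \<epsilon> \<equiv> eps_entropy (completion \<mu>) (semimetric_avg word_shift n cut_semimetric) \<epsilon>"

section \<open>Upper bounds\<close>

lemma entropy_le_of_word_partition: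
  assumes \<epsilon>: "0 < \<epsilon>" and k: "1 \<le> k" and g: "\<And>x. x \<in> X \<Longrightarrow> g (init_word n x) < (k :: nat)"
    and d: "d < \<epsilon>" "\<And>x y. x \<in> X \<Longrightarrow> y \<in> X \<Longrightarrow> g (init_word n x) = g (init_word n y) \<Longrightarrow>
        semimetric_avg word_shift n cut_semimetric x y \<le> d"
  shows "entropy n \<epsilon> \<le> ereal (log 2 k)"
proof (rule eps_entropy_le[OF k])
  \<comment> \<open>Index 0 is reserved for the exceptional set, here empty, so the values of
    \<open>g\<close> are shifted by one.\<close>
  define P where "P = (\<lambda>j. if j = 0 then {} else {x \<in> X. g (init_word n x) = j - 1})"
  have sets: "P j \<in> sets (completion \<mu>)" for j
    unfolding P_def using sets_init_word[of "\<lambda>w. g w = j - 1" n] by simp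
  show "eps_partition (completion \<mu>) (semimetric_avg word_shift n cut_semimetric) \<epsilon> k P"
    unfolding eps_partition_def
  proof (intro conjI ballI)
    show "\<forall>j\<le>k. P j \<in> sets (completion \<mu>)" using sets by blast
    show "disjoint_family_on P {..k}" by (auto simp: disjoint_family_on_def P_def)
    show "(\<Union>j\<le>k. P j) = space (completion \<mu>)"
    proof (intro equalityI subsetI)
      fix x assume "x \<in> space (completion \<mu>)"
      then have "x \<in> X" by (simp add: space_mu)
      then have "x \<in> P (Suc (g (init_word n x)))" "Suc (g (init_word n x)) \<le> k"
        using g[of x] by (auto simp: P_def)
      then show "x \<in> (\<Union>j\<le>k. P j)" by blast
    qed (auto simp: P_def space_mu split: if_splits)
    show "emeasure (completion \<mu>) (P 0) < ennreal \<epsilon>" using \<epsilon> by (simp add: P_def)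
    fix j assume "j \<in> {1..k}"
    have "semimetric_diam (semimetric_avg word_shift n cut_semimetric) (P j) \<le> ennreal d"
      unfolding semimetric_diam_def by (rule SUP_least) (use d(2) in \<open>auto simp: P_def split: if_splits intro!: ennreal_leI\<close>)
    also have "\<dots> < ennreal \<epsilon>" using d(1) \<epsilon> by (simp add: ennreal_lessI)
    finally show "semimetric_diam (semimetric_avg word_shift n cut_semimetric) (P j) < ennreal \<epsilon>" .
  qed
qed

lemma entropy_le_log_complexity:
  assumes "0 < \<epsilon>" "1 \<le> n"
  shows "entropy n \<epsilon> \<le> ereal (log 2 (real (CARD('a)\<^sup>2 * q) * real n))"
proof -
  obtain g where g: "bij_betw g (auto.factors n) {0..<card (auto.factors n)}"
    using ex_bij_betw_finite_nat[OF auto.finite_factors] by blast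
  have inF: "init_word n x \<in> auto.factors n" if "x \<in> X" for x
    using hullD[OF that, of n] by (auto simp: auto.factors_def)
  have "entropy n \<epsilon> \<le> ereal (log 2 (card (auto.factors n)))"
  proof (rule entropy_le_of_word_partition[OF assms(1)])
    have "auto.factors n \<noteq> {}" by (auto simp: auto.factors_def)
    then show "1 \<le> card (auto.factors n)" using auto.finite_factors[of n] by (simp add: Suc_le_eq card_gt_0_iff)
    show "g (init_word n x) < card (auto.factors n)" if "x \<in> X" for x
      using bij_betwE[OF g] inF[OF that] by auto
    show "0 < \<epsilon>" by fact
    fix x y assume "x \<in> X" "y \<in> X" "g (init_word n x) = g (init_word n y)"
    then have "init_word n x = init_word n y" using g inF by (auto simp: bij_betw_def inj_on_def)
    then have "{i. i < n \<and> x i \<noteq> y i} = {}" by (auto simp: init_word_eq_iff)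
    then show "semimetric_avg word_shift n cut_semimetric x y \<le> 0" by (simp only: semimetric_avg_cut) simp
  qed
  also have "\<dots> \<le> ereal (log 2 (real (CARD('a)\<^sup>2 * q) * real n))"
  proof -
    have "auto.factors n \<noteq> {}" by (auto simp: auto.factors_def)
    then have "0 < card (auto.factors n)" using auto.finite_factors[of n] by (simp add: card_gt_0_iff)
    moreover have "real (card (auto.factors n)) \<le> real (CARD('a)\<^sup>2 * q) * real n"
      using auto.card_factors_linear[OF assms(2)] unfolding of_nat_mult[symmetric] of_nat_le_iff .
    ultimately show ?thesis by (simp del: of_nat_mult)
  qed
  finally show ?thesis .
qed

text \<open>Equal phases align the two windows with the same block boundaries, so mismatches can be
  counted block by block. The summand 2 covers the incomplete blocks at both ends.\<close>

lemma mismatch_le: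
  assumes "s mod q ^ m = t mod q ^ m"
    and N: "\<And>k. card {r. r < q ^ m \<and> col m r (u (s div q ^ m + k)) \<noteq> col m r (u (t div q ^ m + k))} \<le> N"
  shows "card {i. i < n \<and> u (s + i) \<noteq> u (t + i)} \<le> (n div q ^ m + 2) * N"
proof -
  define Q where "Q = q ^ m"
  have Q: "0 < Q" using q_pos by (simp add: Q_def)
  define r where "r = s mod Q"
  define D where "D = (\<lambda>k. {r. r < Q \<and> col m r (u (s div Q + k)) \<noteq> col m r (u (t div Q + k))})"
  let ?T = "SIGMA k:{..<n div Q + 2}. D k"
  let ?g = "\<lambda>i. ((r + i) div Q, (r + i) mod Q)"
  have fin: "finite ?T" unfolding D_def by (intro finite_SigmaI) auto
  have val: "u (w + i) = col m ((r + i) mod Q) (u (w div Q + (r + i) div Q))" if "w mod Q = r" for w i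
  proof -
    have "w + i = Q * (w div Q) + (r + i)" using mult_div_mod_eq[of Q w] that by simp
    also have "\<dots> = Q * (w div Q + (r + i) div Q) + (r + i) mod Q"
      by (simp add: distrib_left)
    finally show ?thesis using u_col[of "(r + i) mod Q" m] Q by (simp add: Q_def)
  qed
  have "?g ` {i. i < n \<and> u (s + i) \<noteq> u (t + i)} \<subseteq> ?T"
  proof (rule image_subsetI)
    fix i assume "i \<in> {i. i < n \<and> u (s + i) \<noteq> u (t + i)}"
    then have i: "i < n" "u (s + i) \<noteq> u (t + i)" by auto
    have "r + i < Q * (n div Q + 2)"
      using i(1) mod_less_divisor[OF Q, of s] mod_less_divisor[OF Q, of n] mult_div_mod_eq[of Q n]
      unfolding r_def distrib_left by linarith
    then have "(r + i) div Q < n div Q + 2" using Q by (simp add: div_less_iff_less_mult mult.commute)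
    moreover have "(r + i) mod Q \<in> D ((r + i) div Q)"
      unfolding D_def using val[of s i] val[of t i] i(2) assms(1) Q by (simp add: Q_def r_def)
    ultimately show "?g i \<in> ?T" by simp
  qed
  moreover have "inj_on ?g {i. i < n \<and> u (s + i) \<noteq> u (t + i)}"
  proof (rule inj_onI)
    fix i j assume "?g i = ?g j"
    then have "r + i = r + j" by (metis mult_div_mod_eq prod.inject)
    then show "i = j" by simp
  qed
  ultimately have "card {i. i < n \<and> u (s + i) \<noteq> u (t + i)} \<le> card ?T"
    using fin by (intro card_inj_on_le)
  also have "\<dots> = (\<Sum>k<n div Q + 2. card (D k))" by (rule card_SigmaI) (auto simp: D_def)
  also have "\<dots> \<le> (\<Sum>k<n div Q + 2. N)" by (intro sum_mono) (use N in \<open>simp add: D_def Q_def\<close>)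
  finally show ?thesis by (simp add: Q_def)
qed

text \<open>Words are grouped by the residue modulo \<open>Q * ht\<close> of a position where they
  occur in \<open>u\<close>. It fixes the phase modulo \<open>Q\<close> and the height class of each
  block, so aligned blocks differ in a proportion of at most \<open>\<theta> ^ j\<close>. The number
  of groups depends on \<epsilon>, not on \<open>n\<close>.\<close>

lemma entropy_bounded:
  assumes c: "colnum = ht" and \<epsilon>: "0 < \<epsilon>"
  shows "\<exists>k::nat. 1 \<le> k \<and> (\<forall>\<^sub>F n in sequentially. entropy n \<epsilon> \<le> ereal (log 2 k))"
proof -
  obtain n0 where n0: "1 \<le> n0" "\<And>j a b. class_of a = class_of b \<Longrightarrow>
      card {k. k < q ^ (n0 * j) \<and> col (n0 * j) k a \<noteq> col (n0 * j) k b} \<le> (q ^ n0 - 1) ^ j"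
    using coincidence_density[OF c] by blast
  define \<theta> where "\<theta> = real (q ^ n0 - 1) / real (q ^ n0)"
  have qn: "0 < q ^ n0" using q_pos by simp
  have "real (q ^ n0 - 1) < real (q ^ n0)" using qn by simp
  then have "\<theta> < 1" unfolding \<theta>_def using qn by (simp add: divide_less_eq del: of_nat_power)
  then obtain j where j: "\<theta> ^ j < \<epsilon> / 2" using real_arch_pow_inv[of "\<epsilon> / 2" \<theta>] \<epsilon> by auto
  define Q N where "Q = q ^ (n0 * j)" and "N = (q ^ n0 - 1) ^ j"
  have Q: "0 < Q" using q_pos by (simp add: Q_def)
  have NQ: "real N / real Q = \<theta> ^ j" by (simp add: N_def Q_def \<theta>_def power_divide power_mult)
  \<comment> \<open>The contribution of the incomplete end blocks, which vanishes for long
    windows.\<close>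
  have "\<forall>\<^sub>F n in sequentially. 2 * real N / real n < \<epsilon> / 2"
    using \<epsilon> by real_asymp
  then have ev: "\<forall>\<^sub>F n in sequentially. 1 \<le> n \<and> real N / real Q + 2 * real N / real n < \<epsilon>"
    using eventually_ge_at_top[of 1]
  proof eventually_elim
    case (elim n)
    then show ?case using j NQ by linarith
  qed
  have "1 \<le> Q * ht" using Q height_pos by (simp add: Suc_le_eq)
  have "entropy n \<epsilon> \<le> ereal (log 2 (Q * ht))"
    if n: "1 \<le> n" "real N / real Q + 2 * real N / real n < \<epsilon>" for n
  proof (rule entropy_le_of_word_partition[OF \<epsilon> \<open>1 \<le> Q * ht\<close> _ n(2)])
    define pos where "pos = (\<lambda>w. SOME s. w = init_word n (\<lambda>i. u (s + i)))"
    have pos: "init_word n x = init_word n (\<lambda>i. u (pos (init_word n x) + i))" if "x \<in> X" for x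
      unfolding pos_def by (rule someI_ex) (rule hullD[OF that])
    show "pos (init_word n x) mod (Q * ht) < Q * ht" for x using \<open>1 \<le> Q * ht\<close> by simp
    fix x y assume x: "x \<in> X" and y: "y \<in> X"
      and eq: "pos (init_word n x) mod (Q * ht) = pos (init_word n y) mod (Q * ht)"
    define s t where "s = pos (init_word n x)" and "t = pos (init_word n y)"
    have st: "s mod (Q * ht) = t mod (Q * ht)" using eq by (simp add: s_def t_def)
    then have res: "s mod Q = t mod Q" by (metis mod_mult_right_eq mod_mod_cancel dvd_triv_left)
    moreover have "(s mod (Q * ht)) div Q = (s div Q) mod ht" "(t mod (Q * ht)) div Q = (t div Q) mod ht"
      using Q by (simp_all add: mod_mult2_eq)
    ultimately have cl: "(s div Q) mod ht = (t div Q) mod ht" using st by simp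
    have "class_of (u (s div Q + k)) = class_of (u (t div Q + k))" for k
      unfolding class_of_u using cl by (metis mod_add_left_eq)
    then have m: "card {i. i < n \<and> u (s + i) \<noteq> u (t + i)} \<le> (n div Q + 2) * N"
      unfolding Q_def N_def by (intro mismatch_le n0(2)) (use res in \<open>simp_all add: Q_def\<close>)
    have "{i. i < n \<and> x i \<noteq> y i} = {i. i < n \<and> u (s + i) \<noteq> u (t + i)}"
      using pos[OF x] pos[OF y] unfolding s_def[symmetric] t_def[symmetric] init_word_eq_iff by auto
    then have "card {i. i < n \<and> x i \<noteq> y i} \<le> (n div Q + 2) * N" using m by simp
    then have "real (card {i. i < n \<and> x i \<noteq> y i}) \<le> real ((n div Q + 2) * N)" by (rule of_nat_mono)
    then have "real (card {i. i < n \<and> x i \<noteq> y i}) \<le> (real (n div Q) + 2) * real N"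
      by (simp add: algebra_simps)
    also have "\<dots> \<le> (real n / real Q + 2) * real N"
      by (intro mult_right_mono add_right_mono of_nat_div_le_of_nat) simp
    finally have "real (card {i. i < n \<and> x i \<noteq> y i}) / n \<le> (real n / real Q + 2) * real N / n"
      by (rule divide_right_mono) simp
    also have "\<dots> = real N / real Q + 2 * real N / real n" using n(1) Q by (simp add: field_simps)
    finally show "semimetric_avg word_shift n cut_semimetric x y \<le> real N / real Q + 2 * real N / real n"
      by (simp add: semimetric_avg_cut)
  qed
  then have "\<forall>\<^sub>F n in sequentially. entropy n \<epsilon> \<le> ereal (log 2 (Q * ht))"
    using ev by (auto elim!: eventually_mono)
  moreover have "1 \<le> real Q * real ht" using of_nat_mono[OF \<open>1 \<le> Q * ht\<close>, where 'a = real] by simp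
  ultimately show ?thesis using \<open>1 \<le> Q * ht\<close> by (intro exI[of _ "Q * ht"]) simp
qed

section \<open>Lower bounds\<close>

text \<open>The chosen mismatches are distinct because division by \<open>L\<close> recovers the
  window.\<close>

lemma mismatch_blocks:
  assumes K: "\<And>k. k < K \<Longrightarrow> \<exists>i. k * L \<le> i \<and> i < Suc k * L \<and> i < n \<and> x i \<noteq> y i"
  shows "K \<le> card {i. i < n \<and> x i \<noteq> y i}"
proof -
  obtain \<iota> where \<iota>: "\<And>k. k < K \<Longrightarrow> k * L \<le> \<iota> k \<and> \<iota> k < Suc k * L \<and> \<iota> k < n \<and> x (\<iota> k) \<noteq> y (\<iota> k)"
    using K by metis
  have "\<iota> k div L = k" if "k < K" for k
    using \<iota>[OF that] by (intro div_nat_eqI) (auto simp: mult.commute)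
  then have "inj_on \<iota> {..<K}" by (intro inj_on_inverseI[of _ "\<lambda>i. i div L"]) auto
  moreover have "\<iota> ` {..<K} \<subseteq> {i. i < n \<and> x i \<noteq> y i}" using \<iota> by auto
  ultimately have "card {..<K} \<le> card {i. i < n \<and> x i \<noteq> y i}" by (intro card_inj_on_le) auto
  then show ?thesis by simp
qed

lemma diff_letters: "\<exists>t. u t \<noteq> u (Suc t)"
proof (rule ccontr)
  assume "\<not> ?thesis"
  then have "u t = u 0" for t by (induction t) auto
  then have "a = u 0" for a using letter_occurs[of a] by auto
  then have "(UNIV :: 'a set) = {u 0}" by auto
  then have "CARD('a) = 1" by (metis card_1_singleton_iff One_nat_def)
  then show False using two_letters by simp
qed

text \<open>Letters change within bounded gaps, so a point and its shift stay at distance at least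
  \<open>\<epsilon>0\<close> and cannot share a set of small diameter. If there were only one such
  set, the exceptional set and its shift preimage would cover the space, although each has measure
  below one half.\<close>

lemma entropy_ge_1:
  "\<exists>\<epsilon>0>0. \<forall>\<epsilon>>0. \<epsilon> < \<epsilon>0 \<longrightarrow> (\<forall>\<^sub>F n in sequentially. 1 \<le> entropy n \<epsilon>)"
proof -
  obtain t where t: "u t \<noteq> u (Suc t)" using diff_letters by blast
  obtain R where R: "\<And>x. x \<in> X \<Longrightarrow> \<exists>r\<le>R. init_word 2 (\<lambda>i. x (r + i)) = init_word 2 (\<lambda>i. u (t + i))"
    using auto.hull_uniformly_recurrent[of 2] by blast
  have change: "\<exists>r\<le>R. x r \<noteq> x (Suc r)" if x: "x \<in> X" for x
  proof -
    obtain r where r: "r \<le> R" "init_word 2 (\<lambda>i. x (r + i)) = init_word 2 (\<lambda>i. u (t + i))" using R[OF x] by blast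
    from r(2) have "\<forall>i<2. x (r + i) = u (t + i)" unfolding init_word_eq_iff .
    from this[rule_format, of 0] this[rule_format, of 1] have "x r = u t" "x (Suc r) = u (Suc t)" by simp_all
    then show ?thesis using r(1) t by auto
  qed
  define L where "L = Suc R"
  have "0 < L" by (simp add: L_def)
  \<comment> \<open>There is one mismatch in each of the \<open>n div L\<close> full windows, and
    rounding costs at most a factor 2.\<close>
  define \<epsilon>0 where "\<epsilon>0 = 1 / (2 * real L)"
  have "\<epsilon>0 > 0" by (simp add: \<epsilon>0_def L_def)
  have \<epsilon>0: "\<epsilon>0 \<le> 1 / 2" by (simp add: \<epsilon>0_def L_def)
  have far: "\<epsilon>0 \<le> semimetric_avg word_shift n cut_semimetric x (word_shift x)" if x: "x \<in> X" and n: "2 * L \<le> n" for x n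
  proof -
    have "n div L \<le> card {i. i < n \<and> x i \<noteq> word_shift x i}"
    proof (rule mismatch_blocks)
      fix k assume k: "k < n div L"
      obtain r where r: "r \<le> R" "x (k * L + r) \<noteq> x (k * L + Suc r)" using change[OF hull_shift[OF x]] by blast
      have "Suc k * L \<le> n div L * L" using k by (intro mult_le_mono1) simp
      also have "\<dots> \<le> n" by simp
      finally have "Suc k * L \<le> n" .
      then show "\<exists>i. k * L \<le> i \<and> i < Suc k * L \<and> i < n \<and> x i \<noteq> word_shift x i"
        using r by (intro exI[of _ "k * L + r"]) (auto simp: L_def word_shift_def)
    qed
    moreover have "n \<le> 2 * L * (n div L)"
    proof -
      have "n < L * (n div L) + L" 
        using mod_less_divisor[of L n] mult_div_mod_eq[of L n] \<open>0 < L\<close> by linarith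
      moreover have "L * 2 \<le> L * (n div L)" using n by (intro mult_le_mono2) (simp add: L_def less_eq_div_iff_mult_less_eq)
      ultimately show ?thesis by linarith
    qed
    ultimately have "n \<le> 2 * L * card {i. i < n \<and> x i \<noteq> word_shift x i}"
      by (meson le_trans mult_le_mono2)
    then have "real n \<le> real (2 * L * card {i. i < n \<and> x i \<noteq> word_shift x i})" by (rule of_nat_mono)
    then have "real n \<le> 2 * real L * real (card {i. i < n \<and> x i \<noteq> word_shift x i})" by simp
    then show ?thesis unfolding semimetric_avg_cut \<epsilon>0_def using n by (simp add: field_simps L_def)
  qed
  have "1 \<le> entropy n \<epsilon>" if \<epsilon>: "0 < \<epsilon>" "\<epsilon> < \<epsilon>0" and n: "2 * L \<le> n" for n \<epsilon>
  proof -
    have "ereal (log 2 2) \<le> entropy n \<epsilon>"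
    proof (rule eps_entropy_ge, simp, rule ccontr)
      fix k P assume k: "1 \<le> k" "eps_partition (completion \<mu>) (semimetric_avg word_shift n cut_semimetric) \<epsilon> k P" "\<not> 2 \<le> real k"
      then have "k = 1" by simp
      with k(2) have P: "P 0 \<in> sets (completion \<mu>)" "P 0 \<union> P 1 = X" "emeasure (completion \<mu>) (P 0) < ennreal \<epsilon>"
        "semimetric_diam (semimetric_avg word_shift n cut_semimetric) (P 1) < ennreal \<epsilon>"
        by (auto simp: eps_partition_def space_mu atMost_Suc)
      obtain B where B: "B \<in> sets \<mu>" "P 0 \<subseteq> B" "emeasure \<mu> B = emeasure (completion \<mu>) (P 0)"
        using completion_hull[OF P(1)] by blast
      have "X \<subseteq> B \<union> {x \<in> X. word_shift x \<in> B}"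
      proof (rule ccontr)
        assume "\<not> ?thesis"
        then obtain x where x: "x \<in> X" "x \<notin> B" "word_shift x \<notin> B" by blast
        then have "x \<in> P 1" "word_shift x \<in> P 1" using P(2) B(2) shift_in_X[OF x(1)] by auto
        then show False using far[OF x(1) n] semimetric_diam_bound[OF _ _ P(4) \<epsilon>(1)] \<epsilon>(2) by (meson less_le_trans not_less less_imp_le)
      qed
      then have "emeasure \<mu> X \<le> emeasure \<mu> (B \<union> {x \<in> X. word_shift x \<in> B})"
        by (rule emeasure_mono) (use B preimage_in_sets in auto)
      also have "\<dots> \<le> emeasure \<mu> B + emeasure \<mu> {x \<in> X. word_shift x \<in> B}"
        by (rule emeasure_subadditive) (use B preimage_in_sets in auto)
      also have "\<dots> = emeasure \<mu> B + emeasure \<mu> B" by (simp add: emeasure_shift[OF B(1)])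
      finally have "1 \<le> emeasure \<mu> B + emeasure \<mu> B" using mu.emeasure_space_1 by (simp add: space_mu)
      moreover have "emeasure \<mu> B = ennreal (measure \<mu> B)" by (rule mu.emeasure_eq_measure)
      ultimately have "1 \<le> measure \<mu> B + measure \<mu> B" by (simp flip: ennreal_plus)
      moreover have "measure \<mu> B < \<epsilon>" 
      proof -
        have "ennreal (measure \<mu> B) < ennreal \<epsilon>" using P(3) B(3) mu.emeasure_eq_measure[of B] by simp
        then show ?thesis by (simp add: ennreal_less_iff)
      qed
      ultimately show False using \<epsilon>(2) \<epsilon>0 by linarith
    qed
    then show ?thesis by (simp add: one_ereal_def)
  qed
  then have "\<forall>\<epsilon>>0. \<epsilon> < \<epsilon>0 \<longrightarrow> (\<forall>\<^sub>F n in sequentially. 1 \<le> entropy n \<epsilon>)"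
    by (auto intro!: eventually_mono[OF eventually_ge_at_top[of "2 * L"]])
  then show ?thesis using \<open>\<epsilon>0 > 0\<close> by blast
qed

text \<open>If two positions agree modulo \<open>q ^ l\<close> but not modulo \<open>q ^ (l + 1)\<close>, then in the coarse words
  desubstituted \<open>l\<close> times every window of length \<open>L\<close> shows a mismatch, and each such mismatch costs
  a fixed proportion of a block of length \<open>q ^ l\<close>.\<close>

lemma phase_separation:
  assumes "ht < colnum"
  shows "\<exists>L\<ge>1. \<exists>C\<ge>1. \<forall>m n s t. s mod q ^ m \<noteq> t mod q ^ m \<longrightarrow> 4 * L * q ^ m \<le> n \<longrightarrow>
    n \<le> C * card {i. i < n \<and> quot (s + i) \<noteq> quot (t + i)}"
proof -
  obtain L0 where L0: "\<And>s t. init_word L0 (\<lambda>i. quot (s + i)) = init_word L0 (\<lambda>i. quot (t + i)) \<Longrightarrow> s mod q = t mod q"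
    using quot.recognizable[OF quot_nonperiodic[OF assms]] by blast
  define L where "L = Suc L0"
  have "0 < L" by (simp add: L_def)
  have Lrec: "\<exists>i<L. quot (s + i) \<noteq> quot (t + i)" if "s mod q \<noteq> t mod q" for s t
    using L0[of s t] that unfolding init_word_eq_iff L_def by (meson less_SucI)
  obtain M where M: "\<And>a b l. rep a \<noteq> rep b \<Longrightarrow> q ^ l \<le> q ^ M * card {k. k < q ^ l \<and> rep (col l k a) \<noteq> rep (col l k b)}"
    using separation_density by blast
  have "n \<le> 2 * L * q ^ M * card {i. i < n \<and> quot (s + i) \<noteq> quot (t + i)}"
    if st: "s mod q ^ m \<noteq> t mod q ^ m" and n: "4 * L * q ^ m \<le> n" for m n s t
  proof -
    \<comment> \<open>The least level at which the positions are told apart; it is positive because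
      all residues modulo \<open>q ^ 0\<close> agree.\<close>
    define l' where "l' = (LEAST l. s mod q ^ l \<noteq> t mod q ^ l)"
    have l': "s mod q ^ l' \<noteq> t mod q ^ l'" "l' \<le> m"
      unfolding l'_def by (rule LeastI[of "\<lambda>l. s mod q ^ l \<noteq> t mod q ^ l", OF st], rule Least_le[of "\<lambda>l. s mod q ^ l \<noteq> t mod q ^ l", OF st])
    then obtain l where l: "l' = Suc l" by (cases l') auto
    define Q where "Q = q ^ l"
    have Q: "0 < Q" using q_pos by (simp add: Q_def)
    have eqQ: "s mod Q = t mod Q"
      using not_less_Least[of l "\<lambda>l. s mod q ^ l \<noteq> t mod q ^ l"] l by (simp add: l'_def Q_def)
    define r where "r = s mod Q"
    \<comment> \<open>The first blocks of level \<open>l\<close> starting strictly after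
      \<open>s\<close> and \<open>t\<close>; they lie at the same distance \<open>Q - r\<close> from
      both positions. Their indices still differ modulo \<open>q\<close>, and advancing both by
      \<open>k\<close> preserves this.\<close>
    define s' t' where "s' = Suc (s div Q)" and "t' = Suc (t div Q)"
    have "s mod (Q * q) = Q * (s div Q mod q) + s mod Q" "t mod (Q * q) = Q * (t div Q mod q) + t mod Q"
      by (simp_all add: mod_mult2_eq)
    moreover have "s mod (Q * q) \<noteq> t mod (Q * q)" using l' l by (simp add: Q_def mult.commute)
    ultimately have "(s div Q) mod q \<noteq> (t div Q) mod q" using eqQ by auto
    then have ne: "(s' + k) mod q \<noteq> (t' + k) mod q" for k
      unfolding s'_def t'_def by (metis add_Suc_right add_Suc cong_def cong_add_rcancel_nat)
    \<comment> \<open>One block is given up for the partial block at the start; the remaining full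
      blocks are cut into windows of \<open>L\<close> blocks.\<close>
    define K where "K = (n div Q - 1) div L"
    define D where "D = (\<lambda>k. {j. j < Q \<and> quot (Q * (s' + k) + j) \<noteq> quot (Q * (t' + k) + j)})"
    have "\<exists>i. k * L \<le> i \<and> i < Suc k * L \<and> quot (s' + i) \<noteq> quot (t' + i)" for k
    proof -
      obtain i where "i < L" "quot ((s' + k * L) + i) \<noteq> quot ((t' + k * L) + i)" using Lrec[OF ne] by blast
      then show ?thesis by (intro exI[of _ "k * L + i"]) (auto simp: add.assoc)
    qed
    then obtain \<iota> where \<iota>: "\<And>k. k * L \<le> \<iota> k" "\<And>k. \<iota> k < Suc k * L" "\<And>k. quot (s' + \<iota> k) \<noteq> quot (t' + \<iota> k)" by metis
    have \<iota>div: "\<iota> k div L = k" for k using \<iota>(1,2)[of k] by (intro div_nat_eqI) (auto simp: mult.commute)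
    have cardD: "Q \<le> q ^ M * card (D (\<iota> k))" for k
    proof -
      have "D (\<iota> k) = {j. j < q ^ l \<and> rep (col l j (u (s' + \<iota> k))) \<noteq> rep (col l j (u (t' + \<iota> k)))}"
        unfolding D_def Q_def using quot_col by auto
      then show ?thesis using M[of "u (s' + \<iota> k)" "u (t' + \<iota> k)" l] \<iota>(3)[of k] by (simp add: quot_def Q_def)
    qed
    let ?T = "SIGMA k:{..<K}. D (\<iota> k)"
    let ?g = "\<lambda>(k, j). Q * Suc (\<iota> k) + j - r"
    have rQ: "r < Q" using Q by (simp add: r_def)
    have sQ: "s = Q * (s div Q) + r" unfolding r_def by simp
    have tQ: "t = Q * (t div Q) + r" unfolding r_def eqQ by simp
    have KL: "\<iota> k < n div Q - 1" if "k < K" for k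
    proof -
      have "Suc k * L \<le> K * L" using that by (intro mult_le_mono1) simp
      also have "\<dots> \<le> n div Q - 1" unfolding K_def by simp
      finally show ?thesis using \<iota>(2)[of k] by linarith
    qed
    have "?g ` ?T \<subseteq> {i. i < n \<and> quot (s + i) \<noteq> quot (t + i)}"
    proof (rule image_subsetI)
      fix p assume "p \<in> ?T"
      then obtain k j where p: "p = (k, j)" and kj: "k \<in> {..<K}" "j \<in> D (\<iota> k)" by auto
      then have j: "j < Q" "quot (Q * (s' + \<iota> k) + j) \<noteq> quot (Q * (t' + \<iota> k) + j)" by (auto simp: D_def)
      have "Suc (Suc (\<iota> k)) \<le> n div Q" using KL[of k] kj by simp
      then have "Q * Suc (Suc (\<iota> k)) \<le> Q * (n div Q)" by (rule mult_le_mono2)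
      also have "\<dots> \<le> n" by simp
      finally have "Q * Suc (\<iota> k) + j - r < n" using j(1) by simp
      moreover have "s + (Q * Suc (\<iota> k) + j - r) = Q * (s' + \<iota> k) + j" "t + (Q * Suc (\<iota> k) + j - r) = Q * (t' + \<iota> k) + j"
        using rQ sQ tQ unfolding s'_def t'_def distrib_left mult_Suc_right by linarith+
      ultimately show "?g p \<in> {i. i < n \<and> quot (s + i) \<noteq> quot (t + i)}"
        using j(2) by (simp only: p prod.case mem_Collect_eq) simp
    qed
    moreover have "inj_on ?g ?T"
    proof (rule inj_onI)
      fix p p' assume pp: "p \<in> ?T" "p' \<in> ?T" "?g p = ?g p'"
      obtain k j k' j' where p: "p = (k, j)" "p' = (k', j')" by (metis prod.collapse)
      have h: "j \<in> D (\<iota> k)" "j' \<in> D (\<iota> k')" "Q * Suc (\<iota> k) + j - r = Q * Suc (\<iota> k') + j' - r"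
        using pp by (auto simp: p)
      have jQ: "j < Q" "j' < Q" using h by (auto simp: D_def)
      have e: "Q * Suc (\<iota> k) + j = Q * Suc (\<iota> k') + j'" using h(3) rQ by simp
      have "Suc (\<iota> k) = Suc (\<iota> k')" using arg_cong[OF e, of "\<lambda>x. x div Q"] jQ by (simp del: mult_Suc_right)
      moreover have "j = j'" using arg_cong[OF e, of "\<lambda>x. x mod Q"] jQ by (simp del: mult_Suc_right)
      ultimately show "p = p'" unfolding p by (metis \<iota>div nat.inject)
    qed
    ultimately have "card ?T \<le> card {i. i < n \<and> quot (s + i) \<noteq> quot (t + i)}" by (intro card_inj_on_le) auto
    moreover have "card ?T = (\<Sum>k<K. card (D (\<iota> k)))" by (rule card_SigmaI) (auto simp: D_def)
    moreover have "K * Q \<le> q ^ M * (\<Sum>k<K. card (D (\<iota> k)))"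
      using sum_mono[of "{..<K}" "\<lambda>_. Q" "\<lambda>k. q ^ M * card (D (\<iota> k))"] cardD by (simp add: sum_distrib_left)
    ultimately have c: "K * Q \<le> q ^ M * card {i. i < n \<and> quot (s + i) \<noteq> quot (t + i)}"
      by (elim order_trans) (intro mult_le_mono2, linarith)
    have "n \<le> 2 * L * (K * Q)"
    proof -
      define a where "a = n div Q"
      have "Q * q \<le> q ^ m" using power_increasing[of "Suc l" m q] l' l q_pos by (simp add: Q_def mult.commute)
      moreover have "Q \<le> Q * q" using q_pos by simp
      ultimately have "Q \<le> q ^ m" by linarith
      then have "4 * L * Q \<le> 4 * L * q ^ m" by (rule mult_le_mono2)
      then have "4 * L * Q \<le> n" using n by linarith
      then have a: "4 * L \<le> a" unfolding a_def using Q by (simp add: less_eq_div_iff_mult_less_eq)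
      have "n < Q * a + Q" unfolding a_def using mod_less_divisor[OF Q, of n] mult_div_mod_eq[of Q n] by linarith
      have "a - 1 < L * K + L" unfolding K_def a_def[symmetric] 
        using mod_less_divisor[of L "a - 1"] mult_div_mod_eq[of L "a - 1"] \<open>0 < L\<close> by linarith
      then have "a \<le> L * K + L" by linarith
      \<comment> \<open>Since \<open>a \<ge> 4 * L\<close> forces \<open>K \<ge> 3\<close>, both
        rounding losses are absorbed by the doubling.\<close>
      then have "a + 1 \<le> 2 * L * K" using a by (simp add: L_def)
      then have "(a + 1) * Q \<le> 2 * L * K * Q" by (rule mult_le_mono1)
      then show ?thesis using \<open>n < Q * a + Q\<close> by (simp add: algebra_simps)
    qed
    also have "\<dots> \<le> 2 * L * (q ^ M * card {i. i < n \<and> quot (s + i) \<noteq> quot (t + i)})"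
      using c by (rule mult_le_mono2)
    finally show ?thesis by (simp only: mult.assoc)
  qed
  moreover have "1 \<le> 2 * L * q ^ M" using q_pos by (simp add: L_def Suc_le_eq)
  moreover have "1 \<le> L" by (simp add: L_def)
  ultimately show ?thesis by blast
qed

text \<open>Sets of small diameter lie inside a single phase class modulo \<open>q ^ m\<close>, and the shift permutes
  these classes cyclically, so each of them has measure \<open>1 / q ^ m\<close>.\<close>

lemma entropy_ge_log:
  assumes "ht < colnum"
  shows "\<exists>\<epsilon>0>0. \<exists>B>0. \<forall>\<epsilon>>0. \<epsilon> < \<epsilon>0 \<longrightarrow> (\<forall>\<^sub>F n in sequentially. ereal (log 2 (real n / B)) \<le> entropy n \<epsilon>)"
proof -
  obtain L C where L: "1 \<le> L" "1 \<le> C" "\<And>m n s t. s mod q ^ m \<noteq> t mod q ^ m \<Longrightarrow> 4 * L * q ^ m \<le> n \<Longrightarrow>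
    n \<le> C * card {i. i < n \<and> quot (s + i) \<noteq> quot (t + i)}"
    using phase_separation[OF assms] by blast
  \<comment> \<open>A phase class modulo \<open>q ^ m\<close>. The prefix length is the threshold
    beyond which a word of \<open>u\<close> determines its position modulo \<open>q ^ m\<close>, so
    the class is a finite union of cylinders.\<close>
  define ph where "ph = (\<lambda>m r. {x \<in> X. \<exists>s. s mod q ^ m = r \<and> init_word (4 * L * q ^ m) x = init_word (4 * L * q ^ m) (\<lambda>i. u (s + i))})"
  have unique: "s mod q ^ m = t mod q ^ m"
    if "init_word n x = init_word n (\<lambda>i. u (s + i))" "init_word n x = init_word n (\<lambda>i. u (t + i))" "4 * L * q ^ m \<le> n"
    for m n s t x
  proof (rule ccontr)
    assume "s mod q ^ m \<noteq> t mod q ^ m"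
    from L(3)[OF this that(3)] have "n \<le> C * card {i. i < n \<and> quot (s + i) \<noteq> quot (t + i)}" .
    moreover have "{i. i < n \<and> quot (s + i) \<noteq> quot (t + i)} = {}"
      using that(1,2) by (auto simp: init_word_eq_iff quot_def)
    ultimately show False using that(3) L(1) q_pos by simp
  qed
  have ph_sets: "ph m r \<in> sets \<mu>" for m r
    unfolding ph_def by (rule sets_init_word)
  have ph_cover: "\<exists>s. init_word n x = init_word n (\<lambda>i. u (s + i)) \<and> x \<in> ph m (s mod q ^ m)" if x: "x \<in> X" and n: "4 * L * q ^ m \<le> n" for x m n
  proof -
    obtain s where s: "init_word n x = init_word n (\<lambda>i. u (s + i))" using hullD[OF x] by blast
    then have "x \<in> ph m (s mod q ^ m)" unfolding ph_def using x init_word_eq_mono[OF s n] by blast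
    then show ?thesis using s by blast
  qed
  have ph_unique: "s mod q ^ m = r" if "x \<in> ph m r" "init_word n x = init_word n (\<lambda>i. u (s + i))" "4 * L * q ^ m \<le> n" for x m r s n
    using that(1) unique[OF _ init_word_eq_mono[OF that(2,3)] order_refl] unfolding ph_def by auto
  have ph_shift: "{x \<in> X. word_shift x \<in> ph m (Suc r mod q ^ m)} = ph m r" if r: "r < q ^ m" for m r
  proof -
    let ?N = "4 * L * q ^ m"
    \<comment> \<open>Prefixes are taken one letter longer, so that \<open>?N\<close> letters
      survive the shift.\<close>
    have step: "r' < q ^ m \<and> x \<in> ph m r' \<and> (\<forall>c. word_shift x \<in> ph m c \<longleftrightarrow> c = Suc r' mod q ^ m)"
      if x: "x \<in> X" and s: "init_word (Suc ?N) x = init_word (Suc ?N) (\<lambda>i. u (s + i))" "r' = s mod q ^ m" for x s r'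
    proof -
      have sx: "init_word ?N (word_shift x) = init_word ?N (\<lambda>i. u (Suc s + i))"
        using s(1) by (auto simp: init_word_eq_iff word_shift_def)
      have "r' < q ^ m" using q_pos s(2) by simp
      moreover have "x \<in> ph m r'" unfolding ph_def using x s init_word_eq_mono[OF s(1), of ?N] by auto
      moreover have "word_shift x \<in> ph m (Suc s mod q ^ m)" unfolding ph_def using shift_in_X[OF x] sx by blast
      moreover have "c = Suc s mod q ^ m" if "word_shift x \<in> ph m c" for c
        using ph_unique[OF that sx] by simp
      moreover have "Suc r' mod q ^ m = Suc s mod q ^ m" by (simp add: s(2) mod_Suc_eq)
      ultimately show ?thesis by metis
    qed
    show ?thesis
    proof (intro equalityI subsetI)
      fix x assume x: "x \<in> {x \<in> X. word_shift x \<in> ph m (Suc r mod q ^ m)}"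
      obtain s where s: "init_word (Suc ?N) x = init_word (Suc ?N) (\<lambda>i. u (s + i))" using x hullD[of x u "Suc ?N"] by blast
      from step[OF _ s refl] x have h: "x \<in> ph m (s mod q ^ m)" "Suc r mod q ^ m = Suc (s mod q ^ m) mod q ^ m" by auto
      then have "[r + 1 = s mod q ^ m + 1] (mod q ^ m)" by (simp add: cong_def)
      then have "[r = s mod q ^ m] (mod q ^ m)" by (simp only: cong_add_rcancel_nat)
      then have "r = s mod q ^ m" using r by (simp add: cong_def)
      then show "x \<in> ph m r" using h by simp
    next
      fix x assume x: "x \<in> ph m r"
      then have xX: "x \<in> X" by (simp add: ph_def)
      obtain s where s: "init_word (Suc ?N) x = init_word (Suc ?N) (\<lambda>i. u (s + i))" using hullD[OF xX, of "Suc ?N"] by blast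
      have "s mod q ^ m = r" by (rule ph_unique[OF x s]) simp
      then show "x \<in> {x \<in> X. word_shift x \<in> ph m (Suc r mod q ^ m)}" using step[OF xX s refl] xX by auto
    qed
  qed
  have ph_measure: "measure \<mu> (ph m r) = 1 / q ^ m" if r: "r < q ^ m" for m r
  proof -
    have const: "r < q ^ m \<Longrightarrow> measure \<mu> (ph m r) = measure \<mu> (ph m 0)" for r
    proof (induction r)
      case (Suc r)
      have "emeasure \<mu> (ph m (Suc r)) = emeasure \<mu> {x \<in> X. word_shift x \<in> ph m (Suc r)}"
        by (rule emeasure_shift[OF ph_sets, symmetric])
      also have "\<dots> = emeasure \<mu> (ph m r)" using ph_shift[of r m] Suc.prems by simp
      finally show ?case using Suc by (simp add: measure_def)
    qed simp
    have "X = (\<Union>r\<in>{..<q ^ m}. ph m r)"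
    proof (intro equalityI subsetI)
      fix x assume "x \<in> X"
      then obtain s where "x \<in> ph m (s mod q ^ m)" using ph_cover[OF _ order_refl] by blast
      then show "x \<in> (\<Union>r\<in>{..<q ^ m}. ph m r)" using q_pos by auto
    qed (auto simp: ph_def)
    then have "1 = measure \<mu> (\<Union>r\<in>{..<q ^ m}. ph m r)" using mu.prob_space by (simp add: space_mu)
    also have "\<dots> = (\<Sum>r<q ^ m. measure \<mu> (ph m r))"
    proof (rule mu.finite_measure_finite_Union)
      show "disjoint_family_on (ph m) {..<q ^ m}" unfolding disjoint_family_on_def
      proof (intro ballI impI, rule ccontr)
        fix r r' assume "r \<noteq> r'" "ph m r \<inter> ph m r' \<noteq> {}"
        then obtain x where x: "x \<in> ph m r" "x \<in> ph m r'" by blast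
        then obtain s where "s mod q ^ m = r" "init_word (4 * L * q ^ m) x = init_word (4 * L * q ^ m) (\<lambda>i. u (s + i))"
          by (auto simp: ph_def)
        then show False using ph_unique[OF x(2)] \<open>r \<noteq> r'\<close> by auto
      qed
    qed (use ph_sets in auto)
    also have "\<dots> = (\<Sum>r<q ^ m. measure \<mu> (ph m 0))" by (rule sum.cong) (auto intro: const)
    also have "\<dots> = q ^ m * measure \<mu> (ph m 0)" by simp
    finally show ?thesis using const[OF r] q_pos by (simp add: field_simps)
  qed
  \<comment> \<open>Different phases force distance at least \<open>1 / C\<close>; the extra factor
    2 keeps the exceptional set below measure one half.\<close>
  define \<epsilon>0 where "\<epsilon>0 = 1 / (2 * real C)"
  have \<epsilon>0: "0 < \<epsilon>0" "\<epsilon>0 \<le> 1 / 2" using L(2) by (auto simp: \<epsilon>0_def field_simps)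
  \<comment> \<open>Combines \<open>n < 4 * L * q ^ Suc m\<close>, from the choice of
    \<open>m\<close>, with \<open>q ^ m \<le> 2 * k\<close>, which holds because \<open>k\<close>
    sets of measure at most \<open>1 / q ^ m\<close> fill at least half of the space.\<close>
  define B where "B = 8 * real L * real q"
  have "0 < B" using L(1) q_pos by (simp add: B_def)
  have main: "real n / B \<le> real k" if \<epsilon>: "0 < \<epsilon>" "\<epsilon> < \<epsilon>0" and n: "4 * L \<le> n"
    and P: "eps_partition (completion \<mu>) (semimetric_avg word_shift n cut_semimetric) \<epsilon> k P" for n \<epsilon> k P
  proof -
    define E where "E = (\<lambda>m. 4 * L * q ^ m \<le> n)"
    obtain b where b: "n \<le> q ^ b" using power_unbounded by blast
    have bound: "m \<le> b" if "E m" for m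
    proof (rule ccontr)
      assume "\<not> m \<le> b"
      then have "q ^ b < q ^ m" using q_ge_2 by (intro power_strict_increasing) auto
      also have "q ^ m \<le> 4 * L * q ^ m" using L(1) by simp
      finally show False using that b by (simp add: E_def)
    qed
    have "E 0" using n by (simp add: E_def)
    \<comment> \<open>The finest phases that words of length \<open>n\<close> are guaranteed to
      resolve.\<close>
    define m where "m = (GREATEST m. E m)"
    have m: "4 * L * q ^ m \<le> n" using GreatestI_nat[of E 0 b] \<open>E 0\<close> bound by (auto simp: m_def E_def)
    have "\<not> E (Suc m)" using Greatest_le_nat[of E "Suc m" b] bound by (auto simp: m_def)
    then have n_less: "n < 4 * L * q ^ Suc m" by (simp add: E_def)
    have n_pos: "0 < n" using n L(1) by simp
    have sP: "P j \<in> sets (completion \<mu>)" if "j \<le> k" for j using P that by (auto simp: eps_partition_def)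
    have small: "measure (completion \<mu>) (P j) \<le> 1 / q ^ m" if j: "j \<in> {1..k}" for j
    proof (cases "P j = {}")
      case False
      then obtain x where x: "x \<in> P j" by blast
      have PX: "P j \<subseteq> X" using sets.sets_into_space[OF sP[of j]] j by (auto simp: space_mu)
      have "x \<in> X" using x PX by blast
      then obtain s where s: "init_word n x = init_word n (\<lambda>i. u (s + i))" using ph_cover[OF _ m] by blast
      have "P j \<subseteq> ph m (s mod q ^ m)"
      proof
        fix y assume y: "y \<in> P j"
        have "y \<in> X" using y PX by blast
        then obtain t where t: "init_word n y = init_word n (\<lambda>i. u (t + i))" "y \<in> ph m (t mod q ^ m)" using ph_cover[OF _ m] by blast
        have "semimetric_diam (semimetric_avg word_shift n cut_semimetric) (P j) < ennreal \<epsilon>"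
          using P j by (simp add: eps_partition_def)
        from semimetric_diam_bound[OF x y this \<epsilon>(1)] have "real (card {i. i < n \<and> x i \<noteq> y i}) / n < \<epsilon>"
          by (simp add: semimetric_avg_cut)
        then have "real (card {i. i < n \<and> x i \<noteq> y i}) / n < 1 / (2 * real C)" using \<epsilon>(2) by (simp add: \<epsilon>0_def)
        then have "2 * real C * real (card {i. i < n \<and> x i \<noteq> y i}) < real n" using n_pos L(2) by (simp add: field_simps)
        moreover have "card {i. i < n \<and> quot (s + i) \<noteq> quot (t + i)} \<le> card {i. i < n \<and> x i \<noteq> y i}"
          by (rule card_mono) (use s t(1) in \<open>auto simp: init_word_eq_iff quot_def\<close>)
        ultimately have "\<not> n \<le> C * card {i. i < n \<and> quot (s + i) \<noteq> quot (t + i)}"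
        proof -
          assume a: "2 * real C * real (card {i. i < n \<and> x i \<noteq> y i}) < real n"
            and le: "card {i. i < n \<and> quot (s + i) \<noteq> quot (t + i)} \<le> card {i. i < n \<and> x i \<noteq> y i}"
          have "2 * (C * card {i. i < n \<and> x i \<noteq> y i}) < n"

          proof -
            have "real (2 * (C * card {i. i < n \<and> x i \<noteq> y i})) < real n" using a by (simp add: mult.assoc)
            then show ?thesis by (simp only: of_nat_less_iff)
          qed
          moreover have "C * card {i. i < n \<and> quot (s + i) \<noteq> quot (t + i)} \<le> C * card {i. i < n \<and> x i \<noteq> y i}"
            using le by (rule mult_le_mono2)
          ultimately show ?thesis by linarith
        qed
        then have "s mod q ^ m = t mod q ^ m" using L(3)[OF _ m] by blast
        then show "y \<in> ph m (s mod q ^ m)" using t(2) by simp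
      qed
      then have "measure (completion \<mu>) (P j) \<le> measure (completion \<mu>) (ph m (s mod q ^ m))"
        using ph_sets by (intro cmu.finite_measure_mono) auto
      also have "\<dots> = measure \<mu> (ph m (s mod q ^ m))" using ph_sets by simp
      also have "\<dots> = 1 / q ^ m" using q_pos by (intro ph_measure) simp
      finally show ?thesis .
    qed simp
    have "1 = measure (completion \<mu>) (\<Union>j\<in>{..k}. P j)"
      using P cmu.prob_space by (simp add: eps_partition_def)
    also have "\<dots> \<le> (\<Sum>j\<in>{..k}. measure (completion \<mu>) (P j))"
      by (rule cmu.finite_measure_subadditive_finite) (use sP in auto)
    also have "\<dots> = measure (completion \<mu>) (P 0) + (\<Sum>j\<in>{1..k}. measure (completion \<mu>) (P j))"
      by (simp add: sum.atMost_shift sum.atLeast1_atMost_eq atLeast0AtMost lessThan_Suc_atMost lessThan_atLeast0)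
    also have "\<dots> \<le> 1 / 2 + (\<Sum>j\<in>{1..k}. 1 / real q ^ m)"
    proof (rule add_mono)
      have "emeasure (completion \<mu>) (P 0) < ennreal \<epsilon>" using P unfolding eps_partition_def by blast
      then have "measure (completion \<mu>) (P 0) < \<epsilon>" 
        unfolding cmu.emeasure_eq_measure by (simp add: ennreal_less_iff)
      then show "measure (completion \<mu>) (P 0) \<le> 1 / 2" using \<epsilon>(2) \<epsilon>0(2) by linarith
    qed (intro sum_mono, use small in simp)
    also have "\<dots> = 1 / 2 + real k / real q ^ m" by simp
    finally have "1 / 2 \<le> real k / real q ^ m" by linarith
    then have "real q ^ m \<le> 2 * real k" using q_pos by (simp add: field_simps)
    moreover have "real n \<le> 4 * real L * (real q * real q ^ m)"
      using of_nat_mono[OF less_imp_le[OF n_less], where 'a = real] by simp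
    ultimately have "real n \<le> 4 * real L * (real q * (2 * real k))"
      by (elim order_trans) (intro mult_left_mono, auto)
    then show ?thesis using \<open>0 < B\<close> by (simp add: B_def field_simps)
  qed
  have "ereal (log 2 (real n / B)) \<le> entropy n \<epsilon>" if "0 < \<epsilon>" "\<epsilon> < \<epsilon>0" "4 * L \<le> n" for n \<epsilon>
    by (rule eps_entropy_ge) (use that main L(1) \<open>0 < B\<close> in auto)
  then have "\<forall>\<epsilon>>0. \<epsilon> < \<epsilon>0 \<longrightarrow> (\<forall>\<^sub>F n in sequentially. ereal (log 2 (real n / B)) \<le> entropy n \<epsilon>)"
    by (auto intro!: eventually_mono[OF eventually_ge_at_top[of "4 * L"]])
  then show ?thesis using \<epsilon>0(1) \<open>0 < B\<close> by blast
qed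

end

section \<open>The length of the substitution and comparison with the scale\<close>

text \<open>For \<open>q = 0\<close> all images are empty, contrary to injectivity. For
  \<open>q = 1\<close> the letter \<alpha> is mapped to itself, so its iterates contain no other
  letter, contrary to primitivity.\<close>

lemma substitution_length_ge_2:
  fixes \<xi> :: "'a::finite \<Rightarrow> 'a list"
  assumes "CARD('a) > 1" and len: "constant_length q \<xi>" and "inj \<xi>" and prim: "primitive_subst \<xi>"
    and hd: "hd (\<xi> \<alpha>) = \<alpha>"
  shows "2 \<le> q"
proof (rule ccontr)
  assume "\<not> 2 \<le> q"
  then consider "q = 0" | "q = 1" by linarith
  then have "a = b" for a b :: 'a
  proof cases
    case 1
    then have "\<xi> a = \<xi> b" using len by (simp add: constant_length_def)
    then show ?thesis using \<open>inj \<xi>\<close> by (rule injD[rotated])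
  next
    case 2
    then have "length (\<xi> \<alpha>) = 1" using len by (simp add: constant_length_def)
    then have \<xi>\<alpha>: "\<xi> \<alpha> = [\<alpha>]" using hd by (cases "\<xi> \<alpha>") auto
    have "subst_iter \<xi> n \<alpha> = [\<alpha>]" for n
    proof (induction n)
      case (Suc n)
      have "subst_iter \<xi> (Suc n) \<alpha> = subst_word \<xi> (subst_iter \<xi> n \<alpha>)" by (simp add: subst_iter_def)
      then show ?case using Suc \<xi>\<alpha> by (simp add: subst_word_def)
    qed (simp add: subst_iter_def)
    then have all: "c = \<alpha>" for c using prim unfolding primitive_subst_def by (metis empty_iff empty_set set_ConsD)
    show ?thesis using all[of a] all[of b] by simp
  qed
  then have "(UNIV :: 'a set) \<subseteq> {\<alpha>}" by auto
  then have "CARD('a) \<le> card {\<alpha>}" by (intro card_mono) auto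
  then show False using assms(1) by simp
qed

context substitution_system
begin

definition scale :: "nat \<Rightarrow> real" where
  "scale n = 1 + (real colnum - real ht) * ln (real n)"

lemma scale_pos: "1 \<le> n \<Longrightarrow> 0 < scale n"
  unfolding scale_def using height_le_colnum by (simp add: add_pos_nonneg)

lemma limsup_entropy:
  assumes \<epsilon>: "0 < \<epsilon>" shows "limsup (\<lambda>n. entropy n \<epsilon> / ereal (scale n)) < \<infinity>"
proof -
  have "\<exists>B::real. \<forall>\<^sub>F n in sequentially. entropy n \<epsilon> / ereal (scale n) \<le> ereal B"
  proof (cases "colnum = ht")
    case True
    obtain k :: nat where "\<forall>\<^sub>F n in sequentially. entropy n \<epsilon> \<le> ereal (log 2 k)"
      using entropy_bounded[OF True \<epsilon>] by blast
    moreover have "scale n = 1" for n by (simp add: scale_def True)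
    ultimately show ?thesis by (auto simp flip: one_ereal_def)
  next
    case False
    define D where "D = real colnum - real ht"
    have D: "1 \<le> D" using False height_le_colnum by (simp add: D_def)
    define C where "C = real (CARD('a)\<^sup>2 * q)"
    have C: "1 \<le> C" unfolding C_def using q_pos by (simp add: Suc_le_eq del: of_nat_mult of_nat_power)
    \<comment> \<open>Uses \<open>1 \<le> scale n\<close> for the constant term and
      \<open>ln n \<le> scale n\<close> for the logarithm; the latter holds because the integers
      \<open>colnum\<close> and \<open>ht\<close> differ by at least 1.\<close>
    define B where "B = log 2 C + 1 / ln 2"
    have "entropy n \<epsilon> / ereal (scale n) \<le> ereal B" if n: "1 \<le> n" for n
    proof -
      have "0 < scale n" by (rule scale_pos[OF n])
      have ln: "0 \<le> ln (real n)" using n by simp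
      have "entropy n \<epsilon> / ereal (scale n) \<le> ereal (log 2 (C * real n)) / ereal (scale n)"
        using entropy_le_log_complexity[OF \<epsilon> n] \<open>0 < scale n\<close> unfolding C_def
        by (intro ereal_divide_right_mono) auto
      also have "\<dots> = ereal (log 2 (C * real n) / scale n)" using \<open>0 < scale n\<close> by simp
      also have "log 2 (C * real n) / scale n \<le> B"
      proof -
        have "ln (real n) \<le> D * ln (real n)" using mult_right_mono[OF D ln] by simp
        then have s: "1 \<le> scale n" "ln (real n) \<le> scale n" using ln unfolding scale_def D_def[symmetric] by linarith+
        have "log 2 (C * real n) = log 2 C + ln (real n) / ln 2" 
          using C n by (simp add: log_def ln_mult add_divide_distrib)
        also have "\<dots> \<le> log 2 C * scale n + scale n / ln 2"
          using s C by (intro add_mono divide_right_mono) (auto simp: mult_le_cancel_left1)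
        also have "\<dots> = B * scale n" by (simp add: B_def algebra_simps)
        finally show ?thesis using \<open>0 < scale n\<close> by (simp add: divide_le_eq)
      qed
      finally show ?thesis by simp
    qed
    then have "\<forall>\<^sub>F n in sequentially. entropy n \<epsilon> / ereal (scale n) \<le> ereal B"
      by (rule eventually_mono[OF eventually_ge_at_top[of 1]])
    then show ?thesis by blast
  qed
  then obtain B :: real where "\<forall>\<^sub>F n in sequentially. entropy n \<epsilon> / ereal (scale n) \<le> ereal B" by blast
  then have "limsup (\<lambda>n. entropy n \<epsilon> / ereal (scale n)) \<le> ereal B" by (rule Limsup_bounded)
  also have "\<dots> < \<infinity>" by simp
  finally show ?thesis .
qed

lemma liminf_entropy:
  "\<exists>\<epsilon>0>0. \<forall>\<epsilon>>0. \<epsilon> < \<epsilon>0 \<longrightarrow> 0 < liminf (\<lambda>n. entropy n \<epsilon> / ereal (scale n))"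
proof -
  have "\<exists>\<epsilon>0>0. \<exists>b>0. \<forall>\<epsilon>>0. \<epsilon> < \<epsilon>0 \<longrightarrow> (\<forall>\<^sub>F n in sequentially. ereal b \<le> entropy n \<epsilon> / ereal (scale n))"
  proof (cases "colnum = ht")
    case True
    then have "scale n = 1" for n by (simp add: scale_def)
    then have "entropy n \<epsilon> / ereal (scale n) = entropy n \<epsilon>" for n \<epsilon> by (simp flip: one_ereal_def)
    moreover obtain \<epsilon>0 :: real where "0 < \<epsilon>0"
      "\<And>\<epsilon>. 0 < \<epsilon> \<Longrightarrow> \<epsilon> < \<epsilon>0 \<Longrightarrow> \<forall>\<^sub>F n in sequentially. 1 \<le> entropy n \<epsilon>"
      using entropy_ge_1 by blast
    ultimately show ?thesis
      by (intro exI[of _ \<epsilon>0] conjI exI[of _ "1::real"]) (simp_all flip: one_ereal_def)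
  next
    case False
    define D where "D = real colnum - real ht"
    have D: "1 \<le> D" using False height_le_colnum by (simp add: D_def)
    obtain \<epsilon>0 B where \<epsilon>0: "0 < \<epsilon>0" and B: "0 < B"
      and low: "\<And>\<epsilon>. 0 < \<epsilon> \<Longrightarrow> \<epsilon> < \<epsilon>0 \<Longrightarrow> \<forall>\<^sub>F n in sequentially. ereal (log 2 (real n / B)) \<le> entropy n \<epsilon>"
      using entropy_ge_log[OF le_neq_implies_less[OF height_le_colnum not_sym[OF False]]] by blast
    \<comment> \<open>Eventually the entropy is at least \<open>ln n / 2\<close>, while the scale is
      at most \<open>(1 + D) * ln n\<close>; the first holds once
      \<open>ln n \<ge> 2 * ln B\<close>, the second once \<open>ln n \<ge> 1\<close>.\<close>
    define b where "b = 1 / (2 * (1 + D))"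
    have "0 < b" using D by (simp add: b_def)
    have "filterlim (\<lambda>n. ln (real n)) at_top sequentially" by real_asymp
    then have "\<forall>\<^sub>F n in sequentially. max 1 (2 * ln B) \<le> ln (real n)"
      unfolding filterlim_at_top by blast
    then have ev: "\<forall>\<^sub>F n in sequentially. ereal b \<le> ereal (log 2 (real n / B)) / ereal (scale n)"
      using eventually_ge_at_top[of 1]
    proof eventually_elim
      case (elim n)
      have pos: "0 < scale n" using elim by (intro scale_pos) simp
      have ln_quotient: "ln (real n / B) = ln (real n) - ln B" using elim(2) B by (simp add: ln_div)
      have "ln (real n) / 2 \<le> ln (real n / B)" using elim unfolding ln_quotient by linarith
      also have "\<dots> \<le> ln (real n / B) / ln 2"
      proof -
        have "0 \<le> ln (real n / B)" using elim unfolding ln_quotient by linarith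
        moreover have "ln 2 \<le> (1 :: real)" using ln_2_less_1 by simp
        ultimately show ?thesis by (simp add: le_divide_eq mult_left_le)
      qed
      also have "\<dots> = log 2 (real n / B)" by (simp add: log_def)
      finally have "ln (real n) / 2 \<le> log 2 (real n / B)" .
      moreover have "b * scale n \<le> ln (real n) / 2"
      proof -
        have "scale n \<le> (1 + D) * ln (real n)" using elim unfolding scale_def D_def[symmetric] by (simp add: distrib_right)
        then show ?thesis using D by (simp add: b_def field_simps)
      qed
      ultimately have "b \<le> log 2 (real n / B) / scale n" using pos by (simp add: le_divide_eq)
      then show ?case using pos by simp
    qed
    have "\<forall>\<^sub>F n in sequentially. ereal b \<le> entropy n \<epsilon> / ereal (scale n)" if "0 < \<epsilon>" "\<epsilon> < \<epsilon>0" for \<epsilon>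
      using low[OF that] ev eventually_ge_at_top[of 1]
    proof eventually_elim
      case (elim n)
      have "ereal (log 2 (real n / B)) / ereal (scale n) \<le> entropy n \<epsilon> / ereal (scale n)"
        using elim scale_pos[of n] by (intro ereal_divide_right_mono) auto
      with elim(2) show ?case by (rule order_trans)
    qed
    then show ?thesis using \<epsilon>0 \<open>0 < b\<close> by blast
  qed
  then obtain \<epsilon>0 b :: real where "0 < \<epsilon>0" "0 < b"
    and low: "\<And>\<epsilon>. 0 < \<epsilon> \<Longrightarrow> \<epsilon> < \<epsilon>0 \<Longrightarrow> \<forall>\<^sub>F n in sequentially. ereal b \<le> entropy n \<epsilon> / ereal (scale n)" by blast
  have "0 < liminf (\<lambda>n. entropy n \<epsilon> / ereal (scale n))" if "0 < \<epsilon>" "\<epsilon> < \<epsilon>0" for \<epsilon>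
  proof -
    have "0 < ereal b" using \<open>0 < b\<close> by simp
    also have "\<dots> \<le> liminf (\<lambda>n. entropy n \<epsilon> / ereal (scale n))" by (rule Liminf_bounded[OF low[OF that]])
    finally show ?thesis .
  qed
  then show ?thesis using \<open>0 < \<epsilon>0\<close> by blast
qed

lemma scaling_entropy_scale: "scaling_entropy_sequence (completion \<mu>) word_shift scale"
  unfolding scaling_entropy_sequence_def
proof (intro conjI exI)
  show "\<forall>n\<ge>1. 0 < scale n" using scale_pos by blast
  show "scaling_sequence (completion \<mu>) word_shift cut_semimetric scale"
    unfolding scaling_sequence_def eventually_at_right_field
    using limsup_entropy liminf_entropy by blast
qed (rule cut_summable cut_admissible cut_generating)+

end

theorem theorem6:
  fixes q :: nat and \<xi> :: "'a::finite \<Rightarrow> 'a list" and \<alpha> :: 'a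
    and u :: "nat \<Rightarrow> 'a" and \<mu> :: "(nat \<Rightarrow> 'a) measure"
  assumes "CARD('a) > 1"
    and "constant_length q \<xi>"
    and "inj \<xi>"
    and "primitive_subst \<xi>"
    and "hd (\<xi> \<alpha>) = \<alpha>"
    and "u 0 = \<alpha>"
    and "subst_inf \<xi> u = u"
    and "invariant_borel_prob word_topology (orbit_closure u) word_shift \<mu>"
  shows "scaling_entropy_sequence (completion \<mu>) word_shift
           (\<lambda>n. 1 + (real (column_number q \<xi>) - real (subst_height q u)) * ln (real n))"
proof -
  interpret substitution_system q \<xi> u \<mu>
    using assms substitution_length_ge_2[OF assms(1-5)] by unfold_locales
  show ?thesis using scaling_entropy_scale unfolding scale_def .
qed

end
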